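(* Let $t>0$ and let $$A_x(x,y,t)=\iint_{\mathbb{R}^2}i\xi\,e^{i(t\xi^3+t\xi\eta^2+x\xi+y\eta)}\,d\xi\,d\eta .$$ Let $\lambda=|x|^{3/2}t^{-1/2}>0$ and $z=y|x|^{-1}$. Then for $x>0$, $$|A_x(x,y,t)|\lesssim_{\alpha,\beta}t^{-1}\begin{cases}\langle\lambda\rangle^{-\alpha}&\text{if }|z|\le 4,\ \text{for any }\alpha\ge 0,\\ \langle\lambda|z|^{3/2}\rangle^{-\beta}&\text{if }|z|\ge 4,\ \text{for any }\beta\ge 0,\end{cases}$$ and for $x<0$, $$|A_x(x,y,t)|\lesssim_{\beta}t^{-1}\begin{cases}\langle\lambda\rangle^{1/6}&\text{if }|z|\le 4,\\ \langle\lambda|z|^{3/2}\rangle^{-\beta}&\text{if }|z|\ge 4,\ \text{for any }\beta\ge 0.\end{cases}$$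
   Context: The integral is understood as an oscillatory integral; $A_x$ is the $x$-derivative of the smooth function $A(x,y,t)=\iint_{\mathbb{R}^2}e^{i(t\xi^3+t\xi\eta^2+x\xi+y\eta)}\,d\xi\,d\eta$ (inverse Fourier transform, without normalizing constant, of $e^{it(\xi^3+\xi\eta^2)}$, $t>0$). $\langle a\rangle=(1+a^2)^{1/2}$. $\lesssim_{\alpha,\beta}$ denotes an inequality up to a multiplicative constant depending only on $\alpha,\beta$ (not on $x,y,t$). *)

theory Defs
  imports "HOL-Analysis.Analysis"
begin

text \<open>Complex-valued \<open>C\<^sup>\<infinity>\<close> functions on the plane: \<open>D i j\<close> is the partial derivative of order
  \<open>i\<close> in the first and \<open>j\<close> in the second variable. All of them are required to be Frechet
  differentiable, so all of them are continuous.\<close>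

definition smooth_on_plane :: "(real \<times> real \<Rightarrow> complex) \<Rightarrow> bool" where
  "smooth_on_plane \<psi> \<longleftrightarrow>
     (\<exists>D :: nat \<Rightarrow> nat \<Rightarrow> real \<times> real \<Rightarrow> complex.
        D 0 0 = \<psi> \<and>
        (\<forall>i j p. (D i j has_derivative
                   (\<lambda>h. fst h *\<^sub>R D (Suc i) j p + snd h *\<^sub>R D i (Suc j) p)) (at p)))"

definition test_function :: "(real \<times> real \<Rightarrow> complex) \<Rightarrow> bool" where
  "test_function \<psi> \<longleftrightarrow> smooth_on_plane \<psi> \<and> compact (closure {p. \<psi> p \<noteq> 0})"

text \<open>The oscillatory integral of \<open>a e\<^sup>i\<^sup>\<phi>\<close> over the plane: the amplitude is multiplied by a cutoff
  \<open>\<psi>(\<epsilon> p)\<close> with \<open>\<psi>\<close> a test function, \<open>\<psi>(0) = 1\<close>, and \<open>\<epsilon>\<close> tends to \<open>0\<close>. The limit has to exist for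
  every \<open>\<psi>\<close> and must not depend on \<open>\<psi>\<close>.\<close>

definition has_oscillatory_integral ::
    "(real \<times> real \<Rightarrow> complex) \<Rightarrow> (real \<times> real \<Rightarrow> real) \<Rightarrow> complex \<Rightarrow> bool" where
  "has_oscillatory_integral a \<phi> I \<longleftrightarrow>
     (\<forall>\<psi>. test_function \<psi> \<and> \<psi> 0 = 1 \<longrightarrow>
        ((\<lambda>\<epsilon>. LINT p|lborel. \<psi> (\<epsilon> *\<^sub>R p) * a p * exp (\<i> * complex_of_real (\<phi> p))) \<longlongrightarrow> I)
          (at_right 0))"

definition oscillatory_integral ::
    "(real \<times> real \<Rightarrow> complex) \<Rightarrow> (real \<times> real \<Rightarrow> real) \<Rightarrow> complex" where
  "oscillatory_integral a \<phi> = (THE I. has_oscillatory_integral a \<phi> I)"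

definition phase :: "real \<Rightarrow> real \<Rightarrow> real \<Rightarrow> real \<times> real \<Rightarrow> real" where
  "phase x y t = (\<lambda>(\<xi>, \<eta>). t * \<xi> ^ 3 + t * \<xi> * \<eta> ^ 2 + x * \<xi> + y * \<eta>)"

definition kernelA :: "real \<Rightarrow> real \<Rightarrow> real \<Rightarrow> complex" where
  "kernelA x y t = oscillatory_integral (\<lambda>_. 1) (phase x y t)"

text \<open>The integral of the \<open>x\<close>-derivative of the integrand of \<^const>\<open>kernelA\<close>; that it equals the
  \<open>x\<close>-derivative of \<^const>\<open>kernelA\<close> is not part of the definition.\<close>

definition kernelA_x :: "real \<Rightarrow> real \<Rightarrow> real \<Rightarrow> complex" where
  "kernelA_x x y t = oscillatory_integral (\<lambda>(\<xi>, \<eta>). \<i> * complex_of_real \<xi>) (phase x y t)"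

definition japanese_bracket :: "real \<Rightarrow> real" where
  "japanese_bracket a = sqrt (1 + a ^ 2)"

end

theory Submission
  imports Defs "HOL-Computational_Algebra.Polynomial"
begin

text \<open>The substitution \<open>\<xi> = \<kappa> (a + b)\<close>, \<open>\<eta> = \<surd>3 \<kappa> (a - b)\<close> with \<open>4 t \<kappa>\<^sup>3 = 1\<close> turns the phase into
  \<open>(a\<^sup>3 + u a) + (b\<^sup>3 + v b)\<close>, where \<open>u = \<kappa> (x + \<surd>3 y)\<close> and \<open>v = \<kappa> (x - \<surd>3 y)\<close>. Hence \<open>A\<close> is a multiple of
  \<open>Ai(u) Ai(v)\<close> for an unnormalised Airy function \<open>Ai\<close>, and \<open>A\<^sub>x\<close> a multiple of
  \<open>t\<^sup>-\<^sup>1 (Ai'(u) Ai(v) + Ai(u) Ai'(v))\<close>. The estimates follow from the exponential decay of \<open>Ai\<close> and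
  \<open>Ai'\<close> on the right, which a contour shift by \<open>\<i>\<close> shows, and from the boundedness of \<open>Ai\<close> and the
  growth \<open>\<bar>u\<bar>\<^bsup>1/4\<^esup>\<close> of \<open>Ai'\<close> on the left, which come from an energy estimate for Airy's equation.

  The derivative of the phase in \<open>\<xi>\<close> is elliptic, so two integrations by parts in \<open>\<xi>\<close> make the
  oscillatory integrals absolutely convergent, with bounds that only involve the suprema of the cutoff
  and of its first two \<open>\<xi>\<close>-derivatives. Shifting \<open>\<xi>\<close> to \<open>\<xi> + \<i> \<delta>\<close> amounts to one more admissible family
  of cutoffs, and for it the integral factors and does not depend on \<open>\<delta>\<close>; this identifies the limit.\<close>

section \<open>Integrals over Euclidean spaces\<close>

text \<open>The \<xi>-derivative of the phase has order two, so each integration by parts gains two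
  orders. The amplitude has order one and integrability over the plane needs an order below -2;
  hence two integrations, which lead to order -3. Scaled test functions and the Gaussian cutoffs of
  the contour shift share little beyond the sup bounds used, so the passage to the limit is stated
  for sequences of cutoffs. The shift also turns \<xi> into \<xi> + \<i> \<delta> in the amplitude,
  which is why its constant term may vary along the sequence.

  The cases in z concern the larger Airy argument, \<kappa> (x + sqrt 3 |y|). Let r = |x| for |z|
  \<le> 4, r = |y| otherwise, and q = \<kappa> r. Both arguments are at most 8 q in modulus, and 4
  q^3 is the square of the number inside the bracket. If x > 0 or |z| \<ge> 4, the larger argument
  is at least q and its exponential decay beats the growth of the other factor. Otherwise both may
  be negative, and q^(1/4) from Ai' becomes the power (2/3)(1/4) = 1/6 of \<lambda>.\<close>

lemma lborel_integrable_translation_iff: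
  fixes f :: "'a::euclidean_space \<Rightarrow> 'b::{banach, second_countable_topology}"
  shows "integrable lborel (\<lambda>x. f (x + a)) \<longleftrightarrow> integrable lborel f"
proof -
  have 1: "integrable lborel (\<lambda>x. f (x + a))" if "integrable lborel f" for f :: "'a \<Rightarrow> 'b" and a
  proof -
    have "integrable (distr lborel borel ((+) a)) f"
      using that by (simp add: lborel_distr_plus)
    then have "integrable lborel (\<lambda>x. f (a + x))"
      using that by (subst (asm) integrable_distr_eq) auto
    then show ?thesis by (simp add: add.commute)
  qed
  show ?thesis
    using 1[of f a] 1[of "\<lambda>x. f (x + a)" "-a"] by auto
qed

lemma lborel_integral_translation:
  fixes f :: "'a::euclidean_space \<Rightarrow> 'b::{banach, second_countable_topology}"
  assumes [measurable]: "f \<in> borel_measurable borel"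
  shows "(LINT x|lborel. f (x + a)) = (LINT x|lborel. f x)"
proof -
  have "(LINT x|lborel. f x) = (LINT x|distr lborel borel ((+) a). f x)"
    by (simp add: lborel_distr_plus)
  also have "\<dots> = (LINT x|lborel. f (a + x))"
    by (subst integral_distr) auto
  finally show ?thesis by (simp add: add.commute)
qed

text \<open>Integrate \<open>f (p + e) - f p\<close>, the integral of \<open>f'\<close> over a segment: its integral over
  the space vanishes by translation invariance, so that no decay at infinity enters.\<close>

lemma integral_directional_derivative_eq_0:
  fixes f f' :: "'a::euclidean_space \<Rightarrow> 'b::euclidean_space"
  assumes f: "integrable lborel f" and f': "integrable lborel f'" "continuous_on UNIV f'"
    and deriv: "\<And>p. ((\<lambda>s. f (p + s *\<^sub>R e)) has_vector_derivative f' p) (at 0)"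
  shows "(LINT p|lborel. f' p) = 0"
proof -
  define F where "F = (\<lambda>(s::real, p). indicator {0..1::real} s *\<^sub>R f' (p + s *\<^sub>R e))"
  have [measurable]: "f' \<in> borel_measurable borel" "f \<in> borel_measurable borel"
    using f f' by auto
  have "continuous_on UNIV (\<lambda>q::real \<times> 'a. f' (snd q + fst q *\<^sub>R e))"
    by (intro continuous_on_compose2[OF f'(2)] continuous_intros) auto
  then have [measurable]: "(\<lambda>q::real \<times> 'a. f' (snd q + fst q *\<^sub>R e)) \<in> borel_measurable (lborel \<Otimes>\<^sub>M lborel)"
    by (simp add: lborel_prod borel_measurable_continuous_onI)
  have Fm [measurable]: "F \<in> borel_measurable (lborel \<Otimes>\<^sub>M lborel)"
    unfolding F_def split_beta by measurable
  have F_int: "integrable (lborel \<Otimes>\<^sub>M lborel) F"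
  proof (rule lborel_pair.Fubini_integrable[OF Fm])
    have "(LINT p|lborel. norm (F (s, p))) = indicator {0..1} s * (LINT p|lborel. norm (f' p))" for s
      using lborel_integral_translation[of "\<lambda>p. norm (f' p)" "s *\<^sub>R e"]
      by (simp add: F_def)
    then show "integrable lborel (\<lambda>s. LINT p|lborel. norm (F (s, p)))"
      by (simp add: integrable_real_mult_indicator)
    show "AE s in lborel. integrable lborel (\<lambda>p. F (s, p))"
      using f' by (auto simp: F_def lborel_integrable_translation_iff intro!: integrable_scaleR_right AE_I2)
  qed
  have seg: "((\<lambda>s. f (p + s *\<^sub>R e)) has_vector_derivative f' (p + s *\<^sub>R e)) (at s within A)" for p s A
  proof -
    have "((\<lambda>h. f (p + s *\<^sub>R e + h *\<^sub>R e)) \<circ> (\<lambda>h. h - s) has_vector_derivative 1 *\<^sub>R f' (p + s *\<^sub>R e)) (at s)"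
      by (rule vector_diff_chain_at) (auto intro!: derivative_eq_intros deriv)
    then show ?thesis
      by (simp add: o_def algebra_simps has_vector_derivative_at_within)
  qed
  have "(LINT s|lborel. F (s, p)) = f (p + e) - f p" for p
  proof -
    have "continuous_on {0..1} (\<lambda>s::real. f' (p + s *\<^sub>R e))"
      by (intro continuous_on_compose2[OF f'(2)] continuous_intros) auto
    from has_bochner_integral_FTC_Icc[of 0 1 "\<lambda>s. f (p + s *\<^sub>R e)", OF _ seg this]
    show ?thesis
      by (simp add: F_def has_bochner_integral_integral_eq)
  qed
  moreover have "(LINT p|lborel. f (p + e) - f p) = 0"
    using f lborel_integral_translation[of f e] by (simp add: lborel_integrable_translation_iff)
  ultimately have "0 = (LINT p|lborel. LINT s|lborel. F (s, p))"
    by simp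
  \<comment> \<open>After the swap the inner integral is the same for every \<open>s\<close>, by
    translation invariance, and the interval has length one.\<close>
  also have "\<dots> = (LINT s|lborel. LINT p|lborel. F (s, p))"
    using lborel_pair.Fubini_integral[of "\<lambda>s p. F (s, p)"] F_int by simp
  also have "\<dots> = (LINT s|lborel. indicator {0..1::real} s *\<^sub>R (LINT p|lborel. f' p))"
    by (simp add: F_def lborel_integral_translation)
  also have "\<dots> = (LINT p|lborel. f' p)"
    by simp
  finally show ?thesis ..
qed

section \<open>Differentiation under the integral sign\<close>

lemma has_vector_derivative_iff_quotient:
  "(f has_vector_derivative D) (at x) \<longleftrightarrow> ((\<lambda>h. (f (x + h) - f x) /\<^sub>R h) \<longlongrightarrow> D) (at 0)"
proof -
  have "(f has_vector_derivative D) (at x) \<longleftrightarrow>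
      ((\<lambda>h. norm (f (x + h) - f x - h *\<^sub>R D) / norm h) \<longlongrightarrow> 0) (at 0)"
    by (simp add: has_vector_derivative_def has_derivative_at bounded_linear_scaleR_left)
  also have "\<dots> \<longleftrightarrow> ((\<lambda>h. norm ((f (x + h) - f x) /\<^sub>R h - D)) \<longlongrightarrow> 0) (at 0)"
  proof (rule filterlim_cong[OF refl refl])
    have "norm (f (x + h) - f x - h *\<^sub>R D) / norm h = norm ((f (x + h) - f x) /\<^sub>R h - D)" if "h \<noteq> 0" for h
    proof -
      have "(f (x + h) - f x) /\<^sub>R h - D = (f (x + h) - f x - h *\<^sub>R D) /\<^sub>R h"
        using that by (simp add: algebra_simps)
      then show ?thesis by (simp add: divide_inverse_commute)
    qed
    then show "\<forall>\<^sub>F h in at 0. norm (f (x + h) - f x - h *\<^sub>R D) / norm h = norm ((f (x + h) - f x) /\<^sub>R h - D)"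
      by (auto simp: eventually_at_filter)
  qed
  finally show ?thesis
    by (simp add: tendsto_norm_zero_iff LIM_zero_iff)
qed

text \<open>The mean value inequality dominates the difference quotients by \<open>B\<close>, so
  dominated convergence applies along every sequence of increments.\<close>

lemma has_vector_derivative_lebesgue_integral:
  fixes f :: "real \<Rightarrow> 'a \<Rightarrow> 'b::{banach, second_countable_topology}"
  assumes e: "0 < e"
    and int: "\<And>u. \<bar>u - u0\<bar> < e \<Longrightarrow> integrable M (f u)"
    and deriv: "\<And>u r. \<bar>u - u0\<bar> < e \<Longrightarrow> r \<in> space M \<Longrightarrow> ((\<lambda>u. f u r) has_vector_derivative f' u r) (at u)"
    and bound: "\<And>u r. \<bar>u - u0\<bar> < e \<Longrightarrow> r \<in> space M \<Longrightarrow> norm (f' u r) \<le> B r"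
    and B: "integrable M B" and meas: "f' u0 \<in> borel_measurable M"
  shows "((\<lambda>u. LINT r|M. f u r) has_vector_derivative (LINT r|M. f' u0 r)) (at u0)"
proof -
  let ?F = "\<lambda>u. LINT r|M. f u r"
  have "((\<lambda>h. (?F (u0 + h) - ?F u0) /\<^sub>R h) \<longlongrightarrow> (LINT r|M. f' u0 r)) (at 0)"
    unfolding tendsto_at_iff_sequentially
  proof (intro allI impI)
    fix X :: "nat \<Rightarrow> real"
    assume X: "\<forall>i. X i \<in> UNIV - {0}" "X \<longlonglongrightarrow> 0"
    from X(2) e have "\<forall>\<^sub>F n in sequentially. \<bar>X n\<bar> < e"
      by (auto simp: tendsto_iff dist_real_def)
    then obtain N where N: "\<And>n. n \<ge> N \<Longrightarrow> \<bar>X n\<bar> < e"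
      by (auto simp: eventually_sequentially)
    \<comment> \<open>Dropping finitely many terms keeps all increments inside the neighbourhood
      where the bound holds.\<close>
    define Y where "Y n = X (n + N)" for n
    have Y: "\<bar>Y n\<bar> < e" "Y n \<noteq> 0" for n
      using N X(1) by (auto simp: Y_def)
    have Y0: "Y \<longlonglongrightarrow> 0"
      unfolding Y_def using X(2) by (rule LIMSEQ_ignore_initial_segment)
    have [measurable]: "f (u0 + Y n) \<in> borel_measurable M" "f u0 \<in> borel_measurable M" for n
      using int[of "u0 + Y n"] int[of u0] Y e by auto
    have "(\<lambda>n. LINT r|M. (f (u0 + Y n) r - f u0 r) /\<^sub>R Y n) \<longlonglongrightarrow> (LINT r|M. f' u0 r)"
    proof (rule integral_dominated_convergence[where w = B])
      show "AE r in M. (\<lambda>n. (f (u0 + Y n) r - f u0 r) /\<^sub>R Y n) \<longlonglongrightarrow> f' u0 r"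
      proof (rule AE_I2)
        fix r assume r: "r \<in> space M"
        from deriv[of u0 r] r e have "((\<lambda>h. (f (u0 + h) r - f u0 r) /\<^sub>R h) \<longlongrightarrow> f' u0 r) (at 0)"
          by (simp add: has_vector_derivative_iff_quotient)
        then show "(\<lambda>n. (f (u0 + Y n) r - f u0 r) /\<^sub>R Y n) \<longlonglongrightarrow> f' u0 r"
          using Y Y0 unfolding tendsto_at_iff_sequentially by (auto simp: o_def)
      qed
      show "AE r in M. norm ((f (u0 + Y n) r - f u0 r) /\<^sub>R Y n) \<le> B r" for n
      proof (rule AE_I2)
        fix r assume r: "r \<in> space M"
        have "norm (f (u0 + Y n) r - f u0 r) \<le> B r * norm (u0 + Y n - u0)"
        proof (rule differentiable_bound[where S = "ball u0 e" and f' = "\<lambda>u h. h *\<^sub>R f' u r"])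
          show "((\<lambda>u. f u r) has_derivative (\<lambda>h. h *\<^sub>R f' u r)) (at u within ball u0 e)" if "u \<in> ball u0 e" for u
            using deriv[of u r] that r
            by (auto simp: has_vector_derivative_def dist_real_def abs_minus_commute has_derivative_at_withinI)
          show "onorm (\<lambda>h. h *\<^sub>R f' u r) \<le> B r" if "u \<in> ball u0 e" for u
            using bound[of u r] that r
            by (auto simp: dist_real_def abs_minus_commute intro!: onorm_le) (simp add: mult.commute[of "B _"] mult_left_mono)
        qed (use Y e in \<open>auto simp: dist_real_def\<close>)
        then show "norm ((f (u0 + Y n) r - f u0 r) /\<^sub>R Y n) \<le> B r"
          using Y(2)[of n] by (simp add: divide_le_eq flip: divide_inverse_commute)
      qed
    qed (use B meas in auto)
    also have "(\<lambda>n. LINT r|M. (f (u0 + Y n) r - f u0 r) /\<^sub>R Y n) = (\<lambda>n. (?F (u0 + Y n) - ?F u0) /\<^sub>R Y n)"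
    proof
      fix n
      have "integrable M (f (u0 + Y n))" "integrable M (f u0)"
        using int Y e by auto
      then show "(LINT r|M. (f (u0 + Y n) r - f u0 r) /\<^sub>R Y n) = (?F (u0 + Y n) - ?F u0) /\<^sub>R Y n"
        by simp
    qed
    finally have "(\<lambda>n. ((\<lambda>h. (?F (u0 + h) - ?F u0) /\<^sub>R h) \<circ> X) (n + N)) \<longlonglongrightarrow> (LINT r|M. f' u0 r)"
      by (simp add: Y_def o_def)
    then show "((\<lambda>h. (?F (u0 + h) - ?F u0) /\<^sub>R h) \<circ> X) \<longlonglongrightarrow> (LINT r|M. f' u0 r)"
      by (rule LIMSEQ_offset)
  qed
  then show ?thesis
    by (simp add: has_vector_derivative_iff_quotient)
qed

text \<open>Fubini reduces a shear to an affine substitution in the second variable for each fixed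
  first one. Two shears and a swap give the coordinates in which the phase separates.\<close>

lemma
  fixes F :: "real \<times> real \<Rightarrow> 'b::{banach, second_countable_topology}"
  assumes F: "integrable lborel F" and c: "c \<noteq> 0"
  shows lborel_integrable_shear: "integrable lborel (\<lambda>(x, y). F (x, a * x + c * y))" (is ?int)
    and lborel_integral_shear: "(LINT p|lborel. F p) = \<bar>c\<bar> *\<^sub>R (LINT p|lborel. (\<lambda>(x, y). F (x, a * x + c * y)) p)" (is ?eq)
proof -
  let ?G = "\<lambda>(x, y). F (x, a * x + c * y)"
  have [measurable]: "F \<in> borel_measurable borel"
    using F by auto
  have F2: "integrable (lborel \<Otimes>\<^sub>M lborel) F"
    using F by (simp add: lborel_prod)
  have "?G \<in> borel_measurable borel"
    unfolding split_beta by (intro measurable_compose[OF _ \<open>F \<in> borel_measurable borel\<close>])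
      (simp add: borel_measurable_continuous_onI continuous_intros)
  then have Gm: "?G \<in> borel_measurable (lborel \<Otimes>\<^sub>M lborel)"
    by (simp add: lborel_prod)
  have sub: "(LINT y|lborel. f (a * x + c * y)) = (LINT y|lborel. f y) /\<^sub>R \<bar>c\<bar>"
    for f :: "real \<Rightarrow> 'c::{banach, second_countable_topology}" and x
    using lborel_integral_real_affine[OF c, of f "a * x"] c by simp
  have G: "integrable (lborel \<Otimes>\<^sub>M lborel) ?G"
  proof (rule lborel_pair.Fubini_integrable[OF Gm])
    have "(LINT y|lborel. norm (?G (x, y))) = (LINT y|lborel. norm (F (x, y))) / \<bar>c\<bar>" for x
      using sub[of "\<lambda>y. norm (F (x, y))" x] by (simp add: divide_inverse_commute)
    then show "integrable lborel (\<lambda>x. LINT y|lborel. norm (?G (x, y)))"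
      using lborel_pair.integrable_fst'[OF integrable_norm[OF F2]] by simp
    show "AE x in lborel. integrable lborel (\<lambda>y. ?G (x, y))"
      using lborel_pair.AE_integrable_fst'[OF F2]
    proof eventually_elim
      case (elim x)
      then show ?case
        using lborel_integrable_real_affine[of "\<lambda>y. F (x, y)" c "a * x"] c by simp
    qed
  qed
  then show ?int by (simp add: lborel_prod)
  have "(LINT p|lborel. ?G p) = (LINT x|lborel. LINT y|lborel. F (x, a * x + c * y))"
    using lborel_pair.integral_fst'[OF G] by (simp add: lborel_prod)
  also have "\<dots> = (LINT x|lborel. LINT y|lborel. F (x, y)) /\<^sub>R \<bar>c\<bar>"
    by (simp add: sub[of "\<lambda>y. F (_, y)"])
  also have "\<dots> = (LINT p|lborel. F p) /\<^sub>R \<bar>c\<bar>"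
    using lborel_pair.integral_fst'[OF F2] by (simp add: lborel_prod)
  finally show ?eq using c by simp
qed

section \<open>A test function\<close>

text \<open>\<open>bump n\<close> is the \<open>n\<close>-th derivative of \<open>exp (- 1 / (1 - x\<^sup>2))\<close>, extended by \<open>0\<close>; the recursion
  of its numerator comes from the quotient rule.\<close>

primrec bump_numerator :: "nat \<Rightarrow> real poly" where
  "bump_numerator 0 = 1"
| "bump_numerator (Suc n) =
     pderiv (bump_numerator n) * [:1, 0, -1:] ^ 2
     + bump_numerator n * ([:0, 4 * of_nat n:] * [:1, 0, -1:] - [:0, 2:])"

definition bump :: "nat \<Rightarrow> real \<Rightarrow> real" where
  "bump n x = (if \<bar>x\<bar> < 1
     then poly (bump_numerator n) x / (1 - x\<^sup>2) ^ (2 * n) * exp (- 1 / (1 - x\<^sup>2)) else 0)"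

text \<open>A double zero at both end points is what makes the extension by zero differentiable
  there.\<close>

lemma bump_quadratic_bound:
  obtains C where "C \<ge> 0" "\<And>x. \<bar>bump n x\<bar> \<le> C * (1 - x\<^sup>2)\<^sup>2"
proof -
  have "compact ((\<lambda>x. poly (bump_numerator n) x) ` {-1..1})"
    by (intro compact_continuous_image continuous_intros) auto
  then obtain K where K: "\<And>x. x \<in> {-1..1} \<Longrightarrow> \<bar>poly (bump_numerator n) x\<bar> \<le> K"
    by (metis bounded_iff compact_imp_bounded imageI real_norm_def)
  have K0: "K \<ge> 0"
    using K[of 0] by (simp add: order_trans[OF abs_ge_zero])
  have "\<bar>bump n x\<bar> \<le> K * fact (2 * n + 2) * (1 - x\<^sup>2)\<^sup>2" for x
  proof (cases "\<bar>x\<bar> < 1")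
    case True
    define u where "u = 1 - x\<^sup>2"
    have u: "u > 0"
      using True by (simp add: u_def abs_square_less_1)
    \<comment> \<open>A single term of the exponential series at \<open>1 / u\<close>: of its
      \<open>2 * n + 2\<close> powers, \<open>2 * n\<close> cancel the denominator of
      \<open>bump n\<close> and two remain.\<close>
    have "(1 / u) ^ (2 * n + 2) / fact (2 * n + 2) \<le> exp (1 / u)"
    proof -
      have "(1 / u) ^ (2 * n + 2) /\<^sub>R fact (2 * n + 2) \<le> (\<Sum>k. (1 / u) ^ k /\<^sub>R fact k)"
        using u sum_le_suminf[OF summable_exp_generic[of "1 / u"], of "{2 * n + 2}"] by simp
      then show ?thesis by (simp add: exp_def divide_inverse_commute)
    qed
    then have "1 / (u ^ (2 * n + 2) * fact (2 * n + 2)) \<le> exp (1 / u)"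
      by (simp only: power_one_over divide_divide_eq_left)
    then have "1 \<le> exp (1 / u) * (u ^ (2 * n + 2) * fact (2 * n + 2))"
      using u by (subst (asm) divide_le_eq) simp
    then have "exp (- (1 / u)) \<le> fact (2 * n + 2) * u ^ (2 * n + 2)"
      by (simp only: exp_minus inverse_eq_divide divide_le_eq exp_gt_zero if_True mult_ac)
    then have "exp (- (1 / u)) \<le> fact (2 * n + 2) * (u ^ (2 * n) * u\<^sup>2)"
      by (simp only: power_add)
    then have *: "exp (- (1 / u)) / u ^ (2 * n) \<le> fact (2 * n + 2) * u\<^sup>2"
      using u by (simp only: divide_le_eq zero_less_power if_True mult_ac)
    have "\<bar>bump n x\<bar> = \<bar>poly (bump_numerator n) x\<bar> * (exp (- (1 / u)) / u ^ (2 * n))"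
      using True u by (simp add: bump_def u_def[symmetric] abs_mult)
    also have "\<dots> \<le> K * (fact (2 * n + 2) * u\<^sup>2)"
      using K[of x] True u * K0 by (intro mult_mono) (auto simp: abs_less_iff)
    finally show ?thesis by (simp add: u_def)
  qed (use K0 in \<open>simp add: bump_def\<close>)
  with K0 that[of "K * fact (2 * n + 2)"] show ?thesis by simp
qed

lemma bump_has_derivative: "(bump n has_real_derivative bump (Suc n) x) (at x)"
proof (cases "\<bar>x\<bar> < 1")
  case True
  define p where "p = bump_numerator n"
  have u: "1 - x\<^sup>2 > 0"
    using True by (simp add: abs_square_less_1)
  have "((\<lambda>x. poly p x / (1 - x\<^sup>2) ^ (2 * n) * exp (- 1 / (1 - x\<^sup>2))) has_real_derivative
      bump (Suc n) x) (at x)"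
  proof -
    define v where "v = 1 - x\<^sup>2"
    \<comment> \<open>For \<open>n = 0\<close> the exponent \<open>2 * n - 1\<close> is truncated to
      0, but the factor \<open>real (2 * n)\<close> vanishes, so both sides are 0.\<close>
    have pow: "real (2 * n) * v ^ (2 * n - 1) * v = 2 * real n * v ^ (2 * n)"
      by (cases n) (simp_all add: algebra_simps)
    have "((\<lambda>x. poly p x / (1 - x\<^sup>2) ^ (2 * n) * exp (- 1 / (1 - x\<^sup>2))) has_real_derivative
      ((poly (pderiv p) x * v ^ (2 * n) - poly p x * (real (2 * n) * v ^ (2 * n - 1) * (- (2 * x)))) / (v ^ (2 * n) * v ^ (2 * n)))
       * exp (- 1 / v) + poly p x / v ^ (2 * n) * (exp (- 1 / v) * (- 2 * x / v\<^sup>2))) (at x)"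
    proof -
      have v: "v \<noteq> 0" using u by (simp add: v_def)
      have a: "((\<lambda>x. (1 - x\<^sup>2) ^ (2 * n)) has_real_derivative real (2 * n) * v ^ (2 * n - 1) * (- (2 * x))) (at x)"
        unfolding v_def by (auto intro!: derivative_eq_intros)
      have b: "((\<lambda>x. exp (- 1 / (1 - x\<^sup>2))) has_real_derivative exp (- 1 / v) * (- 2 * x / v\<^sup>2)) (at x)"
        using v unfolding v_def by (auto intro!: derivative_eq_intros simp: power2_eq_square)
      have "(1 - x\<^sup>2) ^ (2 * n) \<noteq> 0" using v by (simp add: v_def)
      from DERIV_mult[OF DERIV_divide[OF poly_DERIV a this] b] show ?thesis
        by (simp add: v_def mult_ac)
    qed
    also have "((poly (pderiv p) x * v ^ (2 * n) - poly p x * (real (2 * n) * v ^ (2 * n - 1) * (- (2 * x)))) / (v ^ (2 * n) * v ^ (2 * n)))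
       * exp (- 1 / v) + poly p x / v ^ (2 * n) * (exp (- 1 / v) * (- 2 * x / v\<^sup>2))
       = (poly (pderiv p) x * v\<^sup>2 + poly p x * (4 * real n * x * v - 2 * x)) / (v ^ (2 * n) * v\<^sup>2) * exp (- 1 / v)"
    proof -
      have v0: "v \<noteq> 0" using u by (simp add: v_def)
      have *: "real (2 * n) * v ^ (2 * n - 1) = 2 * real n * v ^ (2 * n) / v"
        using pow v0 by (simp add: field_simps)
      show ?thesis unfolding * using v0 by (simp add: field_simps power2_eq_square)
    qed
    also have "\<dots> = bump (Suc n) x"
      using True by (simp add: bump_def p_def v_def power_add power2_eq_square algebra_simps)
    finally show ?thesis .
  qed
  then show ?thesis
  proof (rule has_field_derivative_transform_within_open[where S = "{-1<..<1}"])
    show "x \<in> {-1<..<1}" using True by auto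
    show "poly p y / (1 - y\<^sup>2) ^ (2 * n) * exp (- 1 / (1 - y\<^sup>2)) = bump n y" if "y \<in> {-1<..<1}" for y
      using that by (auto simp: bump_def p_def)
  qed auto
next
  case False
  obtain C where C: "C \<ge> 0" "\<And>x. \<bar>bump n x\<bar> \<le> C * (1 - x\<^sup>2)\<^sup>2"
    using bump_quadratic_bound[of n] by blast
  \<comment> \<open>Since |x| \<ge> 1, the factor 1 - |y| is at most |y - x|, and 1 + |y| is at most
    2. The difference quotient at \<open>x\<close> is therefore O(|h|), also at the end
    points.\<close>
  have bound: "\<bar>bump n y\<bar> \<le> C * 4 * (y - x)\<^sup>2" for y
  proof (cases "\<bar>y\<bar> < 1")
    case True
    have "1 - y\<^sup>2 = (1 - \<bar>y\<bar>) * (1 + \<bar>y\<bar>)"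
      by (simp add: algebra_simps power2_eq_square abs_mult_self_eq)
    also have "\<dots> \<le> \<bar>y - x\<bar> * 2"
      using True False by (intro mult_mono) auto
    finally have "(1 - y\<^sup>2)\<^sup>2 \<le> (\<bar>y - x\<bar> * 2)\<^sup>2"
      using True by (intro power_mono) (auto simp: abs_square_le_1)
    then have "(1 - y\<^sup>2)\<^sup>2 \<le> 4 * (y - x)\<^sup>2"
      by (simp add: power_mult_distrib)
    from mult_left_mono[OF this C(1)] C(2)[of y] show ?thesis
      by linarith
  qed (use C in \<open>simp add: bump_def\<close>)
  have "((\<lambda>h. (bump n (x + h) - bump n x) / h) \<longlongrightarrow> 0) (at 0)"
  proof (rule Lim_null_comparison)
    have "norm ((bump n (x + h) - bump n x) / h) \<le> C * 4 * \<bar>h\<bar>" if "h \<noteq> 0" for h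
    proof -
      have "bump n x = 0" using False by (simp add: bump_def)
      moreover have "h\<^sup>2 = \<bar>h\<bar> * \<bar>h\<bar>" by (simp add: power2_eq_square)
      ultimately show ?thesis
        using bound[of "x + h"] that by (simp add: divide_le_eq)
    qed
    then show "\<forall>\<^sub>F h in at 0. norm ((bump n (x + h) - bump n x) / h) \<le> C * 4 * \<bar>h\<bar>"
      by (simp add: eventually_at_filter)
    show "((\<lambda>h. C * 4 * \<bar>h\<bar>) \<longlongrightarrow> 0) (at 0)"
      by (auto intro!: tendsto_eq_intros)
  qed
  then show ?thesis
    using False by (simp add: DERIV_def bump_def[of "Suc n"])
qed

text \<open>Keeps the definition of an oscillatory integral from being vacuous. The factor
  \<open>exp 2\<close> compensates \<open>bump 0 0 = exp (- 1)\<close> in each of the two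
  variables.\<close>

lemma test_function_exists: "\<exists>\<psi>. test_function \<psi> \<and> \<psi> 0 = 1"
proof (intro exI conjI)
  define D :: "nat \<Rightarrow> nat \<Rightarrow> real \<times> real \<Rightarrow> complex" where
    "D i j p = complex_of_real (exp 2 * bump i (fst p) * bump j (snd p))" for i j p
  have "(D i j has_derivative (\<lambda>h. fst h *\<^sub>R D (Suc i) j p + snd h *\<^sub>R D i (Suc j) p)) (at p)" for i j p
  proof -
    have 1: "((\<lambda>p. bump i (fst p)) has_derivative (\<lambda>h. bump (Suc i) (fst p) * fst h)) (at p)"
      using bump_has_derivative[of i "fst p"] 
      by (intro has_derivative_compose[OF has_derivative_fst[OF has_derivative_ident], of "bump i" "(*) (bump (Suc i) (fst p))"])
        (simp add: has_field_derivative_def)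
    have 2: "((\<lambda>p. bump j (snd p)) has_derivative (\<lambda>h. bump (Suc j) (snd p) * snd h)) (at p)"
      using bump_has_derivative[of j "snd p"] 
      by (intro has_derivative_compose[OF has_derivative_snd[OF has_derivative_ident], of "bump j" "(*) (bump (Suc j) (snd p))"])
        (simp add: has_field_derivative_def)
    have "((\<lambda>p. exp 2 * bump i (fst p) * bump j (snd p)) has_derivative
       (\<lambda>h. exp 2 * (bump (Suc i) (fst p) * fst h) * bump j (snd p) + exp 2 * bump i (fst p) * (bump (Suc j) (snd p) * snd h))) (at p)"
      by (auto intro!: derivative_eq_intros 1 2 simp: fun_eq_iff algebra_simps)
    from has_derivative_of_real[OF this, where ?'a = complex] show ?thesis
      unfolding D_def by (rule has_derivative_eq_rhs) (auto simp: fun_eq_iff algebra_simps scaleR_conv_of_real)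
  qed
  then have "smooth_on_plane (D 0 0)"
    unfolding smooth_on_plane_def by blast
  moreover have "compact (closure {p. D 0 0 p \<noteq> 0})"
  proof -
    have "{p. D 0 0 p \<noteq> 0} \<subseteq> {-1..1} \<times> {-1..1}"
      by (auto simp: D_def bump_def split: if_splits)
    then show ?thesis
      using bounded_subset[OF bounded_Times[OF bounded_closed_interval bounded_closed_interval]]
      by (simp add: compact_closure)
  qed
  ultimately show "test_function (D 0 0)"
    by (simp add: test_function_def)
  show "D 0 0 0 = 1"
    by (simp add: D_def bump_def flip: exp_add)
qed

section \<open>Airy integrals\<close>

text \<open>The exponent is chosen for the plane: a decay of order 4 splits into 5/2 in \<xi> and
  3/2 in \<eta>, and an amplitude of order one in \<xi> then leaves 3/2 in both variables.\<close>

lemma integrable_one_plus_abs_powr: "integrable lborel (\<lambda>x::real. (1 + \<bar>x\<bar>) powr (- 3 / 2))"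
proof -
  have nn: "(\<integral>\<^sup>+x. ennreal ((1 + \<bar>x\<bar>) powr (- 3 / 2)) * indicator {0..} x \<partial>lborel) = ennreal (0 - (- 2 * (1 + 0) powr (- 1 / 2)))"
  proof (rule nn_integral_FTC_atLeast[where F = "\<lambda>x. - 2 * (1 + x) powr (- 1 / 2)"])
    show "((\<lambda>x. - 2 * (1 + x) powr (- 1 / 2)) has_real_derivative (1 + \<bar>x\<bar>) powr (- 3 / 2)) (at x)" if "0 \<le> x" for x :: real
      using that by (auto intro!: derivative_eq_intros)
    show "((\<lambda>x::real. - 2 * (1 + x) powr (- 1 / 2)) \<longlongrightarrow> 0) at_top"
    proof -
      have "((\<lambda>x::real. (1 + x) powr (- 1 / 2)) \<longlongrightarrow> 0) at_top"
        by (rule tendsto_neg_powr) (auto intro!: filterlim_tendsto_add_at_top filterlim_ident tendsto_const)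
      from tendsto_mult_left[OF this, of "- 2"] show ?thesis by simp
    qed
  qed auto
  have half: "integrable lborel (\<lambda>x::real. indicator {0..} x * (1 + \<bar>x\<bar>) powr (- 3 / 2))"
  proof (rule integrableI_bounded)
    have "(\<integral>\<^sup>+x. ennreal (norm (indicator {0..} x * (1 + \<bar>x\<bar>) powr (- 3 / 2 :: real))) \<partial>lborel)
        = (\<integral>\<^sup>+x. ennreal ((1 + \<bar>x\<bar>) powr (- 3 / 2)) * indicator {0..} x \<partial>lborel)"
      by (intro nn_integral_cong) (auto split: split_indicator)
    then show "(\<integral>\<^sup>+x. ennreal (norm (indicator {0..} x * (1 + \<bar>x\<bar>) powr (- 3 / 2 :: real))) \<partial>lborel) < \<infinity>"
      using nn by simp
  qed simp
  have "integrable lborel (\<lambda>x::real. indicator {0..} (0 + (-1) * x) * (1 + \<bar>0 + (-1) * x\<bar>) powr (- 3 / 2))"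
    by (rule lborel_integrable_real_affine[OF half]) simp
  from Bochner_Integration.integrable_add[OF half this] show ?thesis
    by (rule Bochner_Integration.integrable_bound) (auto split: split_indicator)
qed

lemma power_le_fact_exp:
  fixes x :: real
  assumes "0 \<le> x"
  shows "x ^ n \<le> fact n * exp x"
proof -
  have "x ^ n /\<^sub>R fact n \<le> (\<Sum>k. x ^ k /\<^sub>R fact k)"
    using assms sum_le_suminf[OF summable_exp_generic[of x], of "{n}"] by simp
  then show ?thesis
    by (simp add: exp_def divide_inverse_commute[symmetric] divide_le_eq mult.commute)
qed

lemma integrable_exp_minus_abs: "integrable lborel (\<lambda>x::real. exp (- \<bar>x\<bar>))"
proof (rule Bochner_Integration.integrable_bound[OF integrable_mult_right[OF integrable_one_plus_abs_powr, of "2 * exp 1"]])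
  have "exp (- \<bar>x\<bar>) \<le> (2 :: real) * exp 1 * (1 + \<bar>x\<bar>) powr (- 3 / 2)" for x :: real
  proof -
    have "(1 + \<bar>x\<bar>) powr (3 / 2) \<le> (1 + \<bar>x\<bar>) powr (real 2)"
      by (intro powr_mono) auto
    also have "\<dots> = (1 + \<bar>x\<bar>) ^ 2"
      by (subst powr_realpow) auto
    also have "\<dots> \<le> 2 * exp (1 + \<bar>x\<bar>)"
      using power_le_fact_exp[of "1 + \<bar>x\<bar>" 2] by simp
    finally have "(1 + \<bar>x\<bar>) powr (3 / 2) \<le> 2 * exp 1 * exp \<bar>x\<bar>"
      by (simp add: exp_add)
    then show ?thesis
      by (simp add: exp_minus powr_minus field_simps)
  qed
  then show "AE x in lborel. norm (exp (- \<bar>x\<bar>)) \<le> norm (2 * exp 1 * (1 + \<bar>x\<bar>) powr (- 3 / 2 :: real))"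
    by simp
qed auto

text \<open>The integrand on the line of imaginary part \<open>s\<close>; the power \<open>k\<close>
  counts derivatives in \<open>u\<close>. For \<open>s > 0\<close> and \<open>k = 0\<close> the
  integral is 2 pi 3^(-1/3) Ai(3^(-1/3) u) with the classical Airy function Ai.\<close>

definition airy_integrand :: "nat \<Rightarrow> real \<Rightarrow> real \<Rightarrow> real \<Rightarrow> complex" where
  "airy_integrand k s u r =
     (\<i> * (of_real r + \<i> * of_real s)) ^ k
     * exp (\<i> * ((of_real r + \<i> * of_real s) ^ 3 + of_real u * (of_real r + \<i> * of_real s)))"

definition airy_int :: "nat \<Rightarrow> real \<Rightarrow> real \<Rightarrow> complex" where
  "airy_int k s u = (LINT r|lborel. airy_integrand k s u r)"

lemma norm_airy_integrand:
  "norm (airy_integrand k s u r) =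
     norm (of_real r + \<i> * of_real s) ^ k * exp (s ^ 3 - 3 * s * r\<^sup>2 - u * s)"
  unfolding airy_integrand_def norm_mult norm_power norm_exp_eq_Re
  by (simp add: power3_eq_cube power2_eq_square algebra_simps)

text \<open>Supplies the dominating functions for differentiation in \<open>u\<close> and in
  \<open>s\<close>. The shift must stay away from 0, because the Gaussian factor
  \<open>exp (- 3 * s * r\<^sup>2)\<close> is the only source of decay.\<close>

lemma airy_integrand_bound:
  assumes "0 < a"
  obtains C where "C \<ge> 0"
    "\<And>s u r. s \<in> {a..b} \<Longrightarrow> \<bar>u\<bar> \<le> U \<Longrightarrow> norm (airy_integrand k s u r) \<le> C * exp (- \<bar>r\<bar>)"
proof
  define C where "C = fact k * exp (b + b ^ 3 + U * b + 1 / (3 * a))"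
  show "C \<ge> 0" by (simp add: C_def)
  fix s u r assume s: "s \<in> {a..b}" and u: "\<bar>u\<bar> \<le> U"
  have "norm (complex_of_real r + \<i> * of_real s) \<le> \<bar>r\<bar> + b"
    using norm_triangle_ineq[of "complex_of_real r" "\<i> * of_real s"] s assms by (simp add: norm_mult)
  then have "norm (complex_of_real r + \<i> * of_real s) ^ k \<le> (\<bar>r\<bar> + b) ^ k"
    by (intro power_mono) auto
  also have "\<dots> \<le> fact k * exp (\<bar>r\<bar> + b)"
    using s assms by (intro power_le_fact_exp) auto
  finally have 1: "norm (complex_of_real r + \<i> * of_real s) ^ k \<le> fact k * exp (\<bar>r\<bar> + b)" .
  have "s ^ 3 \<le> b ^ 3"
    using s assms by (intro power_mono) auto
  moreover have "- (u * s) \<le> U * b"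
  proof -
    have "- (u * s) \<le> \<bar>u\<bar> * s"
      using mult_right_mono[of "- u" "\<bar>u\<bar>" s] s assms by simp
    also have "\<dots> \<le> U * b"
      using s u assms by (intro mult_mono) auto
    finally show ?thesis .
  qed
  moreover have "a * r\<^sup>2 \<le> s * r\<^sup>2"
    using s by (intro mult_right_mono) auto
  \<comment> \<open>Of the two copies of |r| gained by completing the square, one pays for the power
    \<open>(\<bar>r\<bar> + b) ^ k\<close> and the other is the decay that remains.\<close>
  moreover have "2 * \<bar>r\<bar> - 3 * a * r\<^sup>2 \<le> 1 / (3 * a)"
  proof -
    have "0 \<le> (3 * a * \<bar>r\<bar> - 1)\<^sup>2" by simp
    also have "\<dots> = 9 * a\<^sup>2 * r\<^sup>2 - 6 * a * \<bar>r\<bar> + 1"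
      by (simp add: power2_eq_square algebra_simps abs_mult_self_eq)
    finally show ?thesis
      using assms by (simp add: field_simps power2_eq_square)
  qed
  ultimately have "\<bar>r\<bar> + b + (s ^ 3 - 3 * s * r\<^sup>2 - u * s) \<le> b + b ^ 3 + U * b + 1 / (3 * a) - \<bar>r\<bar>"
    by linarith
  then have 2: "exp (\<bar>r\<bar> + b) * exp (s ^ 3 - 3 * s * r\<^sup>2 - u * s) \<le> exp (b + b ^ 3 + U * b + 1 / (3 * a)) * exp (- \<bar>r\<bar>)"
    by (simp flip: exp_add)
  have "norm (airy_integrand k s u r) \<le> fact k * exp (\<bar>r\<bar> + b) * exp (s ^ 3 - 3 * s * r\<^sup>2 - u * s)"
    unfolding norm_airy_integrand using 1 by (intro mult_right_mono) auto
  also have "\<dots> \<le> fact k * (exp (b + b ^ 3 + U * b + 1 / (3 * a)) * exp (- \<bar>r\<bar>))"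
    unfolding mult.assoc[of "fact k"] using 2 by (intro mult_left_mono) auto
  finally show "norm (airy_integrand k s u r) \<le> C * exp (- \<bar>r\<bar>)"
    by (simp add: C_def)
qed

lemma continuous_on_airy_integrand: "continuous_on A (airy_integrand k s u)"
  unfolding airy_integrand_def by (intro continuous_intros)

lemma airy_integrand_measurable [measurable]: "airy_integrand k s u \<in> borel_measurable borel"
  by (intro borel_measurable_continuous_onI continuous_on_airy_integrand)

lemma integrable_airy_integrand:
  assumes "s > 0"
  shows "integrable lborel (airy_integrand k s u)"
proof -
  obtain C where "C \<ge> 0" "\<And>s' u' r. s' \<in> {s..s} \<Longrightarrow> \<bar>u'\<bar> \<le> \<bar>u\<bar> \<Longrightarrow> norm (airy_integrand k s' u' r) \<le> C * exp (- \<bar>r\<bar>)"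
    using airy_integrand_bound[OF assms] by blast
  then show ?thesis
    by (intro Bochner_Integration.integrable_bound[OF integrable_mult_right[OF integrable_exp_minus_abs, of C]]) auto
qed

lemma airy_int_has_derivative:
  assumes s: "s > 0"
  shows "(airy_int k s has_vector_derivative airy_int (Suc k) s u) (at u)"
proof -
  obtain C where C: "C \<ge> 0" "\<And>s' u' r. s' \<in> {s..s} \<Longrightarrow> \<bar>u'\<bar> \<le> \<bar>u\<bar> + 1 \<Longrightarrow> norm (airy_integrand (Suc k) s' u' r) \<le> C * exp (- \<bar>r\<bar>)"
    using airy_integrand_bound[OF s] by blast
  have "((\<lambda>u. LINT r|lborel. airy_integrand k s u r) has_vector_derivative (LINT r|lborel. airy_integrand (Suc k) s u r)) (at u)"
  proof (rule has_vector_derivative_lebesgue_integral[where e = 1 and B = "\<lambda>r. C * exp (- \<bar>r\<bar>)"])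
    show "((\<lambda>u. airy_integrand k s u r) has_vector_derivative airy_integrand (Suc k) s u r) (at u)" for u r
      unfolding airy_integrand_def
      by (rule has_vector_derivative_real_field[where f = "\<lambda>v. (\<i> * (of_real r + \<i> * of_real s)) ^ k
           * exp (\<i> * ((of_real r + \<i> * of_real s) ^ 3 + v * (of_real r + \<i> * of_real s)))"])
        (auto intro!: derivative_eq_intros)
    show "norm (airy_integrand (Suc k) s v r) \<le> C * exp (- \<bar>r\<bar>)" if "\<bar>v - u\<bar> < 1" for v r
      using that by (intro C) auto
  qed (auto intro!: integrable_airy_integrand s integrable_mult_right integrable_exp_minus_abs)
  then show ?thesis
    by (simp add: airy_int_def[abs_def])
qed

text \<open>The derivative of \<open>airy_integrand 0 s u\<close> in \<open>r\<close>. By analyticity the derivative in \<open>s\<close> is \<open>\<i>\<close>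
  times this one, so its vanishing integral gives both the independence of the shift \<open>s\<close> and Airy's
  differential equation.\<close>

definition airy_integrand_deriv :: "real \<Rightarrow> real \<Rightarrow> real \<Rightarrow> complex" where
  "airy_integrand_deriv s u r =
     - 3 * \<i> * airy_integrand 2 s u r + \<i> * of_real u * airy_integrand 0 s u r"

lemma airy_integrand_deriv_field:
  "((\<lambda>z. exp (\<i> * (z ^ 3 + of_real u * z))) has_field_derivative airy_integrand_deriv s u r)
     (at (of_real r + \<i> * of_real s))"
  by (auto intro!: derivative_eq_intros
      simp: airy_integrand_deriv_def airy_integrand_def algebra_simps power2_eq_square)

section \<open>Airy's equation and independence of the contour\<close>

lemma integrable_airy_integrand_deriv:
  "s > 0 \<Longrightarrow> integrable lborel (airy_integrand_deriv s u)"
  unfolding airy_integrand_deriv_def[abs_def] by (auto intro!: integrable_airy_integrand)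

lemma integral_airy_integrand_deriv:
  assumes "s > 0"
  shows "(LINT r|lborel. airy_integrand_deriv s u r) = 0"
proof (rule integral_directional_derivative_eq_0)
  show "integrable lborel (airy_integrand 0 s u)" "integrable lborel (airy_integrand_deriv s u)"
    using assms by (auto intro!: integrable_airy_integrand integrable_airy_integrand_deriv)
  show "continuous_on UNIV (airy_integrand_deriv s u)"
    unfolding airy_integrand_deriv_def by (intro continuous_intros continuous_on_airy_integrand)
  show "((\<lambda>h. airy_integrand 0 s u (r + h *\<^sub>R 1)) has_vector_derivative airy_integrand_deriv s u r) (at 0)" for r
  proof -
    have "((\<lambda>z. exp (\<i> * (z ^ 3 + of_real u * z))) \<circ> (\<lambda>z. of_real r + z + \<i> * of_real s)
        has_field_derivative airy_integrand_deriv s u r * 1) (at (of_real 0))"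
      by (rule DERIV_chain) (use airy_integrand_deriv_field in \<open>auto intro!: derivative_eq_intros\<close>)
    from has_vector_derivative_real_field[OF this] show ?thesis
      by (simp add: airy_integrand_def o_def)
  qed
qed

lemma airy_equation:
  assumes "s > 0"
  shows "3 * airy_int 2 s u = of_real u * airy_int 0 s u"
proof -
  have "0 = (LINT r|lborel. airy_integrand_deriv s u r)"
    using integral_airy_integrand_deriv[OF assms] by simp
  also have "\<dots> = - 3 * \<i> * airy_int 2 s u + \<i> * of_real u * airy_int 0 s u"
    unfolding airy_integrand_deriv_def airy_int_def
    using integrable_airy_integrand[OF assms] by simp
  finally have "\<i> * (3 * airy_int 2 s u) = \<i> * (of_real u * airy_int 0 s u)"
    by (simp add: algebra_simps)
  then show ?thesis by simp
qed

lemma airy_int_0_shift_independent: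
  assumes "s > 0" "s' > 0"
  shows "airy_int 0 s u = airy_int 0 s' u"
proof -
  have "((\<lambda>s. airy_int 0 s u) has_derivative (\<lambda>h. 0)) (at s within {0<..})" if s: "s \<in> {0<..}" for s
  proof -
    \<comment> \<open>The neighbourhood of radius \<open>s / 2\<close> is bounded away from the
      shift 0.\<close>
    have s2: "s / 2 > 0" using s by simp
    obtain C where C: "C \<ge> 0" "\<And>s' u' r. s' \<in> {s / 2..2 * s} \<Longrightarrow> \<bar>u'\<bar> \<le> \<bar>u\<bar> \<Longrightarrow> norm (airy_integrand 2 s' u' r) \<le> C * exp (- \<bar>r\<bar>)"
      using airy_integrand_bound[OF s2] by blast
    obtain D where D: "D \<ge> 0" "\<And>s' u' r. s' \<in> {s / 2..2 * s} \<Longrightarrow> \<bar>u'\<bar> \<le> \<bar>u\<bar> \<Longrightarrow> norm (airy_integrand 0 s' u' r) \<le> D * exp (- \<bar>r\<bar>)"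
      using airy_integrand_bound[OF s2] by blast
    have "((\<lambda>s. LINT r|lborel. airy_integrand 0 s u r) has_vector_derivative
        (LINT r|lborel. \<i> * airy_integrand_deriv s u r)) (at s)"
    proof (rule has_vector_derivative_lebesgue_integral[where e = "s / 2"
          and f = "\<lambda>s. airy_integrand 0 s u" and f' = "\<lambda>s r. \<i> * airy_integrand_deriv s u r"
          and B = "\<lambda>r. (3 * C + \<bar>u\<bar> * D) * exp (- \<bar>r\<bar>)"])
      show "((\<lambda>s. airy_integrand 0 s u r) has_vector_derivative \<i> * airy_integrand_deriv s u r) (at s)" for s r
      proof -
        have "((\<lambda>z. exp (\<i> * (z ^ 3 + of_real u * z))) \<circ> (\<lambda>z. of_real r + \<i> * z)
            has_field_derivative airy_integrand_deriv s u r * \<i>) (at (of_real s))"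
          by (rule DERIV_chain) (use airy_integrand_deriv_field in \<open>auto intro!: derivative_eq_intros\<close>)
        from has_vector_derivative_real_field[OF this] show ?thesis
          by (simp add: airy_integrand_def o_def mult.commute)
      qed
      show "norm (\<i> * airy_integrand_deriv v u r) \<le> (3 * C + \<bar>u\<bar> * D) * exp (- \<bar>r\<bar>)"
        if "\<bar>v - s\<bar> < s / 2" for v r
      proof -
        have "v \<in> {s / 2..2 * s}" using that by (auto simp: abs_if split: if_splits)
        then have "norm (airy_integrand 2 v u r) \<le> C * exp (- \<bar>r\<bar>)" "norm (airy_integrand 0 v u r) \<le> D * exp (- \<bar>r\<bar>)"
          using C D by auto
        moreover from this(2) have "\<bar>u\<bar> * norm (airy_integrand 0 v u r) \<le> \<bar>u\<bar> * (D * exp (- \<bar>r\<bar>))"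
          by (intro mult_left_mono) auto
        moreover have "norm (\<i> * airy_integrand_deriv v u r) \<le> 3 * norm (airy_integrand 2 v u r) + \<bar>u\<bar> * norm (airy_integrand 0 v u r)"
          unfolding airy_integrand_deriv_def norm_mult[of \<i>]
          by (rule order_trans[OF mult_left_mono[OF norm_triangle_ineq]]) (auto simp: norm_mult)
        ultimately show ?thesis by (simp add: algebra_simps)
      qed
      show "integrable lborel (airy_integrand 0 v u)" if "\<bar>v - s\<bar> < s / 2" for v
        using that s by (intro integrable_airy_integrand) (auto simp: abs_if split: if_splits)
      show "(\<lambda>r. \<i> * airy_integrand_deriv s u r) \<in> borel_measurable lborel"
        using integrable_airy_integrand_deriv[of s u] s by auto
    qed (use s in \<open>auto intro!: integrable_mult_right integrable_exp_minus_abs\<close>)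
    then have "((\<lambda>s. airy_int 0 s u) has_vector_derivative 0) (at s)"
      using integral_airy_integrand_deriv[of s u] s by (simp add: airy_int_def)
    then show ?thesis
      by (simp add: has_vector_derivative_def has_derivative_at_withinI)
  qed
  from has_derivative_zero_constant[OF _ this] show ?thesis
    using assms by force
qed

text \<open>The identity for \<open>k = 0\<close> holds for all \<open>u\<close>, so it can be
  differentiated in \<open>u\<close>.\<close>

lemma airy_int_1_shift_independent:
  assumes "s > 0" "s' > 0"
  shows "airy_int 1 s u = airy_int 1 s' u"
proof -
  have "airy_int 0 s = airy_int 0 s'"
    using airy_int_0_shift_independent[OF assms] by (auto simp: fun_eq_iff)
  then show ?thesis
    using airy_int_has_derivative[of s 0 u] airy_int_has_derivative[of s' 0 u] assms
    by (auto dest: vector_derivative_unique_at)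
qed

text \<open>On the line of imaginary part 1, \<open>u\<close> enters the modulus of the integrand
  only through \<open>exp (- u)\<close>. The true decay has exponent of order u^(3/2), but this one
  already beats every power.\<close>

lemma airy_int_exp_bound:
  obtains C where "C \<ge> 0" "\<And>u. norm (airy_int k 1 u) \<le> C * exp (- u)"
proof
  define C where "C = (LINT r|lborel. norm (airy_integrand k 1 0 r))"
  show "C \<ge> 0" by (simp add: C_def)
  fix u
  have "norm (airy_int k 1 u) \<le> (LINT r|lborel. norm (airy_integrand k 1 u r))"
    unfolding airy_int_def by (rule integral_norm_bound)
  also have "(\<lambda>r. norm (airy_integrand k 1 u r)) = (\<lambda>r. norm (airy_integrand k 1 0 r) * exp (- u))"
    by (simp add: norm_airy_integrand fun_eq_iff mult.assoc flip: exp_add)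
  finally show "norm (airy_int k 1 u) \<le> C * exp (- u)"
    by (simp add: C_def)
qed

text \<open>With \<open>u = - \<tau>\<^sup>2\<close>, the energy \<open>\<tau> f\<^sup>2 + 3 h\<^sup>2 / \<tau>\<close> of a solution of \<open>3 f'' = u f\<close>, \<open>h = f'\<close>, is almost
  conserved: the correction \<open>- 3 f h / (2 \<tau>\<^sup>3)\<close> cancels all terms of its derivative except one of
  relative size \<open>\<tau>\<^sup>-\<^sup>4\<close>, which is integrable.\<close>

lemma airy_solution_energy_bound:
  fixes f h :: "real \<Rightarrow> real"
  assumes f: "\<And>u. (f has_real_derivative h u) (at u)"
    and h: "\<And>u. (h has_real_derivative u / 3 * f u) (at u)"
  obtains K where "K \<ge> 0" "\<And>\<tau>. \<tau> \<ge> 1 \<Longrightarrow> (f (- \<tau>\<^sup>2))\<^sup>2 \<le> K \<and> (h (- \<tau>\<^sup>2))\<^sup>2 \<le> K * \<tau>"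
proof
  define p where "p \<tau> = f (- \<tau>\<^sup>2)" for \<tau>
  define q where "q \<tau> = h (- \<tau>\<^sup>2)" for \<tau>
  define F where "F \<tau> = \<tau> * (p \<tau>)\<^sup>2 + 3 * (q \<tau>)\<^sup>2 / \<tau>" for \<tau>
  define H where "H \<tau> = F \<tau> - 3 / 2 * (p \<tau> * q \<tau>) / \<tau> ^ 3" for \<tau>
  have p: "(p has_real_derivative - 2 * \<tau> * q \<tau>) (at \<tau>)" for \<tau>
  proof -
    have "((\<lambda>\<tau>. f (- \<tau>\<^sup>2)) has_real_derivative h (- \<tau>\<^sup>2) * (- (2 * \<tau>))) (at \<tau>)"
      by (rule DERIV_chain2[OF f]) (auto intro!: derivative_eq_intros)
    then show ?thesis by (simp add: p_def[abs_def] q_def algebra_simps)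
  qed
  have q: "(q has_real_derivative 2 / 3 * \<tau> ^ 3 * p \<tau>) (at \<tau>)" for \<tau>
  proof -
    have "((\<lambda>\<tau>. h (- \<tau>\<^sup>2)) has_real_derivative (- \<tau>\<^sup>2) / 3 * f (- \<tau>\<^sup>2) * (- (2 * \<tau>))) (at \<tau>)"
      by (rule DERIV_chain2[OF h]) (auto intro!: derivative_eq_intros)
    then show ?thesis by (simp add: p_def q_def[abs_def] algebra_simps power2_eq_square power3_eq_cube)
  qed
  have H': "(H has_real_derivative 9 / 2 * (p \<tau> * q \<tau>) / \<tau> ^ 4) (at \<tau>)" if "\<tau> > 0" for \<tau>
  proof -
    have D: "(H has_real_derivative
        (1 * (p \<tau>)\<^sup>2 + 2 * p \<tau> * (- 2 * \<tau> * q \<tau>) * \<tau>)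
        + (3 * (2 * q \<tau> * (2 / 3 * \<tau> ^ 3 * p \<tau>)) * \<tau> - 3 * (q \<tau>)\<^sup>2 * 1) / (\<tau> * \<tau>)
        - (3 / 2 * ((- 2 * \<tau> * q \<tau>) * q \<tau> + 2 / 3 * \<tau> ^ 3 * p \<tau> * p \<tau>) * \<tau> ^ 3
           - 3 / 2 * (p \<tau> * q \<tau>) * (3 * \<tau>\<^sup>2)) / (\<tau> ^ 3 * \<tau> ^ 3)) (at \<tau>)"
    proof -
      have 1: "((\<lambda>\<tau>. (p \<tau>)\<^sup>2) has_real_derivative 2 * p \<tau> * (- 2 * \<tau> * q \<tau>)) (at \<tau>)"
        using DERIV_power[OF p, of 2 \<tau>] by (simp add: mult_ac)
      have 2: "((\<lambda>\<tau>. 3 * (q \<tau>)\<^sup>2) has_real_derivative 3 * (2 * q \<tau> * (2 / 3 * \<tau> ^ 3 * p \<tau>))) (at \<tau>)"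
        using DERIV_cmult[OF DERIV_power[OF q, of 2 \<tau>], of 3] by (simp add: mult_ac)
      have 3: "((\<lambda>\<tau>. \<tau> ^ 3) has_real_derivative 3 * \<tau>\<^sup>2) (at \<tau>)"
        by (auto intro!: derivative_eq_intros)
      have 4: "((\<lambda>\<tau>. 3 / 2 * (p \<tau> * q \<tau>)) has_real_derivative
          3 / 2 * ((- 2 * \<tau> * q \<tau>) * q \<tau> + 2 / 3 * \<tau> ^ 3 * p \<tau> * p \<tau>)) (at \<tau>)"
        by (rule DERIV_cmult[OF DERIV_mult[OF p q]])
      have "\<tau> ^ 3 \<noteq> 0" using that by simp
      from DERIV_diff[OF DERIV_add[OF DERIV_mult[OF DERIV_ident 1] DERIV_divide[OF 2 DERIV_ident]] DERIV_divide[OF 4 3 this]]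
      show ?thesis using that by (simp only: H_def[abs_def] F_def)
    qed
    have a: "(3 * (2 * q \<tau> * (2 / 3 * \<tau> ^ 3 * p \<tau>)) * \<tau> - 3 * (q \<tau>)\<^sup>2 * 1) / (\<tau> * \<tau>)
        = 4 * \<tau>\<^sup>2 * (p \<tau> * q \<tau>) - 3 * (q \<tau>)\<^sup>2 / \<tau>\<^sup>2"
      using that by (simp add: field_simps eval_nat_numeral)
    have b: "(3 / 2 * ((- 2 * \<tau> * q \<tau>) * q \<tau> + 2 / 3 * \<tau> ^ 3 * p \<tau> * p \<tau>) * \<tau> ^ 3
           - 3 / 2 * (p \<tau> * q \<tau>) * (3 * \<tau>\<^sup>2)) / (\<tau> ^ 3 * \<tau> ^ 3)
        = - 3 * (q \<tau>)\<^sup>2 / \<tau>\<^sup>2 + (p \<tau>)\<^sup>2 - 9 / 2 * (p \<tau> * q \<tau>) / \<tau> ^ 4"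
    proof -
      have "(3 / 2 * ((- 2 * \<tau> * q \<tau>) * q \<tau> + 2 / 3 * \<tau> ^ 3 * p \<tau> * p \<tau>) * \<tau> ^ 3
           - 3 / 2 * (p \<tau> * q \<tau>) * (3 * \<tau>\<^sup>2))
         = (- 3 * (q \<tau>)\<^sup>2) * \<tau> ^ 4 + (p \<tau>)\<^sup>2 * \<tau> ^ 6 - 9 / 2 * (p \<tau> * q \<tau>) * \<tau>\<^sup>2"
        by (simp add: algebra_simps eval_nat_numeral)
      moreover have "\<tau> ^ 3 * \<tau> ^ 3 = \<tau> ^ 6" "\<tau> ^ 4 / \<tau> ^ 6 = 1 / \<tau>\<^sup>2" "\<tau>\<^sup>2 / \<tau> ^ 6 = 1 / \<tau> ^ 4"
        using that by (simp_all add: field_simps flip: power_add)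
      moreover have "(a * \<tau> ^ 4 + b * \<tau> ^ 6 - c * \<tau>\<^sup>2) / \<tau> ^ 6 = a * (\<tau> ^ 4 / \<tau> ^ 6) + b - c * (\<tau>\<^sup>2 / \<tau> ^ 6)" for a b c
        using that by (simp add: add_divide_distrib diff_divide_distrib)
      ultimately show ?thesis
        by (simp only: times_divide_eq_right mult_1_right)
    qed
    from D show ?thesis
      unfolding a b by (simp add: power2_eq_square algebra_simps)
  qed
  \<comment> \<open>Expanding the square gives \<tau> times
    \<open>F \<tau> - 3 * \<bar>p \<tau> * q \<tau>\<bar>\<close> up to the coefficient 9/4 of q^2,
    which is at most 3.\<close>
  have pq: "3 * \<bar>p \<tau> * q \<tau>\<bar> \<le> F \<tau>" if "\<tau> > 0" for \<tau>
  proof -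
    have "0 \<le> (\<tau> * \<bar>p \<tau>\<bar> - 3 / 2 * \<bar>q \<tau>\<bar>)\<^sup>2" by simp
    also have "\<dots> \<le> \<tau> * (\<tau> * (p \<tau>)\<^sup>2 + 3 * (q \<tau>)\<^sup>2 / \<tau> - 3 * \<bar>p \<tau> * q \<tau>\<bar>)"
      using that by (simp add: power2_eq_square algebra_simps abs_mult abs_mult_self_eq)
    finally show ?thesis
      using that by (simp add: F_def zero_le_mult_iff)
  qed
  \<comment> \<open>For \<tau> \<ge> 1 the correction in \<open>H\<close> is at most half of
    \<open>F\<close>, by \<open>pq\<close>.\<close>
  have FH: "F \<tau> \<le> 2 * H \<tau>" if "\<tau> \<ge> 1" for \<tau>
  proof -
    have "\<bar>p \<tau> * q \<tau>\<bar> / \<tau> ^ 3 \<le> \<bar>p \<tau> * q \<tau>\<bar> / 1"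
      using that by (intro divide_left_mono) auto
    moreover have "(p \<tau> * q \<tau>) / \<tau> ^ 3 \<le> \<bar>p \<tau> * q \<tau>\<bar> / \<tau> ^ 3"
      using that by (intro divide_right_mono) auto
    ultimately show ?thesis
      using pq[of \<tau>] that by (simp add: H_def)
  qed
  \<comment> \<open>Gronwall's argument: 9/2 |p q| \<le> 3/2 F \<le> 3 H, so H' \<le> 3 H /
    \<tau>^4, and \<open>exp (1 / \<tau> ^ 3)\<close> has logarithmic derivative -3 /
    \<tau>^4.\<close>
  have mono: "H \<tau> * exp (1 / \<tau> ^ 3) \<le> H 1 * exp (1 / 1 ^ 3)" if \<tau>: "\<tau> \<ge> 1" for \<tau>
  proof (rule DERIV_nonpos_imp_nonincreasing[of 1 \<tau> "\<lambda>\<tau>. H \<tau> * exp (1 / \<tau> ^ 3)", OF \<tau>])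
    fix x :: real assume x: "1 \<le> x" "x \<le> \<tau>"
    have d: "((\<lambda>\<tau>. H \<tau> * exp (1 / \<tau> ^ 3)) has_real_derivative
        (9 / 2 * (p x * q x) / x ^ 4) * exp (1 / x ^ 3) + H x * (exp (1 / x ^ 3) * (- 3 / x ^ 4))) (at x)"
    proof -
      have "((\<lambda>\<tau>. 1 / \<tau> ^ 3) has_real_derivative (0 * x ^ 3 - 1 * (real 3 * x ^ (3 - 1))) / (x ^ 3 * x ^ 3)) (at x)"
        using x DERIV_divide[OF DERIV_const[of 1] DERIV_pow[of 3 x]] by simp
      also have "(0 * x ^ 3 - 1 * (real 3 * x ^ (3 - 1))) / (x ^ 3 * x ^ 3) = - 3 / x ^ 4"
        using x by (simp add: field_simps eval_nat_numeral)
      finally have "((\<lambda>\<tau>. exp (1 / \<tau> ^ 3)) has_real_derivative exp (1 / x ^ 3) * (- 3 / x ^ 4)) (at x)"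
        by (rule DERIV_chain2[OF DERIV_exp])
      from DERIV_mult[OF H' this] x show ?thesis by (simp add: mult_ac)
    qed
    have e: "(9 / 2 * (p x * q x) / x ^ 4) * exp (1 / x ^ 3) + H x * (exp (1 / x ^ 3) * (- 3 / x ^ 4))
       = (9 / 2 * (p x * q x) - 3 * H x) * (exp (1 / x ^ 3) / x ^ 4)"
      by (simp add: algebra_simps)
    have "9 / 2 * (p x * q x) - 3 * H x \<le> 0"
      using pq[of x] FH[of x] x by linarith
    then have "(9 / 2 * (p x * q x) - 3 * H x) * (exp (1 / x ^ 3) / x ^ 4) \<le> 0"
      by (intro mult_nonpos_nonneg) auto
    with d[unfolded e] show "\<exists>y. ((\<lambda>\<tau>. H \<tau> * exp (1 / \<tau> ^ 3)) has_real_derivative y) (at x) \<and> y \<le> 0"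
      by blast
  qed
  define K where "K = 2 * (H 1 * exp 1)"
  have F0: "F \<tau> \<ge> 0" if "\<tau> > 0" for \<tau>
    using that by (simp add: F_def)
  show "K \<ge> 0"
    using FH[of 1] F0[of 1] by (simp add: K_def)
  fix \<tau> :: real assume \<tau>: "\<tau> \<ge> 1"
  have "F \<tau> \<le> 2 * (H \<tau> * exp (1 / \<tau> ^ 3))"
  proof -
    have "H \<tau> * 1 \<le> H \<tau> * exp (1 / \<tau> ^ 3)"
      using FH[OF \<tau>] F0[of \<tau>] \<tau> by (intro mult_left_mono) auto
    with FH[OF \<tau>] show ?thesis by linarith
  qed
  also have "\<dots> \<le> K"
    using mono[OF \<tau>] by (simp add: K_def)
  finally have FK: "F \<tau> \<le> K" .
  have "(p \<tau>)\<^sup>2 * 1 \<le> (p \<tau>)\<^sup>2 * \<tau>"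
    using \<tau> by (intro mult_left_mono) auto
  moreover have "0 \<le> 3 * (q \<tau>)\<^sup>2 / \<tau>" using \<tau> by simp
  ultimately have "(p \<tau>)\<^sup>2 \<le> K"
    using FK by (simp add: F_def mult.commute)
  moreover have "(q \<tau>)\<^sup>2 \<le> K * \<tau>"
  proof -
    have "0 \<le> \<tau> * (p \<tau>)\<^sup>2" using \<tau> by simp
    then have "3 * (q \<tau>)\<^sup>2 / \<tau> \<le> K" using FK by (simp add: F_def)
    then have "3 * (q \<tau>)\<^sup>2 \<le> K * \<tau>" using \<tau> by (simp add: divide_le_eq)
    moreover have "0 \<le> (q \<tau>)\<^sup>2" by simp
    ultimately show ?thesis by linarith
  qed
  ultimately show "(f (- \<tau>\<^sup>2))\<^sup>2 \<le> K \<and> (h (- \<tau>\<^sup>2))\<^sup>2 \<le> K * \<tau>"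
    by (simp add: p_def q_def)
qed

lemma airy_int_bounds:
  obtains M where "M > 0"
    "\<And>u. norm (airy_int 0 1 u) \<le> M" "\<And>u. norm (airy_int 1 1 u) \<le> M * (1 + \<bar>u\<bar>) powr (1 / 4)"
    "\<And>u. norm (airy_int 0 1 u) \<le> M * exp (- u)" "\<And>u. norm (airy_int 1 1 u) \<le> M * exp (- u)"
proof -
  let ?A = "airy_int 0 1" and ?B = "airy_int 1 1"
  have A': "(?A has_vector_derivative ?B u) (at u)" for u
    using airy_int_has_derivative[of 1 0 u] by simp
  have B': "(?B has_vector_derivative (u / 3) *\<^sub>R ?A u) (at u)" for u
  proof -
    have "airy_int 2 1 u = (u / 3) *\<^sub>R ?A u"
      using airy_equation[of 1 u] by (simp add: scaleR_conv_of_real field_simps)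
    then show ?thesis
      using airy_int_has_derivative[of 1 1 u] by (simp add: numeral_2_eq_2)
  qed
  \<comment> \<open>The energy estimate is for real solutions; the equation has real coefficients,
    so real and imaginary part are solutions.\<close>
  have Re': "((\<lambda>u. Re (?A u)) has_real_derivative Re (?B u)) (at u)"
     "((\<lambda>u. Re (?B u)) has_real_derivative u / 3 * Re (?A u)) (at u)"
     "((\<lambda>u. Im (?A u)) has_real_derivative Im (?B u)) (at u)"
     "((\<lambda>u. Im (?B u)) has_real_derivative u / 3 * Im (?A u)) (at u)" for u
    using bounded_linear.has_vector_derivative[OF bounded_linear_Re A'[of u]] bounded_linear.has_vector_derivative[OF bounded_linear_Re B'[of u]]
      bounded_linear.has_vector_derivative[OF bounded_linear_Im A'[of u]] bounded_linear.has_vector_derivative[OF bounded_linear_Im B'[of u]]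
    by (simp_all add: has_real_derivative_iff_has_vector_derivative)
  obtain K1 where K1: "K1 \<ge> 0" "\<And>\<tau>. \<tau> \<ge> 1 \<Longrightarrow> (Re (?A (- \<tau>\<^sup>2)))\<^sup>2 \<le> K1 \<and> (Re (?B (- \<tau>\<^sup>2)))\<^sup>2 \<le> K1 * \<tau>"
    using airy_solution_energy_bound[OF Re'(1,2)] by blast
  obtain K2 where K2: "K2 \<ge> 0" "\<And>\<tau>. \<tau> \<ge> 1 \<Longrightarrow> (Im (?A (- \<tau>\<^sup>2)))\<^sup>2 \<le> K2 \<and> (Im (?B (- \<tau>\<^sup>2)))\<^sup>2 \<le> K2 * \<tau>"
    using airy_solution_energy_bound[OF Re'(3,4)] by blast
  obtain C0 where C0: "C0 \<ge> 0" "\<And>u. norm (?A u) \<le> C0 * exp (- u)"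
    using airy_int_exp_bound[of 0] by blast
  obtain C1 where C1: "C1 \<ge> 0" "\<And>u. norm (?B u) \<le> C1 * exp (- u)"
    using airy_int_exp_bound[of 1] by blast
  define K where "K = sqrt (K1 + K2)"
  define M where "M = (C0 + C1) * exp 1 + K + 1"
  have K: "K \<ge> 0" using K1 K2 by (simp add: K_def)
  have M: "C0 * exp 1 \<le> M" "C1 * exp 1 \<le> M" "K \<le> M" "C0 \<le> M" "C1 \<le> M" "M > 0"
  proof -
    have e: "C0 * 1 \<le> C0 * exp 1" "C1 * 1 \<le> C1 * exp 1"
      by (rule mult_left_mono; use C0(1) C1(1) in simp)+
    then show "C0 * exp 1 \<le> M" "C1 * exp 1 \<le> M" "K \<le> M" "C0 \<le> M" "C1 \<le> M" "M > 0"
      using C0(1) C1(1) K unfolding M_def distrib_right by linarith+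
  qed
  \<comment> \<open>To the right of -1 the exponential bound is at most a constant; the energy
    estimate takes over to the left.\<close>
  have far: "norm (?A u) \<le> M" "norm (?B u) \<le> M * (1 + \<bar>u\<bar>) powr (1 / 4)" if u: "u \<ge> - 1" for u
  proof -
    have e: "exp (- u) \<le> exp 1" using u by simp
    show "norm (?A u) \<le> M"
      using C0(2)[of u] mult_left_mono[OF e C0(1)] M(1) by linarith
    have "1 \<le> (1 + \<bar>u\<bar>) powr (1 / 4)" by (intro ge_one_powr_ge_zero) auto
    from mult_left_mono[OF this, of M] show "norm (?B u) \<le> M * (1 + \<bar>u\<bar>) powr (1 / 4)"
      using C1(2)[of u] mult_left_mono[OF e C1(1)] M(2,6) by linarith
  qed
  have near: "norm (?A u) \<le> M" "norm (?B u) \<le> M * (1 + \<bar>u\<bar>) powr (1 / 4)" if u: "u \<le> - 1" for u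
  proof -
    define \<tau> where "\<tau> = sqrt (- u)"
    have \<tau>: "\<tau> \<ge> 1" "- \<tau>\<^sup>2 = u" using u by (auto simp: \<tau>_def)
    have "norm (?A u) = sqrt ((Re (?A u))\<^sup>2 + (Im (?A u))\<^sup>2)"
      by (simp add: cmod_def)
    also have "\<dots> \<le> K"
      unfolding K_def using K1(2)[OF \<tau>(1)] K2(2)[OF \<tau>(1)] by (intro real_sqrt_le_mono) (simp add: \<tau>(2))
    finally show "norm (?A u) \<le> M" using M by linarith
    have "norm (?B u) = sqrt ((Re (?B u))\<^sup>2 + (Im (?B u))\<^sup>2)"
      by (simp add: cmod_def)
    also have "\<dots> \<le> sqrt ((K1 + K2) * \<tau>)"
      using K1(2)[OF \<tau>(1)] K2(2)[OF \<tau>(1)] by (intro real_sqrt_le_mono) (simp add: \<tau>(2) algebra_simps)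
    also have "\<dots> = K * sqrt \<tau>"
      by (simp add: K_def real_sqrt_mult)
    also have "sqrt \<tau> = (- u) powr (1 / 4)"
      using u by (simp add: \<tau>_def powr_half_sqrt[symmetric] powr_powr)
    also have "K * (- u) powr (1 / 4) \<le> M * (1 + \<bar>u\<bar>) powr (1 / 4)"
      using M K u by (intro mult_mono powr_mono2) auto
    finally show "norm (?B u) \<le> M * (1 + \<bar>u\<bar>) powr (1 / 4)" .
  qed
  show ?thesis
  proof (rule that[OF M(6)])
    show "norm (?A u) \<le> M" "norm (?B u) \<le> M * (1 + \<bar>u\<bar>) powr (1 / 4)" for u
      using far[of u] near[of u] by linarith+
    show "norm (?A u) \<le> M * exp (- u)" "norm (?B u) \<le> M * exp (- u)" for u
      using C0(2)[of u] C1(2)[of u] M(4,5) mult_right_mono[of C0 M "exp (- u)", OF _ exp_ge_zero] mult_right_mono[of C1 M "exp (- u)", OF _ exp_ge_zero]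
      by linarith+
  qed
qed

section \<open>Integration by parts against the phase\<close>

definition has_fst_derivative :: "(real \<times> real \<Rightarrow> complex) \<Rightarrow> (real \<times> real \<Rightarrow> complex) \<Rightarrow> bool" where
  "has_fst_derivative f f' \<longleftrightarrow>
     (\<forall>\<xi> \<eta>. ((\<lambda>s. f (s, \<eta>)) has_vector_derivative f' (\<xi>, \<eta>)) (at \<xi>))"

lemma has_fst_derivative_mult:
  "has_fst_derivative f f' \<Longrightarrow> has_fst_derivative g g' \<Longrightarrow>
    has_fst_derivative (\<lambda>p. f p * g p) (\<lambda>p. f' p * g p + f p * g' p)"
  unfolding has_fst_derivative_def
  by (auto intro!: has_vector_derivative_eq_rhs[OF has_vector_derivative_mult])

lemma has_fst_derivative_add:
  "has_fst_derivative f f' \<Longrightarrow> has_fst_derivative g g' \<Longrightarrow>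
    has_fst_derivative (\<lambda>p. f p + g p) (\<lambda>p. f' p + g' p)"
  unfolding has_fst_derivative_def by (auto intro!: has_vector_derivative_add)

lemma has_fst_derivative_diff:
  "has_fst_derivative f f' \<Longrightarrow> has_fst_derivative g g' \<Longrightarrow>
    has_fst_derivative (\<lambda>p. f p - g p) (\<lambda>p. f' p - g' p)"
  unfolding has_fst_derivative_def by (auto intro!: has_vector_derivative_diff)

text \<open>Phase, weight and cutoffs extend to complex \<xi> by the same formulas, so their
  derivatives come from the complex differentiation rules.\<close>

lemma has_fst_derivative_complexI:
  assumes "\<And>\<xi> \<eta>. (F \<eta> has_field_derivative f' (\<xi>, \<eta>)) (at (of_real \<xi>))"
    and "\<And>\<xi> \<eta>. f (\<xi>, \<eta>) = F \<eta> (of_real \<xi>)"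
  shows "has_fst_derivative f f'"
  unfolding has_fst_derivative_def assms(2)
  using has_vector_derivative_real_field[OF assms(1)] by blast

lemma integral_fst_derivative_eq_0:
  assumes "has_fst_derivative f f'" "integrable lborel f" "integrable lborel f'" "continuous_on UNIV f'"
  shows "(LINT p|lborel. f' p) = 0"
proof (rule integral_directional_derivative_eq_0[OF assms(2-4), of "(1, 0)"])
  fix p :: "real \<times> real"
  obtain \<xi> \<eta> where p: "p = (\<xi>, \<eta>)" by (cases p)
  have "((\<lambda>s. f (s, \<eta>)) \<circ> (\<lambda>s. \<xi> + s) has_vector_derivative 1 *\<^sub>R f' (\<xi>, \<eta>)) (at 0)"
    using assms(1)
    by (intro vector_diff_chain_at) (auto intro!: derivative_eq_intros simp: has_fst_derivative_def)
  then show "((\<lambda>s. f (p + s *\<^sub>R (1, 0))) has_vector_derivative f' p) (at 0)"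
    by (simp add: o_def p)
qed

lemma integrable_mult_bounded_continuous:
  fixes f h :: "'a::euclidean_space \<Rightarrow> complex"
  assumes "integrable lborel f" "continuous_on UNIV h" "\<And>p. norm (h p) \<le> C"
  shows "integrable lborel (\<lambda>p. f p * h p)"
proof (rule Bochner_Integration.integrable_bound)
  show "integrable lborel (\<lambda>p. norm (f p) * C)"
    using assms(1) by auto
  have [measurable]: "f \<in> borel_measurable borel" "h \<in> borel_measurable borel"
    using assms by (auto intro: borel_measurable_continuous_onI)
  show "(\<lambda>p. f p * h p) \<in> borel_measurable lborel"
    by simp
  have "0 \<le> C"
    using assms(3)[of 0] norm_ge_zero order_trans by blast
  then show "AE p in lborel. norm (f p * h p) \<le> norm (norm (f p) * C)"
    using assms(3) by (simp add: norm_mult mult_left_mono)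
qed

lemma
  fixes f g :: "real \<Rightarrow> 'a::{real_normed_field, banach, second_countable_topology}"
  assumes f: "integrable lborel f" and g: "integrable lborel g"
  shows integrable_lborel_product: "integrable lborel (\<lambda>(x, y). f x * g y)"
    and integral_lborel_product:
      "(LINT p|lborel. (\<lambda>(x, y). f x * g y) p) = (LINT x|lborel. f x) * (LINT x|lborel. g x)"
proof -
  have [measurable]: "f \<in> borel_measurable lborel" "g \<in> borel_measurable lborel"
    using f g by auto
  have int: "integrable (lborel \<Otimes>\<^sub>M lborel) (\<lambda>(x, y). f x * g y)"
  proof (rule lborel_pair.Fubini_integrable)
    show "(\<lambda>(x, y). f x * g y) \<in> borel_measurable (lborel \<Otimes>\<^sub>M lborel)"
      by measurable
  qed (use f g in \<open>auto simp: norm_mult\<close>)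
  then show "integrable lborel (\<lambda>(x, y). f x * g y)"
    by (simp add: lborel_prod)
  show "(LINT p|lborel. (\<lambda>(x, y). f x * g y) p) = (LINT x|lborel. f x) * (LINT x|lborel. g x)"
    using lborel_pair.integral_fst'[OF int] f g by (simp add: lborel_prod)
qed

locale airy_phase =
  fixes t x y :: real
  assumes t: "t > 0"
begin

abbreviation osc :: "real \<times> real \<Rightarrow> complex" where
  "osc p \<equiv> exp (\<i> * complex_of_real (phase x y t p))"

definition phase_xi :: "real \<times> real \<Rightarrow> real" where
  "phase_xi p = 3 * t * (fst p)\<^sup>2 + t * (snd p)\<^sup>2 + x"

text \<open>\<open>phase_xi\<close> is the derivative of the phase in \<open>\<xi>\<close>, which is elliptic at infinity. Since
  \<open>(1 + \<partial>\<^sub>\<xi>) osc = (1 + \<i> phase_xi) osc\<close>, integration by parts in \<open>\<xi>\<close> with the nowhere singular weight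
  \<open>w = 1 / (1 + \<i> phase_xi)\<close> replaces an amplitude \<open>b\<close> by \<open>b w - \<partial>\<^sub>\<xi> (b w)\<close>, a gain of two orders.\<close>

definition w :: "real \<times> real \<Rightarrow> complex" where
  "w p = 1 / (1 + \<i> * of_real (phase_xi p))"

text \<open>\<open>w1\<close> and \<open>w2\<close> are the first two \<xi>-derivatives of
  \<open>w\<close>, written as polynomials in \<open>w\<close> and \<xi> so that a bound for
  \<open>w\<close> yields bounds for them.\<close>

definition w1 :: "real \<times> real \<Rightarrow> complex" where
  "w1 p = - \<i> * of_real (6 * t * fst p) * (w p)\<^sup>2"

definition w2 :: "real \<times> real \<Rightarrow> complex" where
  "w2 p = - \<i> * of_real (6 * t) * (w p)\<^sup>2 - 2 * (of_real (6 * t * fst p))\<^sup>2 * (w p) ^ 3"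

lemma one_plus_i_real_nonzero [simp]: "1 + \<i> * complex_of_real r \<noteq> 0"
  by (simp add: complex_eq_iff)

lemma continuous_on_w [continuous_intros]: "continuous_on A w" "continuous_on A w1" "continuous_on A w2"
  unfolding w_def w1_def w2_def phase_xi_def by (intro continuous_intros ballI one_plus_i_real_nonzero)+

lemma continuous_on_osc [continuous_intros]: "continuous_on A osc"
  unfolding phase_def split_beta by (intro continuous_intros)

lemma norm_osc [simp]: "norm (osc p) = 1"
  by (simp add: norm_exp_i_times)

lemma has_fst_derivative_osc: "has_fst_derivative osc (\<lambda>p. \<i> * of_real (phase_xi p) * osc p)"
  by (rule has_fst_derivative_complexI[where F = "\<lambda>\<eta> z. exp (\<i> * (of_real t * z ^ 3 + of_real t * z * of_real \<eta> ^ 2 + of_real x * z + of_real (y * \<eta>)))"])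
    (auto intro!: derivative_eq_intros simp: phase_def phase_xi_def algebra_simps)

lemma has_fst_derivative_w: "has_fst_derivative w w1"
  by (rule has_fst_derivative_complexI[where F = "\<lambda>\<eta> z. 1 / (1 + \<i> * (3 * of_real t * z ^ 2 + of_real t * of_real \<eta> ^ 2 + of_real x))"])
    (use one_plus_i_real_nonzero[of "phase_xi (_, _)"] in \<open>auto intro!: derivative_eq_intros simp: w_def w1_def phase_xi_def power2_eq_square\<close>)

lemma has_fst_derivative_w1: "has_fst_derivative w1 w2"
proof -
  have 1: "has_fst_derivative (\<lambda>p. - \<i> * of_real (6 * t * fst p)) (\<lambda>p. - \<i> * of_real (6 * t))"
    by (rule has_fst_derivative_complexI[where F = "\<lambda>\<eta> z. - \<i> * (of_real (6 * t) * z)"]) (auto intro!: derivative_eq_intros)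
  have "has_fst_derivative (\<lambda>p. - \<i> * of_real (6 * t * fst p) * (w p * w p))
      (\<lambda>p. - \<i> * of_real (6 * t) * (w p * w p) + - \<i> * of_real (6 * t * fst p) * (w1 p * w p + w p * w1 p))"
    by (intro has_fst_derivative_mult 1 has_fst_derivative_w)
  moreover have "- \<i> * of_real (6 * t) * (w p * w p) + - \<i> * of_real (6 * t * fst p) * (w1 p * w p + w p * w1 p) = w2 p" for p
    by (simp add: w2_def w1_def power2_eq_square power3_eq_cube algebra_simps)
  ultimately show ?thesis
    by (simp add: w1_def[abs_def] power2_eq_square)
qed

text \<open>Makes the term integrable in which the derivative falls on the oscillating
  factor.\<close>

lemma norm_phase_xi_w: "norm (of_real (phase_xi p) * w p) \<le> 1"
proof -
  have "\<bar>Im (1 + \<i> * of_real (phase_xi p))\<bar> \<le> norm (1 + \<i> * of_real (phase_xi p))"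
    by (rule abs_Im_le_cmod)
  then have "\<bar>phase_xi p\<bar> / norm (1 + \<i> * of_real (phase_xi p)) \<le> 1"
    by (subst divide_le_eq) auto
  then show ?thesis
    by (simp add: w_def norm_mult norm_divide)
qed

text \<open>Ellipticity: t (\<xi>^2 + \<eta>^2) \<le> \<open>phase_xi\<close> + |x|, so |1 + \<i>
  \<open>phase_xi\<close>| is bounded below by a multiple of 1 + \<xi>^2 + \<eta>^2. Each power of
  \<xi> in \<open>w1\<close> and \<open>w2\<close> is outweighed by an additional factor
  \<open>w\<close>.\<close>

lemma weight_bound:
  obtains W where "W > 0"
    "\<And>p. norm (w p) \<le> W / (1 + (fst p)\<^sup>2 + (snd p)\<^sup>2)"
    "\<And>p. norm (w1 p) \<le> W / (1 + (fst p)\<^sup>2 + (snd p)\<^sup>2)"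
    "\<And>p. norm (w2 p) \<le> W / (1 + (fst p)\<^sup>2 + (snd p)\<^sup>2)"
proof
  define K where "K = 1 + (1 + \<bar>x\<bar>) / t"
  have K: "K \<ge> 1" using t by (simp add: K_def)
  define W where "W = K + 6 * t * K\<^sup>2 + 72 * t\<^sup>2 * K ^ 3"
  show "W > 0" using K t by (auto simp: W_def intro!: add_pos_nonneg)
  fix p :: "real \<times> real"
  obtain \<xi> \<eta> where p: "p = (\<xi>, \<eta>)" by (cases p)
  define S where "S = 1 + \<xi>\<^sup>2 + \<eta>\<^sup>2"
  have S: "S \<ge> 1" by (simp add: S_def)
  have xi: "\<bar>\<xi>\<bar> \<le> S" "\<xi>\<^sup>2 \<le> S"
  proof -
    have "0 \<le> (\<bar>\<xi>\<bar> - 1)\<^sup>2" by simp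
    then have "2 * \<bar>\<xi>\<bar> \<le> 1 + \<xi>\<^sup>2" by (simp add: power2_diff)
    moreover have "0 \<le> \<xi>\<^sup>2" "0 \<le> \<eta>\<^sup>2" by simp_all
    ultimately show "\<bar>\<xi>\<bar> \<le> S" "\<xi>\<^sup>2 \<le> S" unfolding S_def by linarith+
  qed
  let ?n = "norm (1 + \<i> * complex_of_real (phase_xi p))"
  \<comment> \<open>The norm \<open>?n\<close> is at least 1, so it absorbs both |x| and the summand
    1 of \<open>S\<close>; this produces the constant \<open>K\<close>.\<close>
  have "S \<le> K * ?n"
  proof -
    have "phase_xi p \<le> ?n" using abs_Im_le_cmod[of "1 + \<i> * of_real (phase_xi p)"] by simp
    moreover have n1: "1 \<le> ?n" using abs_Re_le_cmod[of "1 + \<i> * of_real (phase_xi p)"] by simp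
    moreover have "0 \<le> t * \<xi>\<^sup>2" using t by simp
    ultimately have "t * (\<xi>\<^sup>2 + \<eta>\<^sup>2) \<le> ?n + \<bar>x\<bar>"
      by (simp add: phase_xi_def p algebra_simps)
    also have "\<dots> \<le> ?n + \<bar>x\<bar> * ?n"
      using n1 mult_left_mono[OF n1, of "\<bar>x\<bar>"] by simp
    finally have "\<xi>\<^sup>2 + \<eta>\<^sup>2 \<le> (1 + \<bar>x\<bar>) / t * ?n"
      using t by (simp add: field_simps)
    with n1 show ?thesis by (simp add: S_def K_def distrib_right)
  qed
  then have w: "norm (w p) \<le> K / S"
    using S by (simp add: w_def norm_divide field_simps)
  have W: "norm (w p) ^ 2 \<le> K\<^sup>2 / S\<^sup>2" "norm (w p) ^ 3 \<le> K ^ 3 / S ^ 3"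
    using power_mono[OF w, of 2] power_mono[OF w, of 3] by (simp_all add: power_divide)
  have 1: "\<bar>\<xi>\<bar> * norm (w p) ^ 2 \<le> K\<^sup>2 / S"
  proof -
    have "\<bar>\<xi>\<bar> * norm (w p) ^ 2 \<le> S * (K\<^sup>2 / S\<^sup>2)"
      using S xi W by (intro mult_mono) auto
    then show ?thesis using S by (simp add: power2_eq_square)
  qed
  have 2: "norm (w p) ^ 2 \<le> K\<^sup>2 / S"
  proof -
    have "K\<^sup>2 / S\<^sup>2 \<le> K\<^sup>2 / S"
      using S by (intro divide_left_mono) (auto simp: power2_eq_square)
    with W(1) show ?thesis by linarith
  qed
  have 3: "\<xi>\<^sup>2 * norm (w p) ^ 3 \<le> K ^ 3 / S"
  proof -
    have "\<xi>\<^sup>2 * norm (w p) ^ 3 \<le> S * (K ^ 3 / S ^ 3)"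
      using S xi W by (intro mult_mono) auto
    also have "\<dots> = K ^ 3 / S\<^sup>2" using S by (simp add: power3_eq_cube power2_eq_square)
    also have "\<dots> \<le> K ^ 3 / S"
      using S K by (intro divide_left_mono) (auto simp: power2_eq_square)
    finally show ?thesis .
  qed
  have pos: "0 \<le> K / S" "0 \<le> 6 * t * (K\<^sup>2 / S)" "0 \<le> 72 * t\<^sup>2 * (K ^ 3 / S)"
    using K S t by auto
  have WS: "W / (1 + (fst p)\<^sup>2 + (snd p)\<^sup>2) = K / S + 6 * t * (K\<^sup>2 / S) + 72 * t\<^sup>2 * (K ^ 3 / S)"
    by (simp add: W_def S_def p add_divide_distrib)
  show "norm (w p) \<le> W / (1 + (fst p)\<^sup>2 + (snd p)\<^sup>2)"
    unfolding WS using w pos by linarith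
  have "norm (w1 p) = 6 * t * (\<bar>\<xi>\<bar> * norm (w p) ^ 2)"
    using t by (simp add: w1_def p norm_mult norm_power abs_mult)
  also have "\<dots> \<le> 6 * t * (K\<^sup>2 / S)"
    using 1 t by (intro mult_left_mono) auto
  finally show "norm (w1 p) \<le> W / (1 + (fst p)\<^sup>2 + (snd p)\<^sup>2)"
    unfolding WS using pos by linarith
  have "norm (w2 p) \<le> norm (- \<i> * of_real (6 * t) * (w p)\<^sup>2) + norm (2 * (of_real (6 * t * fst p))\<^sup>2 * (w p) ^ 3)"
    unfolding w2_def by (rule norm_triangle_ineq4)
  also have "\<dots> = 6 * t * norm (w p) ^ 2 + 72 * t\<^sup>2 * (\<xi>\<^sup>2 * norm (w p) ^ 3)"
    using t by (simp add: p norm_mult norm_power power_mult_distrib)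
  also have "\<dots> \<le> 6 * t * (K\<^sup>2 / S) + 72 * t\<^sup>2 * (K ^ 3 / S)"
    using 2 3 t by (intro add_mono mult_left_mono) auto
  finally show "norm (w2 p) \<le> W / (1 + (fst p)\<^sup>2 + (snd p)\<^sup>2)"
    unfolding WS using pos by linarith
qed

lemma weight_bounded:
  obtains C where "\<And>p. norm (w p) \<le> C" "\<And>p. norm (w1 p) \<le> C" "\<And>p. norm (w2 p) \<le> C"
proof -
  obtain W where W: "W > 0"
    "\<And>p. norm (w p) \<le> W / (1 + (fst p)\<^sup>2 + (snd p)\<^sup>2)"
    "\<And>p. norm (w1 p) \<le> W / (1 + (fst p)\<^sup>2 + (snd p)\<^sup>2)"
    "\<And>p. norm (w2 p) \<le> W / (1 + (fst p)\<^sup>2 + (snd p)\<^sup>2)"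
    using weight_bound by blast
  have "W / (1 + (fst p)\<^sup>2 + (snd p)\<^sup>2) \<le> W / 1" for p :: "real \<times> real"
    using W(1) by (intro divide_left_mono) (auto intro!: add_pos_nonneg)
  then have "a \<le> W" if "a \<le> W / (1 + (fst p)\<^sup>2 + (snd p)\<^sup>2)" for a and p :: "real \<times> real"
    using that order_trans by fastforce
  with W(2-4) show ?thesis
    by (intro that[of W]) blast+
qed

text \<open>Adding the \<xi>-derivative of \<open>b w osc\<close>, whose integral vanishes, turns
  the right integrand into \<open>b (1 + \<i> phase_xi) w osc\<close>, which is
  \<open>b osc\<close>.\<close>

lemma integral_osc_by_parts:
  assumes b: "continuous_on UNIV b" "integrable lborel b"
    and b1: "continuous_on UNIV b1" "integrable lborel b1"
    and deriv: "has_fst_derivative b b1"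
  shows "(LINT p|lborel. b p * osc p) = (LINT p|lborel. (b p * w p - b1 p * w p - b p * w1 p) * osc p)"
proof -
  obtain C where C: "\<And>p. norm (w p) \<le> C" "\<And>p. norm (w1 p) \<le> C"
    using weight_bounded by metis
  let ?f = "\<lambda>p. b p * w p * osc p"
  let ?f' = "\<lambda>p. (b1 p * w p + b p * w1 p) * osc p + b p * w p * (\<i> * of_real (phase_xi p) * osc p)"
  have i1: "integrable lborel (\<lambda>p. b p * (w p * osc p))" "integrable lborel (\<lambda>p. b1 p * (w p * osc p))"
     "integrable lborel (\<lambda>p. b p * (w1 p * osc p))"
    using C by (auto intro!: integrable_mult_bounded_continuous[where C = C] b b1 continuous_intros simp: norm_mult)
  have i2: "integrable lborel (\<lambda>p. b p * (\<i> * (of_real (phase_xi p) * w p) * osc p))"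
    using norm_phase_xi_w
    by (auto intro!: integrable_mult_bounded_continuous[where C = 1] b continuous_intros simp: norm_mult phase_xi_def)
  have "(LINT p|lborel. ?f' p) = 0"
  proof (rule integral_fst_derivative_eq_0)
    show "has_fst_derivative ?f ?f'"
      by (intro has_fst_derivative_mult deriv has_fst_derivative_w has_fst_derivative_osc)
    show "integrable lborel ?f" using i1(1) by (simp add: mult.assoc)
    show "integrable lborel ?f'"
      using Bochner_Integration.integrable_add[OF Bochner_Integration.integrable_add[OF i1(2,3)] i2]
      by (simp add: algebra_simps)
    show "continuous_on UNIV ?f'"
      unfolding phase_xi_def by (intro continuous_intros b b1)
  qed
  moreover have "integrable lborel ?f'"
    using Bochner_Integration.integrable_add[OF Bochner_Integration.integrable_add[OF i1(2,3)] i2]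
    by (simp add: algebra_simps)
  moreover have "integrable lborel (\<lambda>p. (b p * w p - b1 p * w p - b p * w1 p) * osc p)"
    using Bochner_Integration.integrable_diff[OF Bochner_Integration.integrable_diff[OF i1(1,2)] i1(3)]
    by (simp add: algebra_simps)
  ultimately have "(LINT p|lborel. (b p * w p - b1 p * w p - b p * w1 p) * osc p)
      = (LINT p|lborel. (b p * w p - b1 p * w p - b p * w1 p) * osc p + ?f' p)"
    by simp
  also have "\<dots> = (LINT p|lborel. b p * osc p)"
  proof (rule Bochner_Integration.integral_cong[OF refl])
    fix p
    have "(b p * w p - b1 p * w p - b p * w1 p) * osc p + ?f' p = b p * ((1 + \<i> * of_real (phase_xi p)) * w p) * osc p"
      by (simp add: algebra_simps)
    also have "(1 + \<i> * of_real (phase_xi p)) * w p = 1"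
      by (simp add: w_def)
    finally show "(b p * w p - b1 p * w p - b p * w1 p) * osc p + ?f' p = b p * osc p"
      by simp
  qed
  finally show ?thesis ..
qed

text \<open>The amplitude after two integrations by parts. Its arguments are the values at one point
  of the original amplitude and of its first two derivatives, on which it depends linearly, so
  pointwise limits and bounds pass through.\<close>

definition parts2 :: "complex \<Rightarrow> complex \<Rightarrow> complex \<Rightarrow> real \<times> real \<Rightarrow> complex" where
  "parts2 b b1 b2 p =
     (b * w p - b1 * w p - b * w1 p) * w p
     - ((b1 * w p + b * w1 p) - (b2 * w p + b1 * w1 p) - (b1 * w1 p + b * w2 p)) * w p
     - (b * w p - b1 * w p - b * w1 p) * w1 p"

lemma integral_osc_by_parts2:
  assumes b: "continuous_on UNIV b" "integrable lborel b"
    and b1: "continuous_on UNIV b1" "integrable lborel b1"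
    and b2: "continuous_on UNIV b2" "integrable lborel b2"
    and deriv: "has_fst_derivative b b1" "has_fst_derivative b1 b2"
  shows "(LINT p|lborel. b p * osc p) = (LINT p|lborel. parts2 (b p) (b1 p) (b2 p) p * osc p)"
proof -
  obtain C where C: "\<And>p. norm (w p) \<le> C" "\<And>p. norm (w1 p) \<le> C" "\<And>p. norm (w2 p) \<le> C"
    using weight_bounded by metis
  have int: "integrable lborel (\<lambda>p. f p * h p)"
    if "integrable lborel f" "h = w \<or> h = w1 \<or> h = w2" for f h
    using that C by (auto intro!: integrable_mult_bounded_continuous continuous_intros)
  \<comment> \<open>\<open>?c\<close> is the amplitude after the first integration by parts and
    \<open>?c1\<close> its \<xi>-derivative.\<close>
  let ?c = "\<lambda>p. b p * w p - b1 p * w p - b p * w1 p"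
  let ?c1 = "\<lambda>p. (b1 p * w p + b p * w1 p) - (b2 p * w p + b1 p * w1 p) - (b1 p * w1 p + b p * w2 p)"
  have "(LINT p|lborel. ?c p * osc p) = (LINT p|lborel. (?c p * w p - ?c1 p * w p - ?c p * w1 p) * osc p)"
  proof (rule integral_osc_by_parts)
    show "continuous_on UNIV ?c" "continuous_on UNIV ?c1"
      by (intro continuous_intros b b1 b2)+
    show "integrable lborel ?c" "integrable lborel ?c1"
      by (intro Bochner_Integration.integrable_diff Bochner_Integration.integrable_add int b b1 b2; simp)+
    show "has_fst_derivative ?c ?c1"
      by (intro has_fst_derivative_diff has_fst_derivative_mult deriv has_fst_derivative_w has_fst_derivative_w1)
  qed
  then show ?thesis
    using integral_osc_by_parts[OF b b1 deriv(1)] by (simp add: parts2_def)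
qed

end

section \<open>Limits of cutoff integrals\<close>

text \<open>The shape of the dominating function: an amplitude of order one times two weights of
  order -2.\<close>

lemma integrable_plane_decay:
  "integrable lborel (\<lambda>p. (1 + \<bar>fst p\<bar>) / (1 + (fst p)\<^sup>2 + (snd p)\<^sup>2)\<^sup>2 :: real)"
proof (rule Bochner_Integration.integrable_bound)
  show "integrable lborel (\<lambda>p::real \<times> real. 16 * (case p of (\<xi>, \<eta>) \<Rightarrow> (1 + \<bar>\<xi>\<bar>) powr (- 3 / 2) * (1 + \<bar>\<eta>\<bar>) powr (- 3 / 2)))"
    by (intro integrable_mult_right integrable_lborel_product integrable_one_plus_abs_powr)
  have "continuous_on UNIV (\<lambda>p::real \<times> real. (1 + \<bar>fst p\<bar>) / (1 + (fst p)\<^sup>2 + (snd p)\<^sup>2)\<^sup>2)"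
    by (intro continuous_intros) (auto simp: add_nonneg_eq_0_iff)
  then show "(\<lambda>p::real \<times> real. (1 + \<bar>fst p\<bar>) / (1 + (fst p)\<^sup>2 + (snd p)\<^sup>2)\<^sup>2) \<in> borel_measurable lborel"
    by (simp add: borel_measurable_continuous_onI)
  have "(1 + \<bar>\<xi>\<bar>) / (1 + \<xi>\<^sup>2 + \<eta>\<^sup>2)\<^sup>2 \<le> 16 * ((1 + \<bar>\<xi>\<bar>) powr (- 3 / 2) * (1 + \<bar>\<eta>\<bar>) powr (- 3 / 2))" for \<xi> \<eta> :: real
  proof -
    define S where "S = 1 + \<xi>\<^sup>2 + \<eta>\<^sup>2"
    have S: "S \<ge> 1" by (simp add: S_def)
    have le: "1 + \<bar>r\<bar> \<le> 2 * sqrt S" if "r\<^sup>2 \<le> S - 1" for r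
    proof -
      have "0 \<le> (\<bar>r\<bar> - 1)\<^sup>2" by simp
      then have "(1 + \<bar>r\<bar>)\<^sup>2 \<le> 2 * (1 + r\<^sup>2)" by (simp add: power2_eq_square algebra_simps abs_mult_self_eq)
      also have "\<dots> \<le> 4 * S" using that S by simp
      also have "\<dots> = (2 * sqrt S)\<^sup>2" using S by (simp add: power_mult_distrib)
      finally show ?thesis
        using S by (intro power2_le_imp_le[of "1 + \<bar>r\<bar>"]) auto
    qed
    \<comment> \<open>Both 1 + |\<xi>| and 1 + |\<eta>| are at most 2 sqrt S; distributing the
      fourth power as 5/2 + 3/2 gives the constant 16.\<close>
    have "(1 + \<bar>\<xi>\<bar>) powr (5 / 2) * (1 + \<bar>\<eta>\<bar>) powr (3 / 2) \<le> (2 * sqrt S) powr (5 / 2) * (2 * sqrt S) powr (3 / 2)"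
      by (intro mult_mono powr_mono2 le) (auto simp: S_def)
    also have "\<dots> = (2 * sqrt S) powr 4"
      by (simp flip: powr_add)
    also have "\<dots> = (2 * sqrt S) ^ 4"
      using S by (subst powr_numeral[symmetric]) auto
    also have "\<dots> = 16 * S\<^sup>2"
      using S by (simp add: power_mult_distrib power4_eq_xxxx power2_eq_square)
    finally have *: "(1 + \<bar>\<xi>\<bar>) powr (5 / 2) * (1 + \<bar>\<eta>\<bar>) powr (3 / 2) \<le> 16 * S\<^sup>2" .
    have "1 + \<bar>\<xi>\<bar> = (1 + \<bar>\<xi>\<bar>) powr (5 / 2 + - 3 / 2)"
      by simp
    then have 1: "1 + \<bar>\<xi>\<bar> = (1 + \<bar>\<xi>\<bar>) powr (5 / 2) * (1 + \<bar>\<xi>\<bar>) powr (- 3 / 2)"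
      by (simp only: powr_add)
    have 2: "(1 + \<bar>\<eta>\<bar>) powr (3 / 2) * (1 + \<bar>\<eta>\<bar>) powr (- 3 / 2) = 1"
      by (simp flip: powr_add)
    have "1 + \<bar>\<xi>\<bar> = ((1 + \<bar>\<xi>\<bar>) powr (5 / 2) * (1 + \<bar>\<eta>\<bar>) powr (3 / 2)) * ((1 + \<bar>\<xi>\<bar>) powr (- 3 / 2) * (1 + \<bar>\<eta>\<bar>) powr (- 3 / 2))"
    proof -
      have E: "(1 + \<bar>\<xi>\<bar>) powr (5 / 2) * (1 + \<bar>\<eta>\<bar>) powr (3 / 2) * ((1 + \<bar>\<xi>\<bar>) powr (- 3 / 2) * (1 + \<bar>\<eta>\<bar>) powr (- 3 / 2))
        = ((1 + \<bar>\<xi>\<bar>) powr (5 / 2) * (1 + \<bar>\<xi>\<bar>) powr (- 3 / 2)) * ((1 + \<bar>\<eta>\<bar>) powr (3 / 2) * (1 + \<bar>\<eta>\<bar>) powr (- 3 / 2))"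
        by (simp only: mult_ac)
      show ?thesis
        unfolding E 2 mult_1_right by (rule 1)
    qed
    also have "\<dots> \<le> 16 * S\<^sup>2 * ((1 + \<bar>\<xi>\<bar>) powr (- 3 / 2) * (1 + \<bar>\<eta>\<bar>) powr (- 3 / 2))"
      using * by (intro mult_right_mono) auto
    finally show ?thesis
      using S by (simp add: divide_le_eq mult_ac flip: S_def)
  qed
  then show "AE p in lborel. norm ((1 + \<bar>fst p\<bar>) / (1 + (fst p)\<^sup>2 + (snd p)\<^sup>2)\<^sup>2) \<le>
      norm (16 * (case p of (\<xi>, \<eta>) \<Rightarrow> (1 + \<bar>\<xi>\<bar>) powr (- 3 / 2) * (1 + \<bar>\<eta>\<bar>) powr (- 3 / 2 :: real)))"
    by (auto simp: split_beta)
qed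

lemma integrable_mult_linear_growth:
  fixes f h :: "real \<times> real \<Rightarrow> complex"
  assumes f: "integrable lborel (\<lambda>p. (1 + \<bar>fst p\<bar>) *\<^sub>R f p)" and h: "continuous_on UNIV h"
    and bound: "\<And>p. norm (h p) \<le> C * (1 + \<bar>fst p\<bar>)"
  shows "integrable lborel (\<lambda>p. h p * f p)"
proof -
  have nz: "1 + \<bar>fst p\<bar> \<noteq> 0" for p :: "real \<times> real"
    by (simp add: add_nonneg_eq_0_iff)
  have "integrable lborel (\<lambda>p. ((1 + \<bar>fst p\<bar>) *\<^sub>R f p) * (h p /\<^sub>R (1 + \<bar>fst p\<bar>)))"
  proof (rule integrable_mult_bounded_continuous[OF f])
    show "continuous_on UNIV (\<lambda>p. h p /\<^sub>R (1 + \<bar>fst p\<bar>))"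
      using nz by (intro continuous_intros h) auto
    show "norm (h p /\<^sub>R (1 + \<bar>fst p\<bar>)) \<le> C" for p
      using bound[of p] by (simp add: divide_le_eq flip: divide_inverse_commute)
  qed
  also have "(\<lambda>p. ((1 + \<bar>fst p\<bar>) *\<^sub>R f p) * (h p /\<^sub>R (1 + \<bar>fst p\<bar>))) = (\<lambda>p. h p * f p)"
    using nz by (simp add: fun_eq_iff mult.commute)
  finally show ?thesis .
qed

context airy_phase
begin

text \<open>The regularised value of the integral of \<open>(\<alpha> + \<beta> \<xi>) osc\<close>: the absolutely convergent
  integral left after two integrations by parts without cutoff.\<close>

definition osc_limit :: "complex \<Rightarrow> complex \<Rightarrow> complex" where
  "osc_limit \<alpha> \<beta> = (LINT p|lborel. parts2 (\<alpha> + \<beta> * of_real (fst p)) \<beta> 0 p * osc p)"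

lemma continuous_on_parts2:
  "continuous_on A b \<Longrightarrow> continuous_on A b1 \<Longrightarrow> continuous_on A b2 \<Longrightarrow>
    continuous_on A (\<lambda>p. parts2 (b p) (b1 p) (b2 p) p)"
  unfolding parts2_def
  by (intro continuous_on_diff continuous_on_add continuous_on_mult continuous_on_w)

text \<open>Expanded, \<open>parts2\<close> is a sum of 3 + 6 + 3 products, each of one amplitude
  value and two weights.\<close>

lemma norm_parts2:
  assumes "norm b \<le> B" "norm b1 \<le> B" "norm b2 \<le> B"
    and "norm (w p) \<le> W" "norm (w1 p) \<le> W" "norm (w2 p) \<le> W"
  shows "norm (parts2 b b1 b2 p) \<le> 12 * B * W\<^sup>2"
proof -
  have B: "0 \<le> B" and W: "0 \<le> W"
    using assms norm_ge_zero order_trans by blast+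
  have m: "norm (a * v) \<le> A * W" if "norm a \<le> A" "norm v \<le> W" "0 \<le> A" for a v :: complex and A
    using that W by (auto simp: norm_mult intro!: mult_mono)
  define c where "c = b * w p - b1 * w p - b * w1 p"
  define c1 where "c1 = (b1 * w p + b * w1 p) - (b2 * w p + b1 * w1 p) - (b1 * w1 p + b * w2 p)"
  have "norm c \<le> norm (b * w p) + norm (b1 * w p) + norm (b * w1 p)"
    unfolding c_def by (intro norm_triangle_le_diff add_mono order_refl)
  then have c: "norm c \<le> 3 * B * W"
    using m[OF assms(1,4) B] m[OF assms(2,4) B] m[OF assms(1,5) B] by linarith
  have "norm c1 \<le> (norm (b1 * w p) + norm (b * w1 p)) + (norm (b2 * w p) + norm (b1 * w1 p))
      + (norm (b1 * w1 p) + norm (b * w2 p))"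
    unfolding c1_def by (intro norm_triangle_le_diff norm_triangle_le add_mono order_refl)
  then have c1: "norm c1 \<le> 6 * B * W"
    using m[OF assms(2,4) B] m[OF assms(1,5) B] m[OF assms(3,4) B] m[OF assms(2,5) B] m[OF assms(1,6) B] by linarith
  have "norm (c * w p - c1 * w p - c * w1 p) \<le> norm (c * w p) + norm (c1 * w p) + norm (c * w1 p)"
    by (intro norm_triangle_le_diff add_mono order_refl)
  also have "\<dots> \<le> 3 * B * W * W + 6 * B * W * W + 3 * B * W * W"
    using B W by (intro add_mono m c c1 assms) auto
  finally show ?thesis
    by (simp add: parts2_def c_def c1_def power2_eq_square)
qed

text \<open>After two integrations by parts the integrands are dominated uniformly in
  \<open>n\<close>, and they converge pointwise to the integrand without cutoff, because the
  derivatives of the cutoff tend to 0. Integrability of the cutoff amplitudes serves only to justify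
  the integrations by parts.\<close>

lemma cutoff_integral_tendsto:
  fixes g g1 g2 :: "nat \<Rightarrow> real \<times> real \<Rightarrow> complex"
  assumes deriv: "\<And>n. has_fst_derivative (g n) (g1 n)" "\<And>n. has_fst_derivative (g1 n) (g2 n)"
    and cont: "\<And>n. continuous_on UNIV (g n)" "\<And>n. continuous_on UNIV (g1 n)" "\<And>n. continuous_on UNIV (g2 n)"
    and int: "\<And>n. integrable lborel (\<lambda>p. (1 + \<bar>fst p\<bar>) *\<^sub>R g n p)"
      "\<And>n. integrable lborel (\<lambda>p. (1 + \<bar>fst p\<bar>) *\<^sub>R g1 n p)"
      "\<And>n. integrable lborel (\<lambda>p. (1 + \<bar>fst p\<bar>) *\<^sub>R g2 n p)"
    and bound: "\<And>n p. norm (g n p) \<le> C" "\<And>n p. norm (g1 n p) \<le> C" "\<And>n p. norm (g2 n p) \<le> C"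
    and lim: "\<And>p. (\<lambda>n. g n p) \<longlonglongrightarrow> 1" "\<And>p. (\<lambda>n. g1 n p) \<longlonglongrightarrow> 0" "\<And>p. (\<lambda>n. g2 n p) \<longlonglongrightarrow> 0"
    and \<alpha>: "\<alpha> \<longlonglongrightarrow> \<alpha>'"
  shows "(\<lambda>n. LINT p|lborel. (\<alpha> n + \<beta> * of_real (fst p)) * g n p * osc p) \<longlonglongrightarrow> osc_limit \<alpha>' \<beta>"
proof -
  define b where "b n p = (\<alpha> n + \<beta> * of_real (fst p)) * g n p" for n p
  define b1 where "b1 n p = \<beta> * g n p + (\<alpha> n + \<beta> * of_real (fst p)) * g1 n p" for n p
  define b2 where "b2 n p = 2 * \<beta> * g1 n p + (\<alpha> n + \<beta> * of_real (fst p)) * g2 n p" for n p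
  have amp: "has_fst_derivative (\<lambda>p. \<alpha> n + \<beta> * of_real (fst p)) (\<lambda>p. \<beta>)" for n
    by (rule has_fst_derivative_complexI[where F = "\<lambda>\<eta> z. \<alpha> n + \<beta> * z"]) (auto intro!: derivative_eq_intros)
  have db: "has_fst_derivative (b n) (b1 n)" for n
    unfolding b_def b1_def by (intro has_fst_derivative_mult amp deriv)
  have db1: "has_fst_derivative (b1 n) (b2 n)" for n
  proof -
    have "has_fst_derivative (\<lambda>p. \<beta>) (\<lambda>p. 0)"
      by (simp add: has_fst_derivative_def)
    then have "has_fst_derivative (b1 n)
        (\<lambda>p. (0 * g n p + \<beta> * g1 n p) + (\<beta> * g1 n p + (\<alpha> n + \<beta> * of_real (fst p)) * g2 n p))"
      unfolding b1_def by (intro has_fst_derivative_mult has_fst_derivative_add amp deriv)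
    then show ?thesis
      by (simp add: b2_def[abs_def] algebra_simps)
  qed
  have cb: "continuous_on UNIV (b n)" "continuous_on UNIV (b1 n)" "continuous_on UNIV (b2 n)" for n
    unfolding b_def b1_def b2_def by (intro continuous_intros cont)+
  have ib: "integrable lborel (b n)" "integrable lborel (b1 n)" "integrable lborel (b2 n)" for n
  proof -
    have const: "norm a \<le> norm a * (1 + \<bar>fst p\<bar>)" for a :: complex and p :: "real \<times> real"
      using mult_left_mono[of 1 "1 + \<bar>fst p\<bar>" "norm a"] by simp
    have affine: "norm (\<alpha> n + \<beta> * of_real (fst p)) \<le> (norm (\<alpha> n) + norm \<beta>) * (1 + \<bar>fst p\<bar>)" for p :: "real \<times> real"
    proof -
      have "norm (\<alpha> n + \<beta> * of_real (fst p)) \<le> norm (\<alpha> n) + norm \<beta> * \<bar>fst p\<bar>"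
        by (intro norm_triangle_le) (simp add: norm_mult)
      also have "\<dots> \<le> (norm (\<alpha> n) + norm \<beta>) * (1 + \<bar>fst p\<bar>)"
        by (simp add: algebra_simps)
      finally show ?thesis .
    qed
    have 0: "integrable lborel (\<lambda>p. a * f p)"
      if "integrable lborel (\<lambda>p. (1 + \<bar>fst p\<bar>) *\<^sub>R f p)" for a and f :: "real \<times> real \<Rightarrow> complex"
      by (rule integrable_mult_linear_growth[OF that _ const]) (intro continuous_intros)
    have 2: "integrable lborel (\<lambda>p. (\<alpha> n + \<beta> * of_real (fst p)) * f p)"
      if "integrable lborel (\<lambda>p. (1 + \<bar>fst p\<bar>) *\<^sub>R f p)" for f :: "real \<times> real \<Rightarrow> complex"
      by (rule integrable_mult_linear_growth[OF that _ affine]) (intro continuous_intros)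
    show "integrable lborel (b n)" "integrable lborel (b1 n)" "integrable lborel (b2 n)"
      unfolding b_def b1_def b2_def by (intro Bochner_Integration.integrable_add 0 2 int)+
  qed
  obtain A where A: "\<And>n. norm (\<alpha> n) \<le> A"
    using convergent_imp_Bseq[OF convergentI[OF \<alpha>]] by (auto simp: Bseq_def)
  obtain W where W: "W > 0"
    "\<And>p. norm (w p) \<le> W / (1 + (fst p)\<^sup>2 + (snd p)\<^sup>2)"
    "\<And>p. norm (w1 p) \<le> W / (1 + (fst p)\<^sup>2 + (snd p)\<^sup>2)"
    "\<And>p. norm (w2 p) \<le> W / (1 + (fst p)\<^sup>2 + (snd p)\<^sup>2)"
    using weight_bound by blast
  \<comment> \<open>The second derivative of the amplitude contains \<open>2 * \<beta> * g1\<close>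
    besides the affine factor times \<open>g2\<close>; this accounts for the three copies of
    \<open>norm \<beta>\<close>.\<close>
  define D where "D = (A + 3 * norm \<beta>) * C"
  have A0: "0 \<le> A" and C0: "0 \<le> C"
    using A bound norm_ge_zero order_trans by blast+
  have nb: "norm (b n p) \<le> D * (1 + \<bar>fst p\<bar>)" "norm (b1 n p) \<le> D * (1 + \<bar>fst p\<bar>)" "norm (b2 n p) \<le> D * (1 + \<bar>fst p\<bar>)" for n p
  proof -
    have "norm (\<alpha> n + \<beta> * of_real (fst p)) \<le> A + norm \<beta> * \<bar>fst p\<bar>"
      using A[of n] by (intro norm_triangle_le) (simp add: norm_mult)
    also have "\<dots> \<le> (A + norm \<beta>) * (1 + \<bar>fst p\<bar>)"
      using A0 by (simp add: algebra_simps)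
    finally have a: "norm (\<alpha> n + \<beta> * of_real (fst p)) \<le> (A + norm \<beta>) * (1 + \<bar>fst p\<bar>)" .
    have m: "norm ((\<alpha> n + \<beta> * of_real (fst p)) * v) \<le> (A + norm \<beta>) * C * (1 + \<bar>fst p\<bar>)" if "norm v \<le> C" for v
    proof -
      have "norm ((\<alpha> n + \<beta> * of_real (fst p)) * v) \<le> ((A + norm \<beta>) * (1 + \<bar>fst p\<bar>)) * C"
        unfolding norm_mult using a that C0 A0 by (intro mult_mono) auto
      then show ?thesis by (simp add: mult_ac)
    qed
    have k: "norm (\<beta> * v) \<le> norm \<beta> * C * (1 + \<bar>fst p\<bar>)" if "norm v \<le> C" for v
    proof -
      have "norm (\<beta> * v) \<le> norm \<beta> * C * 1"
        using that by (simp add: norm_mult mult_left_mono)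
      also have "\<dots> \<le> norm \<beta> * C * (1 + \<bar>fst p\<bar>)"
        using C0 by (intro mult_left_mono) auto
      finally show ?thesis .
    qed
    have D: "D * (1 + \<bar>fst p\<bar>) = (A + norm \<beta>) * C * (1 + \<bar>fst p\<bar>) + 2 * (norm \<beta> * C * (1 + \<bar>fst p\<bar>))"
      by (simp add: D_def algebra_simps)
    have pos: "0 \<le> norm \<beta> * C * (1 + \<bar>fst p\<bar>)" using C0 by simp
    show "norm (b n p) \<le> D * (1 + \<bar>fst p\<bar>)"
      unfolding D b_def using m[OF bound(1), of n p] pos by linarith
    have "norm (b1 n p) \<le> norm \<beta> * C * (1 + \<bar>fst p\<bar>) + (A + norm \<beta>) * C * (1 + \<bar>fst p\<bar>)"
      unfolding b1_def by (intro norm_triangle_le add_mono k m bound)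
    then show "norm (b1 n p) \<le> D * (1 + \<bar>fst p\<bar>)"
      unfolding D using pos by linarith
    have "norm (2 * (\<beta> * g1 n p)) \<le> 2 * (norm \<beta> * C * (1 + \<bar>fst p\<bar>))"
      using k[OF bound(2), of n p] by (simp add: norm_mult)
    then have "norm (b2 n p) \<le> 2 * (norm \<beta> * C * (1 + \<bar>fst p\<bar>)) + (A + norm \<beta>) * C * (1 + \<bar>fst p\<bar>)"
      unfolding b2_def mult.assoc[of 2 \<beta>] by (intro norm_triangle_le add_mono m bound)
    then show "norm (b2 n p) \<le> D * (1 + \<bar>fst p\<bar>)"
      unfolding D by linarith
  qed
  have "(\<lambda>n. LINT p|lborel. parts2 (b n p) (b1 n p) (b2 n p) p * osc p) \<longlonglongrightarrow> osc_limit \<alpha>' \<beta>"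
    unfolding osc_limit_def
  proof (rule integral_dominated_convergence[where w = "\<lambda>p. 12 * D * W\<^sup>2 * ((1 + \<bar>fst p\<bar>) / (1 + (fst p)\<^sup>2 + (snd p)\<^sup>2)\<^sup>2)"])
    show "integrable lborel (\<lambda>p::real \<times> real. 12 * D * W\<^sup>2 * ((1 + \<bar>fst p\<bar>) / (1 + (fst p)\<^sup>2 + (snd p)\<^sup>2)\<^sup>2))"
      by (intro integrable_mult_right integrable_plane_decay)
    have "continuous_on UNIV (\<lambda>p. parts2 (\<alpha>' + \<beta> * of_real (fst p)) \<beta> 0 p * osc p)"
      by (intro continuous_on_mult continuous_on_parts2 continuous_on_osc) (intro continuous_intros)+
    then show "(\<lambda>p. parts2 (\<alpha>' + \<beta> * of_real (fst p)) \<beta> 0 p * osc p) \<in> borel_measurable lborel"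
      by (simp add: borel_measurable_continuous_onI)
    have "continuous_on UNIV (\<lambda>p. parts2 (b n p) (b1 n p) (b2 n p) p * osc p)" for n
      by (intro continuous_on_mult continuous_on_parts2 continuous_on_osc cb)
    then show "(\<lambda>p. parts2 (b n p) (b1 n p) (b2 n p) p * osc p) \<in> borel_measurable lborel" for n
      by (simp add: borel_measurable_continuous_onI)
    show "AE p in lborel. (\<lambda>n. parts2 (b n p) (b1 n p) (b2 n p) p * osc p) \<longlonglongrightarrow> parts2 (\<alpha>' + \<beta> * of_real (fst p)) \<beta> 0 p * osc p"
    proof (rule AE_I2)
      fix p :: "real \<times> real"
      have "(\<lambda>n. b n p) \<longlonglongrightarrow> (\<alpha>' + \<beta> * of_real (fst p)) * 1"
        "(\<lambda>n. b1 n p) \<longlonglongrightarrow> \<beta> * 1 + (\<alpha>' + \<beta> * of_real (fst p)) * 0"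
        "(\<lambda>n. b2 n p) \<longlonglongrightarrow> 2 * \<beta> * 0 + (\<alpha>' + \<beta> * of_real (fst p)) * 0"
        unfolding b_def b1_def b2_def by (intro tendsto_intros lim \<alpha>)+
      then show "(\<lambda>n. parts2 (b n p) (b1 n p) (b2 n p) p * osc p) \<longlonglongrightarrow> parts2 (\<alpha>' + \<beta> * of_real (fst p)) \<beta> 0 p * osc p"
        unfolding parts2_def by (intro tendsto_intros) auto
    qed
    show "AE p in lborel. norm (parts2 (b n p) (b1 n p) (b2 n p) p * osc p)
        \<le> 12 * D * W\<^sup>2 * ((1 + \<bar>fst p\<bar>) / (1 + (fst p)\<^sup>2 + (snd p)\<^sup>2)\<^sup>2)" for n
    proof (rule AE_I2)
      fix p
      have "norm (parts2 (b n p) (b1 n p) (b2 n p) p) \<le> 12 * (D * (1 + \<bar>fst p\<bar>)) * (W / (1 + (fst p)\<^sup>2 + (snd p)\<^sup>2))\<^sup>2"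
        by (intro norm_parts2 nb W)
      then show "norm (parts2 (b n p) (b1 n p) (b2 n p) p * osc p)
        \<le> 12 * D * W\<^sup>2 * ((1 + \<bar>fst p\<bar>) / (1 + (fst p)\<^sup>2 + (snd p)\<^sup>2)\<^sup>2)"
        by (simp add: norm_mult power_divide algebra_simps)
    qed
  qed
  then show ?thesis
    using integral_osc_by_parts2[OF cb(1) ib(1) cb(2) ib(2) cb(3) ib(3) db db1]
    by (simp add: b_def[symmetric])
qed

end

section \<open>The two families of cutoffs\<close>

lemma poly_gauss_bound:
  fixes c r :: real
  assumes "c > 0"
  shows "(1 + \<bar>r\<bar>) ^ n * exp (- c * r\<^sup>2) \<le> fact n * exp (1 + 1 / c) * exp (- \<bar>r\<bar>)"
proof -
  have "(1 + \<bar>r\<bar>) ^ n \<le> fact n * exp (1 + \<bar>r\<bar>)"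
    by (intro power_le_fact_exp) simp
  then have "(1 + \<bar>r\<bar>) ^ n * exp (- c * r\<^sup>2) \<le> fact n * exp (1 + \<bar>r\<bar>) * exp (- c * r\<^sup>2)"
    by (intro mult_right_mono) auto
  also have "\<dots> = fact n * exp (1 + \<bar>r\<bar> - c * r\<^sup>2)"
    by (simp add: mult.assoc flip: exp_add)
  also have "\<dots> \<le> fact n * exp (1 + 1 / c - \<bar>r\<bar>)"
  proof -
    have "0 \<le> (c * \<bar>r\<bar> - 1)\<^sup>2" by simp
    also have "\<dots> = c * (c * r\<^sup>2 - 2 * \<bar>r\<bar> + 1 / c)"
      using assms by (simp add: power2_eq_square algebra_simps abs_mult_self_eq)
    finally have "0 \<le> c * r\<^sup>2 - 2 * \<bar>r\<bar> + 1 / c"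
      using assms by (simp add: zero_le_mult_iff)
    then show ?thesis by simp
  qed
  also have "\<dots> = fact n * exp (1 + 1 / c) * exp (- \<bar>r\<bar>)"
    by (simp add: mult.assoc flip: exp_add)
  finally show ?thesis .
qed

text \<open>On an open set of zeros the derivative vanishes by uniqueness, and the direction
  \<open>(1, 0)\<close> picks out the \<xi>-derivative. Hence all \<xi>-derivatives of a test
  function are supported in its compact support.\<close>

lemma smooth_vanishing_derivatives:
  assumes D: "\<And>i j p. (D i j has_derivative
      (\<lambda>h. fst h *\<^sub>R D (Suc i) j p + snd h *\<^sub>R D i (Suc j) p)) (at p)"
    and S: "open S" "\<And>p. p \<in> S \<Longrightarrow> D 0 0 p = (0 :: complex)" and p: "p \<in> (S :: (real \<times> real) set)"
  shows "D i 0 p = 0"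
  using p
proof (induction i arbitrary: p)
  case (Suc i)
  have "(D i 0 has_derivative (\<lambda>h. 0)) (at p)"
    by (rule has_derivative_transform_within_open[OF has_derivative_const[of 0] S(1) Suc.prems]) (simp add: Suc.IH)
  with D[of i 0 p] have "(\<lambda>h. fst h *\<^sub>R D (Suc i) 0 p + snd h *\<^sub>R D i (Suc 0) p) = (\<lambda>h. 0)"
    by (rule has_derivative_unique)
  from fun_cong[OF this, of "(1, 0)"] show ?case by simp
qed (use S in auto)

lemma integrable_continuous_compact_support:
  fixes f :: "'a::euclidean_space \<Rightarrow> 'b::{banach, second_countable_topology}"
  assumes "continuous_on UNIV f" "compact K" "\<And>p. p \<notin> K \<Longrightarrow> f p = 0"
  shows "integrable lborel f"
proof -
  have "integrable lborel (\<lambda>p. indicator K p *\<^sub>R f p)"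
    by (rule borel_integrable_compact[OF assms(2) continuous_on_subset[OF assms(1)]]) simp
  also have "(\<lambda>p. indicator K p *\<^sub>R f p) = f"
    using assms(3) by (auto simp: fun_eq_iff split: split_indicator)
  finally show ?thesis .
qed

context airy_phase
begin

text \<open>Each \<xi>-derivative of \<open>\<psi> (\<epsilon> *\<^sub>R p)\<close> brings out a
  factor \<epsilon>, so derivatives tend to 0 while all suprema stay bounded.\<close>

lemma test_function_cutoff_tendsto:
  assumes \<psi>: "test_function \<psi>" "\<psi> 0 = 1"
  shows "((\<lambda>\<epsilon>. LINT p|lborel. \<psi> (\<epsilon> *\<^sub>R p) * (\<alpha> + \<beta> * of_real (fst p)) * osc p) \<longlongrightarrow> osc_limit \<alpha> \<beta>) (at_right 0)"
proof -
  obtain D where D0: "D 0 0 = \<psi>" and D: "\<And>i j p. (D i j has_derivative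
      (\<lambda>h. fst h *\<^sub>R D (Suc i) j p + snd h *\<^sub>R D i (Suc j) p)) (at p)"
    using \<psi> unfolding test_function_def smooth_on_plane_def by blast
  define K where "K = closure {p. \<psi> p \<noteq> 0}"
  have K: "compact K" using \<psi> by (simp add: test_function_def K_def)
  have cont: "continuous_on A (D i j)" for i j A
    by (intro continuous_at_imp_continuous_on ballI has_derivative_continuous[OF D])
  have zero: "D i 0 p = 0" if "p \<notin> K" for i p
  proof (rule smooth_vanishing_derivatives[where D = D and S = "- K", OF D])
    show "open (- K)" by (intro open_Compl compact_imp_closed K)
    show "D 0 0 q = 0" if "q \<in> - K" for q
      using that closure_subset[of "{p. \<psi> p \<noteq> 0}"] by (auto simp: D0 K_def)
  qed (use that in auto)
  have "\<exists>C. \<forall>p. norm (D i 0 p) \<le> C" for i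
  proof -
    have "bounded (D i 0 ` K)"
      by (intro compact_imp_bounded compact_continuous_image cont K)
    then obtain C where C: "\<And>p. p \<in> K \<Longrightarrow> norm (D i 0 p) \<le> C"
      by (auto simp: bounded_iff)
    have "norm (D i 0 p) \<le> max C 0" for p
      using C[of p] zero[of p i] by (cases "p \<in> K") auto
    then show ?thesis by blast
  qed
  then obtain C where C: "\<And>i p. norm (D i 0 p) \<le> C i" by metis
  have deriv: "has_fst_derivative (\<lambda>p. D i 0 (\<epsilon> *\<^sub>R p)) (\<lambda>p. \<epsilon> *\<^sub>R D (Suc i) 0 (\<epsilon> *\<^sub>R p))" for i \<epsilon>
    unfolding has_fst_derivative_def
  proof (intro allI)
    fix \<xi> \<eta> :: real
    have "((\<lambda>s. D i 0 (\<epsilon> *\<^sub>R (s, \<eta>))) has_derivative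
        (\<lambda>h. fst (\<epsilon> * h, 0::real) *\<^sub>R D (Suc i) 0 (\<epsilon> *\<^sub>R (\<xi>, \<eta>)) + snd (\<epsilon> * h, 0::real) *\<^sub>R D i (Suc 0) (\<epsilon> *\<^sub>R (\<xi>, \<eta>)))) (at \<xi>)"
      by (rule has_derivative_compose[OF _ D]) (auto intro!: derivative_eq_intros)
    then show "((\<lambda>s. D i 0 (\<epsilon> *\<^sub>R (s, \<eta>))) has_vector_derivative \<epsilon> *\<^sub>R D (Suc i) 0 (\<epsilon> *\<^sub>R (\<xi>, \<eta>))) (at \<xi>)"
      by (simp add: has_vector_derivative_def mult.commute)
  qed
  have scale: "has_fst_derivative (\<lambda>p. c *\<^sub>R f p) (\<lambda>p. c *\<^sub>R f' p)" if "has_fst_derivative f f'" for c f f'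
    using that unfolding has_fst_derivative_def
    by (auto intro!: bounded_linear.has_vector_derivative[OF bounded_linear_scaleR_right])
  show ?thesis
    unfolding tendsto_at_iff_sequentially
  proof (intro allI impI)
    fix X :: "nat \<Rightarrow> real"
    assume X: "\<forall>i. X i \<in> {0<..} - {0}" and X0: "X \<longlonglongrightarrow> 0"
    from convergent_imp_Bseq[OF convergentI[OF X0]] obtain B where B: "\<And>n. \<bar>X n\<bar> \<le> B"
      by (auto simp: Bseq_def)
    have B0: "0 \<le> B" using B[of 0] by linarith
    have Xpos: "X n > 0" for n using X by auto
    have "(\<lambda>n. LINT p|lborel. (\<alpha> + \<beta> * of_real (fst p)) * D 0 0 (X n *\<^sub>R p) * osc p) \<longlonglongrightarrow> osc_limit \<alpha> \<beta>"
    proof (rule cutoff_integral_tendsto[where g = "\<lambda>n p. D 0 0 (X n *\<^sub>R p)" and \<alpha> = "\<lambda>n. \<alpha>"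
          and ?g1.0 = "\<lambda>n p. X n *\<^sub>R D 1 0 (X n *\<^sub>R p)" and ?g2.0 = "\<lambda>n p. X n *\<^sub>R X n *\<^sub>R D 2 0 (X n *\<^sub>R p)"
          and C = "C 0 + B * C 1 + B * (B * C 2)"])
      show "has_fst_derivative (\<lambda>p. D 0 0 (X n *\<^sub>R p)) (\<lambda>p. X n *\<^sub>R D 1 0 (X n *\<^sub>R p))"
        "has_fst_derivative (\<lambda>p. X n *\<^sub>R D 1 0 (X n *\<^sub>R p)) (\<lambda>p. X n *\<^sub>R X n *\<^sub>R D 2 0 (X n *\<^sub>R p))" for n
        using deriv[of 0 "X n"] scale[OF deriv[of 1 "X n"]] by (simp_all add: numeral_2_eq_2)
      have c: "continuous_on UNIV (\<lambda>p. D i 0 (X n *\<^sub>R p))" for i n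
        by (intro continuous_on_compose2[OF cont[of UNIV]] continuous_intros) auto
      show "continuous_on UNIV (\<lambda>p. D 0 0 (X n *\<^sub>R p))" "continuous_on UNIV (\<lambda>p. X n *\<^sub>R D 1 0 (X n *\<^sub>R p))"
        "continuous_on UNIV (\<lambda>p. X n *\<^sub>R X n *\<^sub>R D 2 0 (X n *\<^sub>R p))" for n
        by (intro continuous_intros c)+
      have i: "integrable lborel (\<lambda>p. (1 + \<bar>fst p\<bar>) *\<^sub>R c *\<^sub>R D i 0 (X n *\<^sub>R p))" for i n c
      proof (rule integrable_continuous_compact_support)
        show "continuous_on UNIV (\<lambda>p. (1 + \<bar>fst p\<bar>) *\<^sub>R c *\<^sub>R D i 0 (X n *\<^sub>R p))"
          using c by (intro continuous_intros)
        show "compact ((*\<^sub>R) (1 / X n) ` K)"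
          by (intro compact_scaling K)
        show "(1 + \<bar>fst p\<bar>) *\<^sub>R c *\<^sub>R D i 0 (X n *\<^sub>R p) = 0" if "p \<notin> (*\<^sub>R) (1 / X n) ` K" for p
        proof -
          have "X n *\<^sub>R p \<notin> K"
          proof
            assume "X n *\<^sub>R p \<in> K"
            moreover have "p = (1 / X n) *\<^sub>R (X n *\<^sub>R p)" using Xpos[of n] by simp
            ultimately show False using that by blast
          qed
          then show ?thesis by (simp add: zero)
        qed
      qed
      show "integrable lborel (\<lambda>p. (1 + \<bar>fst p\<bar>) *\<^sub>R D 0 0 (X n *\<^sub>R p))"
        "integrable lborel (\<lambda>p. (1 + \<bar>fst p\<bar>) *\<^sub>R X n *\<^sub>R D 1 0 (X n *\<^sub>R p))"
        "integrable lborel (\<lambda>p. (1 + \<bar>fst p\<bar>) *\<^sub>R X n *\<^sub>R X n *\<^sub>R D 2 0 (X n *\<^sub>R p))" for n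
        using i[of 1 0 n] i[of "X n" 1 n] i[of "X n * X n" 2 n] by simp_all
      have Cpos: "0 \<le> C i" for i using C[of i 0] norm_ge_zero order_trans by blast
      have 1: "norm (X n *\<^sub>R D 1 0 (X n *\<^sub>R p)) \<le> B * C 1" for n p
        unfolding norm_scaleR using B B0 by (intro mult_mono C) auto
      have 2: "norm (X n *\<^sub>R X n *\<^sub>R D 2 0 (X n *\<^sub>R p)) \<le> B * (B * C 2)" for n p
        unfolding norm_scaleR using B B0 Cpos by (intro mult_mono C) auto
      have pos: "0 \<le> B * C 1" "0 \<le> B * (B * C 2)" using B0 Cpos by auto
      show "norm (D 0 0 (X n *\<^sub>R p)) \<le> C 0 + B * C 1 + B * (B * C 2)"
        "norm (X n *\<^sub>R D 1 0 (X n *\<^sub>R p)) \<le> C 0 + B * C 1 + B * (B * C 2)"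
        "norm (X n *\<^sub>R X n *\<^sub>R D 2 0 (X n *\<^sub>R p)) \<le> C 0 + B * C 1 + B * (B * C 2)" for n p
        using C[of 0 "X n *\<^sub>R p"] 1[of n p] 2[of n p] pos Cpos[of 0] by linarith+
      have lim: "(\<lambda>n. D i 0 (X n *\<^sub>R p)) \<longlonglongrightarrow> D i 0 (0 *\<^sub>R p)" for i p
        by (rule continuous_on_tendsto_compose[OF cont[of UNIV] tendsto_scaleR[OF X0 tendsto_const]]) auto
      from lim[of 0] show "(\<lambda>n. D 0 0 (X n *\<^sub>R p)) \<longlonglongrightarrow> 1" for p
        by (simp add: D0 \<psi>)
      have "(\<lambda>n. X n *\<^sub>R D 1 0 (X n *\<^sub>R p)) \<longlonglongrightarrow> 0 *\<^sub>R D 1 0 (0 *\<^sub>R p)"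
        "(\<lambda>n. X n *\<^sub>R X n *\<^sub>R D 2 0 (X n *\<^sub>R p)) \<longlonglongrightarrow> 0 *\<^sub>R 0 *\<^sub>R D 2 0 (0 *\<^sub>R p)" for p
        by (intro tendsto_intros X0 lim)+
      then show "(\<lambda>n. X n *\<^sub>R D 1 0 (X n *\<^sub>R p)) \<longlonglongrightarrow> 0" "(\<lambda>n. X n *\<^sub>R X n *\<^sub>R D 2 0 (X n *\<^sub>R p)) \<longlonglongrightarrow> 0" for p
        by simp_all
    qed auto
    then show "((\<lambda>\<epsilon>. LINT p|lborel. \<psi> (\<epsilon> *\<^sub>R p) * (\<alpha> + \<beta> * of_real (fst p)) * osc p) \<circ> X) \<longlonglongrightarrow> osc_limit \<alpha> \<beta>"
      by (simp add: D0 o_def mult.commute[of "\<psi> _"])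
  qed
qed

text \<open>The Gaussian-like cutoff that the contour shift \<open>\<xi> \<mapsto> \<xi> + \<i> \<delta>\<close> produces in the integrand.\<close>

definition shift_cutoff :: "real \<Rightarrow> real \<times> real \<Rightarrow> complex" where
  "shift_cutoff \<delta> p = exp (of_real (t * \<delta> ^ 3 - x * \<delta> - \<delta> * t * (3 * (fst p)\<^sup>2 + (snd p)\<^sup>2))
     - 3 * \<i> * of_real (t * \<delta>\<^sup>2 * fst p))"

lemma shift_cutoff_osc:
  "shift_cutoff \<delta> (\<xi>, \<eta>) * osc (\<xi>, \<eta>) =
     (let z = complex_of_real \<xi> + \<i> * of_real \<delta> in
       exp (\<i> * (of_real t * z ^ 3 + of_real t * z * of_real \<eta> ^ 2 + of_real x * z + of_real (y * \<eta>))))"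
  unfolding shift_cutoff_def exp_add[symmetric] Let_def
  by (rule arg_cong[of _ _ exp]) (simp add: phase_def complex_eq_iff power3_eq_cube power2_eq_square algebra_simps)

lemma continuous_on_shift_cutoff: "continuous_on A (shift_cutoff \<delta>)"
  unfolding shift_cutoff_def by (intro continuous_intros)

lemma norm_shift_cutoff:
  "norm (shift_cutoff \<delta> p) = exp (t * \<delta> ^ 3 - x * \<delta>) * exp (- (3 * \<delta> * t) * (fst p)\<^sup>2) * exp (- (\<delta> * t) * (snd p)\<^sup>2)"
  by (simp add: shift_cutoff_def flip: exp_add) (simp add: algebra_simps)

lemma integrable_growth_shift_cutoff:
  assumes "\<delta> > 0" and h: "continuous_on UNIV h" and bound: "\<And>p. norm (h p) \<le> C * (1 + \<bar>fst p\<bar>) ^ n"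
  shows "integrable lborel (\<lambda>p. h p * shift_cutoff \<delta> p)"
proof (rule Bochner_Integration.integrable_bound)
  define E where "E = C * exp (t * \<delta> ^ 3 - x * \<delta>)"
  define M where "M = fact n * exp (1 + 1 / (3 * \<delta> * t)) * exp (1 + 1 / (\<delta> * t))"
  show "integrable lborel (\<lambda>p::real \<times> real. E * M * (case p of (\<xi>, \<eta>) \<Rightarrow> exp (- \<bar>\<xi>\<bar>) * exp (- \<bar>\<eta>\<bar>)))"
    by (intro integrable_mult_right integrable_lborel_product integrable_exp_minus_abs)
  have "continuous_on UNIV (\<lambda>p. h p * shift_cutoff \<delta> p)"
    by (intro continuous_intros h continuous_on_shift_cutoff)
  then show "(\<lambda>p. h p * shift_cutoff \<delta> p) \<in> borel_measurable lborel"
    by (simp add: borel_measurable_continuous_onI)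
  have C: "0 \<le> C"
    using order_trans[OF norm_ge_zero bound[of 0]] by simp
  have "norm (h (\<xi>, \<eta>) * shift_cutoff \<delta> (\<xi>, \<eta>)) \<le> E * M * (exp (- \<bar>\<xi>\<bar>) * exp (- \<bar>\<eta>\<bar>))" for \<xi> \<eta>
  proof -
    have pos: "3 * \<delta> * t > 0" "\<delta> * t > 0" using assms t by auto
    have "norm (h (\<xi>, \<eta>) * shift_cutoff \<delta> (\<xi>, \<eta>)) \<le> C * (1 + \<bar>\<xi>\<bar>) ^ n * norm (shift_cutoff \<delta> (\<xi>, \<eta>))"
      unfolding norm_mult using bound[of "(\<xi>, \<eta>)"] by (intro mult_right_mono) auto
    also have "\<dots> = E * (((1 + \<bar>\<xi>\<bar>) ^ n * exp (- (3 * \<delta> * t) * \<xi>\<^sup>2)) * ((1 + \<bar>\<eta>\<bar>) ^ 0 * exp (- (\<delta> * t) * \<eta>\<^sup>2)))"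
      unfolding norm_shift_cutoff E_def by (simp only: fst_conv snd_conv power_0 mult_1_left mult_ac)
    also have "\<dots> \<le> E * ((fact n * exp (1 + 1 / (3 * \<delta> * t)) * exp (- \<bar>\<xi>\<bar>)) * (fact 0 * exp (1 + 1 / (\<delta> * t)) * exp (- \<bar>\<eta>\<bar>)))"
      using C pos by (intro mult_left_mono mult_mono poly_gauss_bound) (auto simp: E_def)
    also have "\<dots> = E * M * (exp (- \<bar>\<xi>\<bar>) * exp (- \<bar>\<eta>\<bar>))"
      unfolding M_def by (simp only: fact_0 mult_1_left mult_ac)
    finally show ?thesis .
  qed
  then show "AE p in lborel. norm (h p * shift_cutoff \<delta> p) \<le> norm (E * M * (case p of (\<xi>, \<eta>) \<Rightarrow> exp (- \<bar>\<xi>\<bar>) * exp (- \<bar>\<eta>\<bar>)))"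
    by (intro AE_I2) (auto simp: split_beta intro: order_trans[OF _ abs_ge_self])
qed

text \<open>Derivatives of this Gaussian grow polynomially, but every factor \<xi> comes with
  \<delta>, while the width is of order \<delta>^(-1/2). So they are bounded uniformly in the
  shift.\<close>

lemma shift_cutoff_tendsto:
  fixes \<delta> :: "nat \<Rightarrow> real"
  assumes \<delta>: "\<And>n. 0 < \<delta> n" "\<And>n. \<delta> n \<le> 1" "\<delta> \<longlonglongrightarrow> 0" and \<alpha>: "\<alpha> \<longlonglongrightarrow> \<alpha>'"
  shows "(\<lambda>n. LINT p|lborel. (\<alpha> n + \<beta> * of_real (fst p)) * shift_cutoff (\<delta> n) p * osc p) \<longlonglongrightarrow> osc_limit \<alpha>' \<beta>"
proof -
  \<comment> \<open>\<open>q\<close> is the logarithmic \<xi>-derivative of the cutoff, and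
    \<open>r\<close> = q^2 + q' the factor in its second derivative.\<close>
  define q where "q d p = of_real (- 6 * d * t * fst p) - 3 * \<i> * of_real (t * d\<^sup>2)" for d and p :: "real \<times> real"
  define r where "r d p = q d p * q d p + of_real (- 6 * d * t)" for d and p :: "real \<times> real"
  have dq: "has_fst_derivative (q d) (\<lambda>p. of_real (- 6 * d * t))" for d
    by (rule has_fst_derivative_complexI[where F = "\<lambda>\<eta> z. of_real (- 6 * d * t) * z - 3 * \<i> * of_real (t * d\<^sup>2)"])
      (auto intro!: derivative_eq_intros simp: q_def)
  have dg: "has_fst_derivative (shift_cutoff d) (\<lambda>p. q d p * shift_cutoff d p)" for d
    by (rule has_fst_derivative_complexI[where F = "\<lambda>\<eta> z. exp (of_real (t * d ^ 3 - x * d) - of_real (d * t) * (3 * z ^ 2 + of_real \<eta> ^ 2) - 3 * \<i> * of_real (t * d\<^sup>2) * z)"])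
      (auto intro!: derivative_eq_intros simp: q_def shift_cutoff_def algebra_simps)
  have dg1: "has_fst_derivative (\<lambda>p. q d p * shift_cutoff d p) (\<lambda>p. r d p * shift_cutoff d p)" for d
    using has_fst_derivative_mult[OF dq[of d] dg[of d]] by (simp add: r_def algebra_simps)
  have cq: "continuous_on A (q d)" "continuous_on A (r d)" for A d
    unfolding r_def q_def by (intro continuous_intros)+
  have nq: "norm (q d p) \<le> 6 * d * t * \<bar>fst p\<bar> + 3 * t * d\<^sup>2" if "d > 0" for d p
    unfolding q_def using t that
    by (intro norm_triangle_le_diff) (simp add: norm_mult abs_mult norm_power)
  \<comment> \<open>The first two bounds give integrability for a fixed shift; the last two, in
    terms of d \<xi>^2, give bounds uniform in the shift.\<close>
  have growth: "norm (q d p) \<le> 9 * t * (1 + \<bar>fst p\<bar>)"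
    "norm (r d p) \<le> (81 * t\<^sup>2 + 6 * t) * (1 + \<bar>fst p\<bar>) ^ 2"
    "norm (q d p) \<le> 1 + 72 * t\<^sup>2 * d * (fst p)\<^sup>2 + 18 * t\<^sup>2 + 6 * t"
    "norm (r d p) \<le> 1 + 72 * t\<^sup>2 * d * (fst p)\<^sup>2 + 18 * t\<^sup>2 + 6 * t" if d: "0 < d" "d \<le> 1" for d p
  proof -
    have d2: "d\<^sup>2 \<le> d" "d\<^sup>2 \<le> 1" using d by (auto simp: power2_eq_square mult_le_one intro: mult_left_le)
    have "d * (6 * t * \<bar>fst p\<bar>) \<le> 1 * (6 * t * \<bar>fst p\<bar>)"
      using d t by (intro mult_right_mono) auto
    then have "6 * d * t * \<bar>fst p\<bar> \<le> 6 * (t * \<bar>fst p\<bar>)"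
      by (simp add: mult_ac)
    moreover have "3 * t * d\<^sup>2 \<le> 3 * t * 1"
      using d2 t by (intro mult_left_mono) auto
    moreover have "0 \<le> t * \<bar>fst p\<bar>" using t by simp
    moreover have "9 * t * (1 + \<bar>fst p\<bar>) = 9 * t + 9 * (t * \<bar>fst p\<bar>)"
      by (simp add: algebra_simps)
    ultimately show q1: "norm (q d p) \<le> 9 * t * (1 + \<bar>fst p\<bar>)"
      using nq[OF d(1), of p] t by linarith
    have r0: "norm (r d p) \<le> norm (q d p) ^ 2 + 6 * t"
    proof -
      have "norm (r d p) \<le> norm (q d p) ^ 2 + 6 * d * t"
        unfolding r_def using d t by (intro norm_triangle_le) (simp add: norm_mult abs_mult power2_eq_square)
      also have "6 * d * t \<le> 6 * 1 * t"
        using d t by (intro mult_right_mono) auto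
      finally show ?thesis by simp
    qed
    have "norm (q d p) ^ 2 \<le> (9 * t * (1 + \<bar>fst p\<bar>)) ^ 2"
      by (intro power_mono q1) auto
    moreover have "6 * t * 1 \<le> 6 * t * (1 + \<bar>fst p\<bar>) ^ 2"
      using t by (intro mult_left_mono one_le_power) auto
    ultimately show "norm (r d p) \<le> (81 * t\<^sup>2 + 6 * t) * (1 + \<bar>fst p\<bar>) ^ 2"
      using r0 by (simp add: power_mult_distrib distrib_right)
    have "norm (q d p) ^ 2 \<le> (6 * d * t * \<bar>fst p\<bar> + 3 * t * d\<^sup>2) ^ 2"
      by (intro power_mono nq d) auto
    also have "\<dots> \<le> 2 * (6 * d * t * \<bar>fst p\<bar>)\<^sup>2 + 2 * (3 * t * d\<^sup>2)\<^sup>2"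
      using sum_squares_bound[of "6 * d * t * \<bar>fst p\<bar>" "3 * t * d\<^sup>2"] by (simp add: power2_sum)
    also have "\<dots> = 72 * t\<^sup>2 * d\<^sup>2 * (fst p)\<^sup>2 + 18 * t\<^sup>2 * (d\<^sup>2)\<^sup>2"
      by (simp add: power_mult_distrib)
    also have "\<dots> \<le> 72 * t\<^sup>2 * d * (fst p)\<^sup>2 + 18 * t\<^sup>2 * 1"
      using d d2 by (intro add_mono mult_mono mult_left_mono power_le_one) auto
    finally have q2: "norm (q d p) ^ 2 \<le> 72 * t\<^sup>2 * d * (fst p)\<^sup>2 + 18 * t\<^sup>2"
      by simp
    have "norm (q d p) \<le> 1 + norm (q d p) ^ 2"
    proof -
      have "0 \<le> (norm (q d p) - 1)\<^sup>2" by simp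
      also have "(norm (q d p) - 1)\<^sup>2 = norm (q d p) ^ 2 - 2 * norm (q d p) + 1"
        by (simp add: power2_eq_square algebra_simps)
      finally show ?thesis using norm_ge_zero[of "q d p"] by linarith
    qed
    with q2 t show "norm (q d p) \<le> 1 + 72 * t\<^sup>2 * d * (fst p)\<^sup>2 + 18 * t\<^sup>2 + 6 * t"
      by linarith
    show "norm (r d p) \<le> 1 + 72 * t\<^sup>2 * d * (fst p)\<^sup>2 + 18 * t\<^sup>2 + 6 * t"
      using r0 q2 by linarith
  qed
  define C where "C = exp (t + \<bar>x\<bar>) * (1 + 24 * t + 18 * t\<^sup>2 + 6 * t)"
  have bound: "norm (v * shift_cutoff d p) \<le> C"
    if d: "0 < d" "d \<le> 1" and v: "norm v \<le> 1 + 72 * t\<^sup>2 * d * (fst p)\<^sup>2 + 18 * t\<^sup>2 + 6 * t" for v d p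
  proof -
    \<comment> \<open>\<open>z\<close> is the exponent of the Gaussian in \<xi>, and 72 t^2 d
      \<xi>^2 = 24 t z; the product of \<open>z\<close> and \<open>exp (- z)\<close> is at most
      1.\<close>
    define z where "z = 3 * d * t * (fst p)\<^sup>2"
    have z: "z \<ge> 0" using d t by (simp add: z_def)
    have "t * d ^ 3 - x * d \<le> t + \<bar>x\<bar>"
    proof -
      have "t * d ^ 3 \<le> t * 1" using d t by (intro mult_left_mono power_le_one) auto
      moreover have "\<bar>x\<bar> * d \<le> \<bar>x\<bar> * 1" using d by (intro mult_left_mono) auto
      moreover have "- (x * d) \<le> \<bar>x\<bar> * d" using d mult_right_mono[of "- x" "\<bar>x\<bar>" d] by simp
      ultimately show ?thesis by linarith
    qed
    then have e1: "exp (t * d ^ 3 - x * d) \<le> exp (t + \<bar>x\<bar>)" by simp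
    have e2: "exp (- (d * t) * (snd p)\<^sup>2) \<le> 1" using d t by simp
    have s: "norm (shift_cutoff d p) \<le> exp (t + \<bar>x\<bar>) * exp (- z)"
    proof -
      have "norm (shift_cutoff d p) \<le> exp (t + \<bar>x\<bar>) * exp (- z) * 1"
        unfolding norm_shift_cutoff z_def using e1 e2 by (intro mult_mono) auto
      then show ?thesis by simp
    qed
    have "z \<le> exp z"
      using exp_ge_add_one_self[of z] by linarith
    then have ze: "z * exp (- z) \<le> 1" "exp (- z) \<le> 1"
      using z by (auto simp: exp_minus field_simps)
    have "norm (v * shift_cutoff d p) \<le> (1 + 24 * t * z + 18 * t\<^sup>2 + 6 * t) * (exp (t + \<bar>x\<bar>) * exp (- z))"
    proof -
      have "norm v \<le> 1 + 24 * t * z + 18 * t\<^sup>2 + 6 * t"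
        using v by (simp add: z_def power2_eq_square mult_ac)
      moreover have "0 \<le> 1 + 24 * t * z + 18 * t\<^sup>2 + 6 * t"
        using z t by simp
      ultimately show ?thesis
        unfolding norm_mult using s by (intro mult_mono) auto
    qed
    also have "\<dots> = exp (t + \<bar>x\<bar>) * (24 * t * (z * exp (- z)) + (1 + 18 * t\<^sup>2 + 6 * t) * exp (- z))"
      by (simp add: algebra_simps)
    also have "\<dots> \<le> exp (t + \<bar>x\<bar>) * (24 * t * 1 + (1 + 18 * t\<^sup>2 + 6 * t) * 1)"
      using ze t by (intro mult_left_mono add_mono) auto
    finally show ?thesis by (simp add: C_def algebra_simps)
  qed
  show ?thesis
  proof (rule cutoff_integral_tendsto[where ?g1.0 = "\<lambda>n p. q (\<delta> n) p * shift_cutoff (\<delta> n) p"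
        and ?g2.0 = "\<lambda>n p. r (\<delta> n) p * shift_cutoff (\<delta> n) p" and C = C, OF _ _ _ _ _ _ _ _ _ _ _ _ _ _ \<alpha>])
    fix n
    have d: "0 < \<delta> n" "\<delta> n \<le> 1" using \<delta> by auto
    show "has_fst_derivative (shift_cutoff (\<delta> n)) (\<lambda>p. q (\<delta> n) p * shift_cutoff (\<delta> n) p)"
      "has_fst_derivative (\<lambda>p. q (\<delta> n) p * shift_cutoff (\<delta> n) p) (\<lambda>p. r (\<delta> n) p * shift_cutoff (\<delta> n) p)"
      by (rule dg dg1)+
    show "continuous_on UNIV (shift_cutoff (\<delta> n))" "continuous_on UNIV (\<lambda>p. q (\<delta> n) p * shift_cutoff (\<delta> n) p)"
      "continuous_on UNIV (\<lambda>p. r (\<delta> n) p * shift_cutoff (\<delta> n) p)"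
      by (intro continuous_on_mult continuous_on_shift_cutoff cq)+
    have i: "integrable lborel (\<lambda>p. (1 + \<bar>fst p\<bar>) *\<^sub>R (h p * shift_cutoff (\<delta> n) p))"
      if h: "continuous_on UNIV h" "\<And>p. norm (h p) \<le> K * (1 + \<bar>fst p\<bar>) ^ m" for h K m
    proof -
      have "integrable lborel (\<lambda>p. ((1 + \<bar>fst p\<bar>) *\<^sub>R h p) * shift_cutoff (\<delta> n) p)"
      proof (rule integrable_growth_shift_cutoff[OF d(1), where C = K and n = "Suc m"])
        show "continuous_on UNIV (\<lambda>p. (1 + \<bar>fst p\<bar>) *\<^sub>R h p)" by (intro continuous_intros h)
        show "norm ((1 + \<bar>fst p\<bar>) *\<^sub>R h p) \<le> K * (1 + \<bar>fst p\<bar>) ^ Suc m" for p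
          using mult_left_mono[OF h(2)[of p], of "1 + \<bar>fst p\<bar>"] by (simp add: mult_ac)
      qed
      then show ?thesis by simp
    qed
    show "integrable lborel (\<lambda>p. (1 + \<bar>fst p\<bar>) *\<^sub>R shift_cutoff (\<delta> n) p)"
      using i[of "\<lambda>p. 1" 1 0] by simp
    show "integrable lborel (\<lambda>p. (1 + \<bar>fst p\<bar>) *\<^sub>R (q (\<delta> n) p * shift_cutoff (\<delta> n) p))"
      using growth(1)[OF d] by (intro i[where K = "9 * t" and m = 1] cq) simp
    show "integrable lborel (\<lambda>p. (1 + \<bar>fst p\<bar>) *\<^sub>R (r (\<delta> n) p * shift_cutoff (\<delta> n) p))"
      using growth(2)[OF d] by (intro i[where K = "81 * t\<^sup>2 + 6 * t" and m = 2] cq) simp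
    fix p
    show "norm (q (\<delta> n) p * shift_cutoff (\<delta> n) p) \<le> C" "norm (r (\<delta> n) p * shift_cutoff (\<delta> n) p) \<le> C"
      by (intro bound growth d)+
    have "0 \<le> 72 * t\<^sup>2 * \<delta> n * (fst p)\<^sup>2 + 18 * t\<^sup>2 + 6 * t" using d t by simp
    then have "norm (1 * shift_cutoff (\<delta> n) p) \<le> C"
      by (intro bound d) (simp add: add.assoc)
    then show "norm (shift_cutoff (\<delta> n) p) \<le> C" by simp
  next
    fix p
    have s: "(\<lambda>n. shift_cutoff (\<delta> n) p) \<longlonglongrightarrow> exp (of_real (t * 0 ^ 3 - x * 0 - 0 * t * (3 * (fst p)\<^sup>2 + (snd p)\<^sup>2))
       - 3 * \<i> * of_real (t * 0\<^sup>2 * fst p))"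
      unfolding shift_cutoff_def by (intro tendsto_intros \<delta>(3))
    then show "(\<lambda>n. shift_cutoff (\<delta> n) p) \<longlonglongrightarrow> 1" by simp
    have q: "(\<lambda>n. q (\<delta> n) p) \<longlonglongrightarrow> of_real (- 6 * 0 * t * fst p) - 3 * \<i> * of_real (t * 0\<^sup>2)"
      unfolding q_def by (intro tendsto_intros \<delta>(3))
    have r: "(\<lambda>n. r (\<delta> n) p) \<longlonglongrightarrow> (of_real (- 6 * 0 * t * fst p) - 3 * \<i> * of_real (t * 0\<^sup>2)) * (of_real (- 6 * 0 * t * fst p) - 3 * \<i> * of_real (t * 0\<^sup>2)) + of_real (- 6 * 0 * t)"
      unfolding r_def by (intro tendsto_intros \<delta>(3) q)
    show "(\<lambda>n. q (\<delta> n) p * shift_cutoff (\<delta> n) p) \<longlonglongrightarrow> 0" "(\<lambda>n. r (\<delta> n) p * shift_cutoff (\<delta> n) p) \<longlonglongrightarrow> 0"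
      using tendsto_mult[OF q s] tendsto_mult[OF r s] by simp_all
  qed
qed

end

section \<open>Factorization into Airy integrals\<close>

text \<open>The first shear puts \<eta> = c \<xi> - 2 c k b with \<xi> fixed, the second \<xi> = k b
  + k a with b fixed; together \<eta> = c (k a - k b), and the Jacobian is 2 c k times k.\<close>

lemma lborel_integral_rotation:
  fixes F :: "real \<times> real \<Rightarrow> 'b::{banach, second_countable_topology}"
  assumes F: "integrable lborel F" and k: "k > 0" and c: "c > 0"
  shows
    "(LINT p|lborel. F p) = (2 * c * k\<^sup>2) *\<^sub>R (LINT p|lborel. (\<lambda>(b, a). F (k * b + k * a, c * (k * a - k * b))) p)"
proof -
  define G where "G = (\<lambda>(\<xi>, b). F (\<xi>, c * \<xi> + (- 2 * c * k) * b))"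
  have nz: "- 2 * c * k \<noteq> 0" using k c by simp
  have G: "integrable lborel G" "(LINT p|lborel. F p) = (2 * c * k) *\<^sub>R (LINT p|lborel. G p)"
    unfolding G_def using lborel_integrable_shear[OF F nz] lborel_integral_shear[OF F nz, of c] k c by (simp_all add: abs_mult)
  define H where "H = (\<lambda>(b, \<xi>). G (\<xi>, b))"
  have "integrable (lborel \<Otimes>\<^sub>M lborel) G" using G(1) by (simp add: lborel_prod)
  from lborel_pair.integrable_product_swap[OF this] lborel_pair.integral_product_swap[OF borel_measurable_integrable[OF this]]
  have H: "integrable lborel H" "(LINT p|lborel. H p) = (LINT p|lborel. G p)"
    by (simp_all add: H_def lborel_prod)
  have "(LINT p|lborel. H p) = k *\<^sub>R (LINT p|lborel. (\<lambda>(b, a). H (b, k * b + k * a)) p)"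
    using lborel_integral_shear[OF H(1), of k k] k by simp
  also have "(\<lambda>(b, a). H (b, k * b + k * a)) = (\<lambda>(b, a). F (k * b + k * a, c * (k * a - k * b)))"
    by (auto simp: H_def G_def fun_eq_iff algebra_simps)
  finally show ?thesis
    using G(2) H(2) by (simp add: power2_eq_square mult_ac)
qed

context airy_phase
begin

definition \<kappa> :: real where "\<kappa> = (4 * t) powr (- 1 / 3)"

lemma \<kappa>_pos: "\<kappa> > 0"
  using t by (simp add: \<kappa>_def)

lemma \<kappa>_cube: "4 * t * \<kappa> ^ 3 = 1"
proof -
  have "\<kappa> ^ 3 = \<kappa> powr (real 3)"
    using \<kappa>_pos by (simp only: powr_realpow)
  also have "\<dots> = (4 * t) powr (- 1)"
    by (simp add: \<kappa>_def powr_powr)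
  also have "\<dots> = 1 / (4 * t)"
    using t by (simp add: powr_minus_divide)
  finally show ?thesis using t by simp
qed

text \<open>The identity \<open>(a + b)\<^sup>3 + 3 (a + b) (a - b)\<^sup>2 = 4 (a\<^sup>3 + b\<^sup>3)\<close> separates the phase in the
  coordinates \<open>\<xi> = \<kappa> (a + b)\<close>, \<open>\<eta> = \<surd>3 \<kappa> (a - b)\<close> and turns the shift of \<open>\<xi>\<close> into equal shifts
  of \<open>a\<close> and \<open>b\<close>.\<close>

lemma shift_cutoff_osc_factor:
  assumes s: "\<delta> = 2 * \<kappa> * s"
  shows "shift_cutoff \<delta> (\<kappa> * b + \<kappa> * a, sqrt 3 * (\<kappa> * a - \<kappa> * b)) * osc (\<kappa> * b + \<kappa> * a, sqrt 3 * (\<kappa> * a - \<kappa> * b))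
    = airy_integrand 0 s (\<kappa> * (x - sqrt 3 * y)) b * airy_integrand 0 s (\<kappa> * (x + sqrt 3 * y)) a"
proof -
  define A where "A = complex_of_real a + \<i> * of_real s"
  define B where "B = complex_of_real b + \<i> * of_real s"
  define k where "k = complex_of_real \<kappa>"
  define r where "r = complex_of_real (sqrt 3)"
  define X Y T where "X = complex_of_real x" and "Y = complex_of_real y" and "T = complex_of_real t"
  have r: "r\<^sup>2 = 3"
    unfolding r_def by (simp flip: of_real_power)
  have k: "4 * T * k ^ 3 = 1"
    unfolding k_def T_def using arg_cong[OF \<kappa>_cube, of complex_of_real] by simp
  have z: "complex_of_real (\<kappa> * b + \<kappa> * a) + \<i> * of_real \<delta> = k * (A + B)"
    by (simp add: A_def B_def k_def s algebra_simps)
  have e: "complex_of_real (sqrt 3 * (\<kappa> * a - \<kappa> * b)) = r * k * (A - B)"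
    by (simp add: A_def B_def k_def r_def algebra_simps)
  have "T * (k * (A + B)) ^ 3 + T * (k * (A + B)) * (r * k * (A - B)) ^ 2
      = T * k ^ 3 * ((A + B) ^ 3 + (A + B) * r\<^sup>2 * (A - B)\<^sup>2)"
    by (simp add: power_mult_distrib power2_eq_square power3_eq_cube algebra_simps)
  also have "\<dots> = 4 * T * k ^ 3 * (A ^ 3 + B ^ 3)"
    unfolding r by (simp add: power2_eq_square power3_eq_cube algebra_simps)
  finally have c: "T * (k * (A + B)) ^ 3 + T * (k * (A + B)) * (r * k * (A - B)) ^ 2 = A ^ 3 + B ^ 3"
    using k by simp
  have yr: "complex_of_real (y * (sqrt 3 * (\<kappa> * a - \<kappa> * b))) = Y * (r * k * (A - B))"
    by (simp only: of_real_mult[of y] e Y_def)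
  have "T * (k * (A + B)) ^ 3 + T * (k * (A + B)) * (r * k * (A - B)) ^ 2 + X * (k * (A + B)) + Y * (r * k * (A - B))
      = (B ^ 3 + k * (X - r * Y) * B) + (A ^ 3 + k * (X + r * Y) * A)"
    unfolding c by (simp add: algebra_simps)
  then show ?thesis
    unfolding shift_cutoff_osc Let_def z e yr
    by (simp add: airy_integrand_def A_def[symmetric] B_def[symmetric] X_def[symmetric] Y_def[symmetric]
        T_def[symmetric] k_def[symmetric] r_def[symmetric] distrib_left flip: exp_add)
qed

abbreviation airy_u :: real where "airy_u \<equiv> \<kappa> * (x + sqrt 3 * y)"
abbreviation airy_v :: real where "airy_v \<equiv> \<kappa> * (x - sqrt 3 * y)"

text \<open>Shifting \<xi> by \<delta> shifts both Airy variables by \<delta> / (2 \<kappa>), on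
  which their integrals do not depend; so no \<delta> is left on the right. The amplitude is \<i>
  (\<xi> + \<i> \<delta>), continued along with the phase.\<close>

lemma
  assumes \<delta>: "\<delta> > 0"
  shows integral_shift_cutoff: "(LINT p|lborel. shift_cutoff \<delta> p * osc p)
      = of_real (2 * sqrt 3 * \<kappa>\<^sup>2) * (airy_int 0 1 airy_v * airy_int 0 1 airy_u)" (is ?eq)
    and integral_shift_cutoff_amplitude:
      "(LINT p|lborel. (of_real (- \<delta>) + \<i> * of_real (fst p)) * shift_cutoff \<delta> p * osc p)
        = of_real (2 * sqrt 3 * \<kappa> ^ 3) * (airy_int 0 1 airy_v * airy_int 1 1 airy_u + airy_int 1 1 airy_v * airy_int 0 1 airy_u)" (is ?eqx)
proof -
  define s where "s = \<delta> / (2 * \<kappa>)"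
  have s: "s > 0" "\<delta> = 2 * \<kappa> * s" using \<delta> \<kappa>_pos by (auto simp: s_def)
  have shift: "airy_int 0 s u = airy_int 0 1 u" "airy_int 1 s u = airy_int 1 1 u" for u
    using airy_int_0_shift_independent[OF s(1)] airy_int_1_shift_independent[OF s(1)] by simp_all
  have int: "integrable lborel (\<lambda>p. h p * shift_cutoff \<delta> p * osc p)"
    if "continuous_on UNIV h" "\<And>p. norm (h p) \<le> C * (1 + \<bar>fst p\<bar>) ^ n" for h C n
    using integrable_mult_bounded_continuous[OF integrable_growth_shift_cutoff[OF \<delta> that] continuous_on_osc, of 1] by simp
  have i0: "integrable lborel (\<lambda>p. shift_cutoff \<delta> p * osc p)"
    using int[of "\<lambda>p. 1" 1 0] by simp
  have i1: "integrable lborel (\<lambda>p. (of_real (- \<delta>) + \<i> * of_real (fst p)) * shift_cutoff \<delta> p * osc p)"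
  proof (rule int[where C = "1 + \<delta>" and n = 1])
    fix p :: "real \<times> real"
    have "norm (complex_of_real (- \<delta>) + \<i> * of_real (fst p)) \<le> \<delta> + \<bar>fst p\<bar>"
      using \<delta> by (intro norm_triangle_le) (simp add: norm_mult)
    also have "\<dots> \<le> (1 + \<delta>) * (1 + \<bar>fst p\<bar>) ^ 1"
      using \<delta> by (simp add: algebra_simps)
    finally show "norm (complex_of_real (- \<delta>) + \<i> * of_real (fst p)) \<le> (1 + \<delta>) * (1 + \<bar>fst p\<bar>) ^ 1" .
  qed (intro continuous_intros)
  have sq: "sqrt 3 > 0" by simp
  note ai = integrable_airy_integrand[OF s(1)]
  have "(LINT p|lborel. shift_cutoff \<delta> p * osc p)
      = (2 * sqrt 3 * \<kappa>\<^sup>2) *\<^sub>R (LINT p|lborel. (\<lambda>(b, a). airy_integrand 0 s airy_v b * airy_integrand 0 s airy_u a) p)"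
    unfolding lborel_integral_rotation[OF i0 \<kappa>_pos sq] shift_cutoff_osc_factor[OF s(2)] ..
  also have "\<dots> = (2 * sqrt 3 * \<kappa>\<^sup>2) *\<^sub>R (airy_int 0 s airy_v * airy_int 0 s airy_u)"
    unfolding integral_lborel_product[OF ai ai] airy_int_def ..
  finally show ?eq
    by (simp add: shift scaleR_conv_of_real)
  have "(of_real (- \<delta>) + \<i> * of_real (fst (\<kappa> * b + \<kappa> * a, sqrt 3 * (\<kappa> * a - \<kappa> * b))))
      * shift_cutoff \<delta> (\<kappa> * b + \<kappa> * a, sqrt 3 * (\<kappa> * a - \<kappa> * b)) * osc (\<kappa> * b + \<kappa> * a, sqrt 3 * (\<kappa> * a - \<kappa> * b))
     = of_real \<kappa> * (airy_integrand 0 s airy_v b * airy_integrand 1 s airy_u a + airy_integrand 1 s airy_v b * airy_integrand 0 s airy_u a)" for a b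
  proof -
    have "complex_of_real (- \<delta>) + \<i> * of_real (\<kappa> * b + \<kappa> * a)
      = of_real \<kappa> * (\<i> * (of_real a + \<i> * of_real s) + \<i> * (of_real b + \<i> * of_real s))"
      by (simp add: s(2) algebra_simps)
    moreover have "airy_integrand 1 s w r = (\<i> * (of_real r + \<i> * of_real s)) * airy_integrand 0 s w r" for w r
      by (simp add: airy_integrand_def)
    ultimately show ?thesis
      unfolding mult.assoc[of _ "shift_cutoff _ _"] shift_cutoff_osc_factor[OF s(2)] fst_conv
      by (simp only:) (simp only: distrib_left distrib_right mult_ac add_ac)
  qed
  then have "(LINT p|lborel. (of_real (- \<delta>) + \<i> * of_real (fst p)) * shift_cutoff \<delta> p * osc p)
      = (2 * sqrt 3 * \<kappa>\<^sup>2) *\<^sub>R (LINT p|lborel. (\<lambda>(b, a). of_real \<kappa> *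
          (airy_integrand 0 s airy_v b * airy_integrand 1 s airy_u a + airy_integrand 1 s airy_v b * airy_integrand 0 s airy_u a)) p)"
    unfolding lborel_integral_rotation[OF i1 \<kappa>_pos sq] by (simp only:)
  also have "(LINT p|lborel. (\<lambda>(b, a). of_real \<kappa> *
          (airy_integrand 0 s airy_v b * airy_integrand 1 s airy_u a + airy_integrand 1 s airy_v b * airy_integrand 0 s airy_u a)) p)
      = of_real \<kappa> * ((LINT p|lborel. (\<lambda>(b, a). airy_integrand 0 s airy_v b * airy_integrand 1 s airy_u a) p)
         + (LINT p|lborel. (\<lambda>(b, a). airy_integrand 1 s airy_v b * airy_integrand 0 s airy_u a) p))"
    using Bochner_Integration.integral_add[OF integrable_lborel_product[OF ai ai, of 0 airy_v 1 airy_u]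
        integrable_lborel_product[OF ai ai, of 1 airy_v 0 airy_u]]
    by (simp add: case_prod_unfold)
  also have "\<dots> = of_real \<kappa> * (airy_int 0 s airy_v * airy_int 1 s airy_u + airy_int 1 s airy_v * airy_int 0 s airy_u)"
    unfolding integral_lborel_product[OF ai ai] airy_int_def ..
  finally show ?eqx
    unfolding shift by (simp add: scaleR_conv_of_real power2_eq_square power3_eq_cube mult_ac)
qed

text \<open>The approximating integrals are constant along the sequence of shifts, so the limit is
  their common value; the term \<open>- \<delta>\<close> of the amplitude disappears in the
  limit.\<close>

lemma
  shows osc_limit_1: "osc_limit 1 0 = of_real (2 * sqrt 3 * \<kappa>\<^sup>2) * (airy_int 0 1 airy_v * airy_int 0 1 airy_u)"
    and osc_limit_xi: "osc_limit 0 \<i> = of_real (2 * sqrt 3 * \<kappa> ^ 3) *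
      (airy_int 0 1 airy_v * airy_int 1 1 airy_u + airy_int 1 1 airy_v * airy_int 0 1 airy_u)"
proof -
  define \<delta> where "\<delta> n = 1 / real (Suc n)" for n
  have \<delta>: "0 < \<delta> n" "\<delta> n \<le> 1" for n by (auto simp: \<delta>_def)
  have \<delta>0: "\<delta> \<longlonglongrightarrow> 0"
    unfolding \<delta>_def using LIMSEQ_inverse_real_of_nat by (simp add: inverse_eq_divide)
  have "(\<lambda>n. LINT p|lborel. (1 + 0 * of_real (fst p)) * shift_cutoff (\<delta> n) p * osc p) \<longlonglongrightarrow> osc_limit 1 0"
    by (rule shift_cutoff_tendsto[OF \<delta> \<delta>0 tendsto_const])
  then show "osc_limit 1 0 = of_real (2 * sqrt 3 * \<kappa>\<^sup>2) * (airy_int 0 1 airy_v * airy_int 0 1 airy_u)"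
    using integral_shift_cutoff[OF \<delta>(1)] by (simp add: LIMSEQ_const_iff)
  have "(\<lambda>n. complex_of_real (- \<delta> n)) \<longlonglongrightarrow> of_real (- 0)"
    by (intro tendsto_intros \<delta>0)
  then have "(\<lambda>n. complex_of_real (- \<delta> n)) \<longlonglongrightarrow> 0" by simp
  then have "(\<lambda>n. LINT p|lborel. (of_real (- \<delta> n) + \<i> * of_real (fst p)) * shift_cutoff (\<delta> n) p * osc p) \<longlonglongrightarrow> osc_limit 0 \<i>"
    by (rule shift_cutoff_tendsto[OF \<delta> \<delta>0])
  then show "osc_limit 0 \<i> = of_real (2 * sqrt 3 * \<kappa> ^ 3) *
      (airy_int 0 1 airy_v * airy_int 1 1 airy_u + airy_int 1 1 airy_v * airy_int 0 1 airy_u)"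
    unfolding integral_shift_cutoff_amplitude[OF \<delta>(1)] LIMSEQ_const_iff by (rule sym)
qed

end

text \<open>Two candidate values are limits of the same integrals for any one normalised test
  function.\<close>

lemma oscillatory_integral_eqI:
  assumes "has_oscillatory_integral a \<phi> I"
  shows "oscillatory_integral a \<phi> = I"
  unfolding oscillatory_integral_def
proof (rule the_equality[where P = "has_oscillatory_integral a \<phi>", OF assms])
  fix J assume J: "has_oscillatory_integral a \<phi> J"
  obtain \<psi> where "test_function \<psi>" "\<psi> 0 = 1"
    using test_function_exists by blast
  with assms J show "J = I"
    unfolding has_oscillatory_integral_def
    by (meson tendsto_unique trivial_limit_at_right_real)
qed

context airy_phase
begin

lemma has_oscillatory_integral_kernelA:
  "has_oscillatory_integral (\<lambda>_. 1) (phase x y t) (kernelA x y t)"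
  and kernelA_eq: "kernelA x y t = of_real (2 * sqrt 3 * \<kappa>\<^sup>2) * (airy_int 0 1 airy_v * airy_int 0 1 airy_u)"
proof -
  have *: "has_oscillatory_integral (\<lambda>_. 1) (phase x y t) (osc_limit 1 0)"
    using test_function_cutoff_tendsto[of _ 1 0] by (simp add: has_oscillatory_integral_def)
  then show "has_oscillatory_integral (\<lambda>_. 1) (phase x y t) (kernelA x y t)"
    "kernelA x y t = of_real (2 * sqrt 3 * \<kappa>\<^sup>2) * (airy_int 0 1 airy_v * airy_int 0 1 airy_u)"
    using oscillatory_integral_eqI[OF *] by (simp_all add: kernelA_def osc_limit_1)
qed

lemma has_oscillatory_integral_kernelA_x:
  "has_oscillatory_integral (\<lambda>(\<xi>, \<eta>). \<i> * complex_of_real \<xi>) (phase x y t) (kernelA_x x y t)"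
  and kernelA_x_eq: "kernelA_x x y t = of_real (2 * sqrt 3 * \<kappa> ^ 3) *
      (airy_int 0 1 airy_v * airy_int 1 1 airy_u + airy_int 1 1 airy_v * airy_int 0 1 airy_u)"
proof -
  have *: "has_oscillatory_integral (\<lambda>(\<xi>, \<eta>). \<i> * complex_of_real \<xi>) (phase x y t) (osc_limit 0 \<i>)"
    using test_function_cutoff_tendsto[of _ 0 \<i>] by (simp add: has_oscillatory_integral_def split_beta)
  then show "has_oscillatory_integral (\<lambda>(\<xi>, \<eta>). \<i> * complex_of_real \<xi>) (phase x y t) (kernelA_x x y t)"
    "kernelA_x x y t = of_real (2 * sqrt 3 * \<kappa> ^ 3) *
      (airy_int 0 1 airy_v * airy_int 1 1 airy_u + airy_int 1 1 airy_v * airy_int 0 1 airy_u)"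
    using oscillatory_integral_eqI[OF *] by (simp_all add: kernelA_x_def osc_limit_xi)
qed

text \<open>Differentiates the closed form with Airy factors, which avoids differentiating an
  oscillatory integral.\<close>

lemma kernelA_has_derivative: "((\<lambda>x. kernelA x y t) has_vector_derivative kernelA_x x y t) (at x)"
proof -
  have A: "(airy_int 0 1 has_vector_derivative airy_int 1 1 u) (at u)" for u
    using airy_int_has_derivative[of 1 0 u] by simp
  have chain: "((\<lambda>x'. airy_int 0 1 (\<kappa> * (x' + c))) has_vector_derivative \<kappa> *\<^sub>R airy_int 1 1 (\<kappa> * (x + c))) (at x)" for c
  proof -
    have "(airy_int 0 1 \<circ> (\<lambda>x'. \<kappa> * (x' + c)) has_vector_derivative \<kappa> *\<^sub>R airy_int 1 1 (\<kappa> * (x + c))) (at x)"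
      by (rule vector_diff_chain_at[OF _ A]) (auto intro!: derivative_eq_intros)
    then show ?thesis by (simp add: o_def)
  qed
  have "kernelA x' y t = of_real (2 * sqrt 3 * \<kappa>\<^sup>2) * (airy_int 0 1 (\<kappa> * (x' + - (sqrt 3 * y))) * airy_int 0 1 (\<kappa> * (x' + sqrt 3 * y)))" for x'
  proof -
    \<comment> \<open>\<open>\<kappa>\<close> depends on \<open>t\<close> alone, so both
      interpretations share it.\<close>
    interpret shifted: airy_phase t x' y by unfold_locales (rule t)
    show ?thesis using shifted.kernelA_eq by simp
  qed
  moreover have "((\<lambda>x'. of_real (2 * sqrt 3 * \<kappa>\<^sup>2) * (airy_int 0 1 (\<kappa> * (x' + - (sqrt 3 * y))) * airy_int 0 1 (\<kappa> * (x' + sqrt 3 * y))))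
      has_vector_derivative of_real (2 * sqrt 3 * \<kappa>\<^sup>2) *
        (airy_int 0 1 (\<kappa> * (x + - (sqrt 3 * y))) * (\<kappa> *\<^sub>R airy_int 1 1 (\<kappa> * (x + sqrt 3 * y)))
          + \<kappa> *\<^sub>R airy_int 1 1 (\<kappa> * (x + - (sqrt 3 * y))) * airy_int 0 1 (\<kappa> * (x + sqrt 3 * y)))) (at x)"
    by (intro bounded_linear.has_vector_derivative[OF bounded_linear_mult_right] has_vector_derivative_mult chain)
  ultimately show ?thesis
    by (simp add: kernelA_x_eq scaleR_conv_of_real power2_eq_square power3_eq_cube algebra_simps)
qed

end

section \<open>The estimates\<close>

lemma japanese_bracket_powr: "japanese_bracket a powr c = (1 + a\<^sup>2) powr (c / 2)"
proof -
  have "japanese_bracket a = (1 + a\<^sup>2) powr (1 / 2)"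
    by (simp add: japanese_bracket_def powr_half_sqrt)
  then show ?thesis by (simp add: powr_powr)
qed

definition airy_product :: "real \<Rightarrow> real \<Rightarrow> complex" where
  "airy_product u v = airy_int 0 1 v * airy_int 1 1 u + airy_int 1 1 v * airy_int 0 1 u"

text \<open>One argument is at least \<open>q\<close> and contributes \<open>exp (- q)\<close>. The
  other may be far to the left, but only as far as \<open>8 * q\<close>, so its growth is polynomial
  in \<open>q\<close> and is absorbed together with any power of 1 + 4 q^3.\<close>

lemma airy_product_decay:
  fixes \<beta> :: real
  assumes \<beta>: "\<beta> \<ge> 0"
  obtains C where "C > 0"
    "\<And>q u v. 0 \<le> q \<Longrightarrow> q \<le> max u v \<Longrightarrow> \<bar>u\<bar> \<le> 8 * q \<Longrightarrow> \<bar>v\<bar> \<le> 8 * q \<Longrightarrow>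
      norm (airy_product u v) \<le> C * (1 + 4 * q ^ 3) powr (- \<beta> / 2)"
proof -
  obtain M where M: "M > 0"
    "\<And>u. norm (airy_int 0 1 u) \<le> M" "\<And>u. norm (airy_int 1 1 u) \<le> M * (1 + \<bar>u\<bar>) powr (1 / 4)"
    "\<And>u. norm (airy_int 0 1 u) \<le> M * exp (- u)" "\<And>u. norm (airy_int 1 1 u) \<le> M * exp (- u)"
    using airy_int_bounds by blast
  \<comment> \<open>The target weight is at most (2 (1 + q))^(3 \<beta> / 2); rounding the exponent
    up allows comparison with one term of the exponential series.\<close>
  define n where "n = nat \<lceil>3 * \<beta> / 2\<rceil>"
  define C where "C = 16 * M\<^sup>2 * (2 ^ n * (fact (Suc n) * exp 1))"
  have main: "norm (airy_product u v) \<le> C * (1 + 4 * q ^ 3) powr (- \<beta> / 2)"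
    if q: "0 \<le> q" and uq: "q \<le> u" and v: "\<bar>v\<bar> \<le> 8 * q" for q u v
  proof -
    have e: "exp (- u) \<le> exp (- q)" using uq by simp
    have "norm (airy_int 0 1 v * airy_int 1 1 u) \<le> M * (M * exp (- u))"
      unfolding norm_mult using M by (intro mult_mono) auto
    also have "\<dots> \<le> M * (M * exp (- q))"
      using M(1) e by (intro mult_left_mono) auto
    finally have 1: "norm (airy_int 0 1 v * airy_int 1 1 u) \<le> M\<^sup>2 * exp (- q)"
      by (simp add: power2_eq_square)
    have "(1 + \<bar>v\<bar>) powr (1 / 4) \<le> (1 + \<bar>v\<bar>) powr 1"
      by (intro powr_mono) auto
    also have "\<dots> \<le> 1 + 8 * q" using v by simp
    finally have v4: "(1 + \<bar>v\<bar>) powr (1 / 4) \<le> 1 + 8 * q" .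
    have "norm (airy_int 1 1 v * airy_int 0 1 u) \<le> (M * (1 + \<bar>v\<bar>) powr (1 / 4)) * (M * exp (- u))"
      unfolding norm_mult using M by (intro mult_mono) auto
    also have "\<dots> \<le> (M * (1 + 8 * q)) * (M * exp (- q))"
      using M(1) e v4 q by (intro mult_mono mult_left_mono) auto
    finally have 2: "norm (airy_int 1 1 v * airy_int 0 1 u) \<le> M\<^sup>2 * exp (- q) * (1 + 8 * q)"
      by (simp add: power2_eq_square mult_ac)
    have "norm (airy_product u v) \<le> M\<^sup>2 * exp (- q) + M\<^sup>2 * exp (- q) * (1 + 8 * q)"
      unfolding airy_product_def by (intro norm_triangle_le add_mono 1 2)
    also have "\<dots> = M\<^sup>2 * exp (- q) * (2 + 8 * q)"
      by (simp add: algebra_simps)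
    also have "\<dots> \<le> M\<^sup>2 * exp (- q) * (16 * (1 + q))"
      using q by (intro mult_left_mono) auto
    finally have N: "norm (airy_product u v) \<le> 16 * M\<^sup>2 * ((1 + q) * exp (- q))"
      by (simp add: algebra_simps)
    have "(1 + 4 * q ^ 3) powr (\<beta> / 2) \<le> ((2 * (1 + q)) ^ 3) powr (\<beta> / 2)"
      using q \<beta> by (intro powr_mono2) (auto simp: power3_eq_cube algebra_simps)
    also have "\<dots> = ((2 * (1 + q)) powr real 3) powr (\<beta> / 2)"
      using q by (subst powr_realpow) auto
    also have "\<dots> = (2 * (1 + q)) powr (3 * \<beta> / 2)"
      by (simp add: powr_powr)
    also have "\<dots> \<le> (2 * (1 + q)) powr (real n)"
      using q unfolding n_def by (intro powr_mono real_nat_ceiling_ge) auto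
    also have "\<dots> = (2 * (1 + q)) ^ n"
      using q by (subst powr_realpow) auto
    also have "\<dots> = 2 ^ n * (1 + q) ^ n"
      by (rule power_mult_distrib)
    finally have P: "(1 + 4 * q ^ 3) powr (\<beta> / 2) \<le> 2 ^ n * (1 + q) ^ n" .
    have "((1 + q) * exp (- q)) * (1 + 4 * q ^ 3) powr (\<beta> / 2) \<le> ((1 + q) * exp (- q)) * (2 ^ n * (1 + q) ^ n)"
      using P q by (intro mult_left_mono) auto
    also have "\<dots> = 2 ^ n * ((1 + q) ^ Suc n * exp (- q))"
      by (simp add: mult_ac)
    also have "\<dots> \<le> 2 ^ n * ((fact (Suc n) * exp (1 + q)) * exp (- q))"
      using q by (intro mult_left_mono mult_right_mono power_le_fact_exp) auto
    also have "\<dots> = 2 ^ n * (fact (Suc n) * exp 1)"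
      by (simp add: mult.assoc flip: exp_add)
    finally have "((1 + q) * exp (- q)) * (1 + 4 * q ^ 3) powr (\<beta> / 2) \<le> 2 ^ n * (fact (Suc n) * exp 1)" .
    moreover have pos: "1 + 4 * q ^ 3 > 0" using q by (intro add_pos_nonneg) auto
    ultimately have "(1 + q) * exp (- q) \<le> 2 ^ n * (fact (Suc n) * exp 1) * (1 + 4 * q ^ 3) powr (- \<beta> / 2)"
      by (simp add: powr_minus pos_le_divide_eq flip: divide_inverse)
    then have "16 * M\<^sup>2 * ((1 + q) * exp (- q)) \<le> 16 * M\<^sup>2 * (2 ^ n * (fact (Suc n) * exp 1) * (1 + 4 * q ^ 3) powr (- \<beta> / 2))"
      by (intro mult_left_mono) auto
    with N show ?thesis by (simp only: C_def mult.assoc)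
  qed
  show ?thesis
  proof (rule that)
    show "C > 0" using M(1) by (simp add: C_def)
    show "norm (airy_product u v) \<le> C * (1 + 4 * q ^ 3) powr (- \<beta> / 2)"
      if "0 \<le> q" "q \<le> max u v" "\<bar>u\<bar> \<le> 8 * q" "\<bar>v\<bar> \<le> 8 * q" for q u v
    proof (cases "q \<le> u")
      case True
      then show ?thesis using main that by blast
    next
      case False
      then have "q \<le> v" using that by auto
      then have "norm (airy_product v u) \<le> C * (1 + 4 * q ^ 3) powr (- \<beta> / 2)"
        using main that by blast
      then show ?thesis by (simp add: airy_product_def mult.commute add.commute)
    qed
  qed
qed

text \<open>Each summand contains one bounded factor and one of growth 1/4. As q is at most (1 + 4
  q^3)^(1/3), the exponent becomes 1/12, half of the 1/6 on the bracket.\<close>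

lemma airy_product_growth:
  obtains C where "C > 0"
    "\<And>q u v. 0 \<le> q \<Longrightarrow> \<bar>u\<bar> \<le> 8 * q \<Longrightarrow> \<bar>v\<bar> \<le> 8 * q \<Longrightarrow>
      norm (airy_product u v) \<le> C * (1 + 4 * q ^ 3) powr (1 / 12)"
proof -
  obtain M where M: "M > 0"
    "\<And>u. norm (airy_int 0 1 u) \<le> M" "\<And>u. norm (airy_int 1 1 u) \<le> M * (1 + \<bar>u\<bar>) powr (1 / 4)"
    "\<And>u. norm (airy_int 0 1 u) \<le> M * exp (- u)" "\<And>u. norm (airy_int 1 1 u) \<le> M * exp (- u)"
    using airy_int_bounds by blast
  show ?thesis
  proof (rule that)
    show "2 * M\<^sup>2 * 9 powr (1 / 4) > 0" using M by simp
    fix q u v :: real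
    assume q: "0 \<le> q" and u: "\<bar>u\<bar> \<le> 8 * q" and v: "\<bar>v\<bar> \<le> 8 * q"
    define R where "R = (1 + 4 * q ^ 3) powr (1 / 3)"
    have ge1: "1 + 4 * q ^ 3 \<ge> 1" using q by simp
    have "R \<ge> 1" unfolding R_def by (intro ge_one_powr_ge_zero ge1) auto
    moreover have "q \<le> R"
    proof (rule power_le_imp_le_base)
      have "R ^ Suc 2 = R powr (real 3)"
        using \<open>R \<ge> 1\<close> by (subst powr_realpow) auto
      also have "\<dots> = 1 + 4 * q ^ 3"
        using ge1 by (simp add: R_def powr_powr)
      finally show "q ^ Suc 2 \<le> R ^ Suc 2" using q by simp
    qed (use \<open>R \<ge> 1\<close> in simp)
    ultimately have R: "1 + 8 * q \<le> 9 * R" "0 \<le> R" by linarith+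
    have g: "(1 + \<bar>r\<bar>) powr (1 / 4) \<le> 9 powr (1 / 4) * (1 + 4 * q ^ 3) powr (1 / 12)" if "\<bar>r\<bar> \<le> 8 * q" for r
    proof -
      have "(1 + \<bar>r\<bar>) powr (1 / 4) \<le> (9 * R) powr (1 / 4)"
        using that R by (intro powr_mono2) auto
      also have "\<dots> = 9 powr (1 / 4) * (1 + 4 * q ^ 3) powr (1 / 12)"
        using R by (simp add: powr_mult) (simp add: R_def powr_powr)
      finally show ?thesis .
    qed
    define E where "E = 9 powr (1 / 4) * (1 + 4 * q ^ 3) powr (1 / 12)"
    have b: "norm (airy_int 1 1 r) \<le> M * E" if "\<bar>r\<bar> \<le> 8 * q" for r
      using order_trans[OF M(3) mult_left_mono[OF g[OF that], of M]] M(1) by (simp add: E_def)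
    have "norm (airy_product u v) \<le> M * (M * E) + (M * E) * M"
      unfolding airy_product_def
      by (rule norm_triangle_le, unfold norm_mult, intro add_mono mult_mono M(2) b u v) (use M(1) in \<open>auto simp: E_def\<close>)
    then show "norm (airy_product u v) \<le> 2 * M\<^sup>2 * 9 powr (1 / 4) * (1 + 4 * q ^ 3) powr (1 / 12)"
      by (simp add: E_def power2_eq_square mult_ac)
  qed
qed

section \<open>Scaling and the position of the Airy arguments\<close>

context airy_phase
begin

lemma norm_kernelA_x_le: "norm (kernelA_x x y t) \<le> 1 / t * norm (airy_product airy_u airy_v)"
proof -
  have "2 * sqrt 3 * \<kappa> ^ 3 = sqrt 3 / 2 * (1 / t)"
    using \<kappa>_cube t by (simp add: field_simps)
  moreover have "sqrt 3 / 2 \<le> 1"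
    using real_sqrt_le_mono[of 3 4] by simp
  ultimately have k: "2 * sqrt 3 * \<kappa> ^ 3 \<le> 1 / t"
    using t mult_right_mono[of "sqrt 3 / 2" 1 "1 / t"] by simp
  have "norm (kernelA_x x y t) = 2 * sqrt 3 * \<kappa> ^ 3 * norm (airy_product airy_u airy_v)"
    using \<kappa>_pos by (simp add: kernelA_x_eq airy_product_def norm_mult norm_power)
  with mult_right_mono[OF k norm_ge_zero] show ?thesis
    by (simp only:)
qed

text \<open>Taken with r = |x| it rewrites the bracket of \<lambda>, and with r = |y| that of
  \<lambda> |z|^(3/2).\<close>

lemma japanese_bracket_scaling:
  assumes "r \<ge> 0"
  shows "japanese_bracket (r powr (3 / 2) * t powr (- 1 / 2)) powr c = (1 + 4 * (\<kappa> * r) ^ 3) powr (c / 2)"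
proof -
  have "(r powr (3 / 2) * t powr (- 1 / 2))\<^sup>2 = r ^ 3 / t"
  proof -
    have "(r powr (3 / 2))\<^sup>2 = r ^ 3"
    proof (cases "r = 0")
      case False
      have "(r powr (3 / 2))\<^sup>2 = r powr (real 3)"
        using False assms by (simp add: power2_eq_square flip: powr_add)
      then show ?thesis using False assms by (simp only: powr_realpow)
    qed simp
    moreover have "(t powr (- 1 / 2))\<^sup>2 = 1 / t"
      using t by (simp add: power2_eq_square powr_minus_divide flip: powr_add)
    ultimately show ?thesis by (simp add: power_mult_distrib)
  qed
  also have "\<dots> = 4 * (\<kappa> * r) ^ 3"
    using \<kappa>_cube t by (simp add: power_mult_distrib field_simps)
  finally show ?thesis
    by (simp add: japanese_bracket_powr)
qed

text \<open>The constant is 8 = 1 + 4 (7/4), with 7/4 an upper bound for sqrt 3. The hypotheses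
  cover r = |x| if |z| \<le> 4 and r = |y| if |z| \<ge> 4.\<close>

lemma abs_airy_uv_le:
  assumes "\<bar>x\<bar> \<le> r" "\<bar>y\<bar> \<le> 4 * r"
  shows "\<bar>airy_u\<bar> \<le> 8 * (\<kappa> * r)" "\<bar>airy_v\<bar> \<le> 8 * (\<kappa> * r)"
proof -
  have "sqrt 3 \<le> 7 / 4" by (rule real_le_lsqrt) (auto simp: power2_eq_square)
  then have "sqrt 3 * \<bar>y\<bar> \<le> 7 / 4 * (4 * r)"
    using assms by (intro mult_mono) auto
  then have s: "\<bar>sqrt 3 * y\<bar> \<le> 7 * r"
    by (simp add: abs_mult)
  have "\<bar>x + sqrt 3 * y\<bar> \<le> 8 * r" "\<bar>x - sqrt 3 * y\<bar> \<le> 8 * r"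
    using s assms by linarith+
  then show "\<bar>airy_u\<bar> \<le> 8 * (\<kappa> * r)" "\<bar>airy_v\<bar> \<le> 8 * (\<kappa> * r)"
    using \<kappa>_pos by (simp_all add: abs_mult)
qed

lemma max_airy_uv_ge:
  "\<kappa> * (x + sqrt 3 * \<bar>y\<bar>) \<le> max airy_u airy_v"
proof (cases "y \<ge> 0")
  case True
  then have "\<bar>y\<bar> = y" by simp
  then show ?thesis by (simp only: max.cobounded1)
next
  case False
  then have "\<bar>y\<bar> = - y" by simp
  then have "\<kappa> * (x + sqrt 3 * \<bar>y\<bar>) = airy_v" by (simp only: mult_minus_right add_uminus_conv_diff)
  then show ?thesis by (simp only: max.cobounded2)
qed

end

theorem proposition9p2:
  "(\<forall>t>0. \<forall>x y.
      has_oscillatory_integral (\<lambda>_. 1) (phase x y t) (kernelA x y t) \<and>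
      has_oscillatory_integral (\<lambda>(\<xi>, \<eta>). \<i> * complex_of_real \<xi>) (phase x y t) (kernelA_x x y t) \<and>
      ((\<lambda>x. kernelA x y t) has_vector_derivative kernelA_x x y t) (at x)) \<and>
   (\<forall>\<alpha>\<ge>0. \<forall>\<beta>\<ge>0. \<exists>C>0. \<forall>t>0. \<forall>x>0. \<forall>y.
      let l = \<bar>x\<bar> powr (3/2) * t powr (-1/2); z = y / \<bar>x\<bar> in
        (\<bar>z\<bar> \<le> 4 \<longrightarrow>
           norm (kernelA_x x y t) \<le> C * (1 / t) * japanese_bracket l powr (-\<alpha>)) \<and>
        (\<bar>z\<bar> \<ge> 4 \<longrightarrow>
           norm (kernelA_x x y t) \<le> C * (1 / t) * japanese_bracket (l * \<bar>z\<bar> powr (3/2)) powr (-\<beta>))) \<and>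
   (\<forall>\<beta>\<ge>0. \<exists>C>0. \<forall>t>0. \<forall>x<0. \<forall>y.
      let l = \<bar>x\<bar> powr (3/2) * t powr (-1/2); z = y / \<bar>x\<bar> in
        (\<bar>z\<bar> \<le> 4 \<longrightarrow>
           norm (kernelA_x x y t) \<le> C * (1 / t) * japanese_bracket l powr (1/6)) \<and>
        (\<bar>z\<bar> \<ge> 4 \<longrightarrow>
           norm (kernelA_x x y t) \<le> C * (1 / t) * japanese_bracket (l * \<bar>z\<bar> powr (3/2)) powr (-\<beta>)))"
proof -
  let ?l = "\<lambda>t x. \<bar>x :: real\<bar> powr (3/2) * t powr (-1/2)"
  let ?near = "\<lambda>C e t x y. norm (kernelA_x x y t) \<le> C * (1 / t) * japanese_bracket (?l t x) powr e"
  let ?far = "\<lambda>C \<beta> t x y. norm (kernelA_x x y t) \<le> C * (1 / t) * japanese_bracket (?l t x * \<bar>y / \<bar>x\<bar>\<bar> powr (3/2)) powr (-\<beta>)"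
  have far: "\<exists>C>0. \<forall>t>0. \<forall>x y. x \<noteq> 0 \<longrightarrow> 4 \<le> \<bar>y / \<bar>x\<bar>\<bar> \<longrightarrow>
      ?far C \<beta> t x y" if \<beta>: "\<beta> \<ge> 0" for \<beta> :: real
  proof -
    obtain C where C: "C > 0" "\<And>q u v. 0 \<le> q \<Longrightarrow> q \<le> max u v \<Longrightarrow> \<bar>u\<bar> \<le> 8 * q \<Longrightarrow> \<bar>v\<bar> \<le> 8 * q \<Longrightarrow>
        norm (airy_product u v) \<le> C * (1 + 4 * q ^ 3) powr (- \<beta> / 2)"
      using airy_product_decay[OF \<beta>] by blast
    have "?far C \<beta> t x y"
      if t: "t > 0" and x: "x \<noteq> 0" and z: "4 \<le> \<bar>y / \<bar>x\<bar>\<bar>" for t x y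
    proof -
      interpret airy_phase t x y by unfold_locales (rule t)
      have xy: "4 * \<bar>x\<bar> \<le> \<bar>y\<bar>"
        using z x by (simp add: le_divide_eq abs_divide)
      \<comment> \<open>As x \<ge> -|y| / 4 whatever its sign, 5/4 |y| is just enough for x + sqrt 3
        |y| \<ge> |y|. The same bound thus serves both half-planes.\<close>
      have "sqrt 3 \<ge> 5 / 4" by (rule real_le_rsqrt) (simp add: power2_eq_square)
      then have "5 / 4 * \<bar>y\<bar> \<le> sqrt 3 * \<bar>y\<bar>" by (intro mult_right_mono) auto
      then have "\<bar>y\<bar> \<le> x + sqrt 3 * \<bar>y\<bar>" using xy by linarith
      then have "\<kappa> * \<bar>y\<bar> \<le> max airy_u airy_v"
        using \<kappa>_pos max_airy_uv_ge order_trans[OF mult_left_mono[of "\<bar>y\<bar>" "x + sqrt 3 * \<bar>y\<bar>" \<kappa>]] by simp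
      then have N: "norm (airy_product airy_u airy_v) \<le> C * (1 + 4 * (\<kappa> * \<bar>y\<bar>) ^ 3) powr (- \<beta> / 2)"
        using \<kappa>_pos xy by (intro C abs_airy_uv_le) auto
      have "\<bar>x\<bar> powr (3/2) * t powr (-1/2) * \<bar>y / \<bar>x\<bar>\<bar> powr (3/2) = \<bar>y\<bar> powr (3/2) * t powr (-1/2)"
        using x by (simp add: abs_divide powr_divide)
      then have "japanese_bracket (\<bar>x\<bar> powr (3/2) * t powr (-1/2) * \<bar>y / \<bar>x\<bar>\<bar> powr (3/2)) powr (-\<beta>)
          = (1 + 4 * (\<kappa> * \<bar>y\<bar>) ^ 3) powr (- \<beta> / 2)"
        by (simp only: japanese_bracket_scaling[OF abs_ge_zero])
      with norm_kernelA_x_le mult_left_mono[OF N, of "1 / t"] t show ?thesis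
        by (simp only:) (simp add: mult_ac)
    qed
    with C(1) show ?thesis by blast
  qed
  have near_pos: "\<exists>C>0. \<forall>t>0. \<forall>x>0. \<forall>y. \<bar>y / \<bar>x\<bar>\<bar> \<le> 4 \<longrightarrow>
      ?near C (-\<alpha>) t x y" if \<alpha>: "\<alpha> \<ge> 0" for \<alpha> :: real
  proof -
    obtain C where C: "C > 0" "\<And>q u v. 0 \<le> q \<Longrightarrow> q \<le> max u v \<Longrightarrow> \<bar>u\<bar> \<le> 8 * q \<Longrightarrow> \<bar>v\<bar> \<le> 8 * q \<Longrightarrow>
        norm (airy_product u v) \<le> C * (1 + 4 * q ^ 3) powr (- \<alpha> / 2)"
      using airy_product_decay[OF \<alpha>] by blast
    have "?near C (-\<alpha>) t x y"
      if t: "t > 0" and x: "x > 0" and z: "\<bar>y / \<bar>x\<bar>\<bar> \<le> 4" for t x y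
    proof -
      interpret airy_phase t x y by unfold_locales (rule t)
      have xy: "\<bar>y\<bar> \<le> 4 * \<bar>x\<bar>"
        using z x unfolding abs_divide abs_abs by (subst (asm) pos_divide_le_eq) auto
      have "\<kappa> * \<bar>x\<bar> \<le> max airy_u airy_v"
        using \<kappa>_pos x by (intro order_trans[OF mult_left_mono max_airy_uv_ge]) auto
      then have N: "norm (airy_product airy_u airy_v) \<le> C * (1 + 4 * (\<kappa> * \<bar>x\<bar>) ^ 3) powr (- \<alpha> / 2)"
        using \<kappa>_pos xy by (intro C abs_airy_uv_le) auto
      with norm_kernelA_x_le mult_left_mono[OF N, of "1 / t"] t show ?thesis
        by (simp only: japanese_bracket_scaling[OF abs_ge_zero]) (simp add: mult_ac)
    qed
    with C(1) show ?thesis by blast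
  qed
  have near_neg: "\<exists>C>0. \<forall>t>0. \<forall>x<0. \<forall>y. \<bar>y / \<bar>x\<bar>\<bar> \<le> 4 \<longrightarrow>
      ?near C (1/6) t x y"
  proof -
    obtain C where C: "C > 0" "\<And>q u v. 0 \<le> q \<Longrightarrow> \<bar>u\<bar> \<le> 8 * q \<Longrightarrow> \<bar>v\<bar> \<le> 8 * q \<Longrightarrow>
        norm (airy_product u v) \<le> C * (1 + 4 * q ^ 3) powr (1 / 12)"
      using airy_product_growth by blast
    have "?near C (1/6) t x y"
      if t: "t > 0" and x: "x < 0" and z: "\<bar>y / \<bar>x\<bar>\<bar> \<le> 4" for t x y
    proof -
      interpret airy_phase t x y by unfold_locales (rule t)
      have xy: "\<bar>y\<bar> \<le> 4 * \<bar>x\<bar>"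
        using z x unfolding abs_divide abs_abs by (subst (asm) pos_divide_le_eq) auto
      \<comment> \<open>For x < 0 the larger argument may be negative, for instance at y = 0, so
        only the growth bound is available.\<close>
      have N: "norm (airy_product airy_u airy_v) \<le> C * (1 + 4 * (\<kappa> * \<bar>x\<bar>) ^ 3) powr (1 / 12)"
        using \<kappa>_pos xy by (intro C abs_airy_uv_le) auto
      have "japanese_bracket (\<bar>x\<bar> powr (3/2) * t powr (-1/2)) powr (1/6) = (1 + 4 * (\<kappa> * \<bar>x\<bar>) ^ 3) powr (1 / 12)"
        by (subst japanese_bracket_scaling) auto
      with norm_kernelA_x_le mult_left_mono[OF N, of "1 / t"] t show ?thesis
        by (simp only:) (simp add: mult_ac)
    qed
    with C(1) show ?thesis by blast
  qed
  have widen: "a \<le> C' * (1 / t) * b" if "a \<le> C * (1 / t) * b" "C \<le> C'" "t > 0" "b \<ge> 0" for a b C C' t :: real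
  proof -
    have "C * (1 / t) * b \<le> C' * (1 / t) * b"
      using that by (intro mult_right_mono) auto
    with that(1) show ?thesis by linarith
  qed
  show ?thesis
  proof (intro conjI allI impI)
    fix t x y :: real assume t: "t > 0"
    interpret airy_phase t x y by unfold_locales (rule t)
    show "has_oscillatory_integral (\<lambda>_. 1) (phase x y t) (kernelA x y t)"
      "has_oscillatory_integral (\<lambda>(\<xi>, \<eta>). \<i> * complex_of_real \<xi>) (phase x y t) (kernelA_x x y t)"
      "((\<lambda>x. kernelA x y t) has_vector_derivative kernelA_x x y t) (at x)"
      by (rule has_oscillatory_integral_kernelA has_oscillatory_integral_kernelA_x kernelA_has_derivative)+
  next
    fix \<alpha> \<beta> :: real assume "\<alpha> \<ge> 0" "\<beta> \<ge> 0"
    from near_pos[OF this(1)] obtain C1 where C1: "C1 > 0" "\<forall>t>0. \<forall>x>0. \<forall>y. \<bar>y / \<bar>x\<bar>\<bar> \<le> 4 \<longrightarrow> ?near C1 (- \<alpha>) t x y"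
      by (elim exE conjE)
    from far[OF \<open>\<beta> \<ge> 0\<close>] obtain C2 where C2: "C2 > 0" "\<forall>t>0. \<forall>x y. x \<noteq> 0 \<longrightarrow> 4 \<le> \<bar>y / \<bar>x\<bar>\<bar> \<longrightarrow> ?far C2 \<beta> t x y"
      by (elim exE conjE)
    show "\<exists>C>0. \<forall>t>0. \<forall>x>0. \<forall>y.
      let l = \<bar>x\<bar> powr (3/2) * t powr (-1/2); z = y / \<bar>x\<bar> in
        (\<bar>z\<bar> \<le> 4 \<longrightarrow>
           norm (kernelA_x x y t) \<le> C * (1 / t) * japanese_bracket l powr (-\<alpha>)) \<and>
        (\<bar>z\<bar> \<ge> 4 \<longrightarrow>
           norm (kernelA_x x y t) \<le> C * (1 / t) * japanese_bracket (l * \<bar>z\<bar> powr (3/2)) powr (-\<beta>))"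
      unfolding Let_def
    proof (intro exI[of _ "max C1 C2"] conjI allI impI)
      show "max C1 C2 > 0" using C1 by simp
    next
      fix t x y :: real assume h: "t > 0" "x > 0"
      show "?near (max C1 C2) (-\<alpha>) t x y"
        if "\<bar>y / \<bar>x\<bar>\<bar> \<le> 4"
        by (rule widen[OF C1(2)[rule_format, OF h that]]) (use h in auto)
      show "?far (max C1 C2) \<beta> t x y"
        if "4 \<le> \<bar>y / \<bar>x\<bar>\<bar>"
        by (rule widen[OF C2(2)[rule_format, OF h(1) _ that]]) (use h in auto)
    qed
  next
    fix \<beta> :: real assume "\<beta> \<ge> 0"
    from near_neg obtain C1 where C1: "C1 > 0" "\<forall>t>0. \<forall>x<0. \<forall>y. \<bar>y / \<bar>x\<bar>\<bar> \<le> 4 \<longrightarrow> ?near C1 (1/6) t x y"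
      by (elim exE conjE)
    from far[OF \<open>\<beta> \<ge> 0\<close>] obtain C2 where C2: "C2 > 0" "\<forall>t>0. \<forall>x y. x \<noteq> 0 \<longrightarrow> 4 \<le> \<bar>y / \<bar>x\<bar>\<bar> \<longrightarrow> ?far C2 \<beta> t x y"
      by (elim exE conjE)
    show "\<exists>C>0. \<forall>t>0. \<forall>x<0. \<forall>y.
      let l = \<bar>x\<bar> powr (3/2) * t powr (-1/2); z = y / \<bar>x\<bar> in
        (\<bar>z\<bar> \<le> 4 \<longrightarrow>
           norm (kernelA_x x y t) \<le> C * (1 / t) * japanese_bracket l powr (1/6)) \<and>
        (\<bar>z\<bar> \<ge> 4 \<longrightarrow>
           norm (kernelA_x x y t) \<le> C * (1 / t) * japanese_bracket (l * \<bar>z\<bar> powr (3/2)) powr (-\<beta>))"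
      unfolding Let_def
    proof (intro exI[of _ "max C1 C2"] conjI allI impI)
      show "max C1 C2 > 0" using C1 by simp
    next
      fix t x y :: real assume h: "t > 0" "x < 0"
      show "?near (max C1 C2) (1/6) t x y"
        if "\<bar>y / \<bar>x\<bar>\<bar> \<le> 4"
        by (rule widen[OF C1(2)[rule_format, OF h that]]) (use h in auto)
      show "?far (max C1 C2) \<beta> t x y"
        if "4 \<le> \<bar>y / \<bar>x\<bar>\<bar>"
        by (rule widen[OF C2(2)[rule_format, OF h(1) _ that]]) (use h in auto)
    qed
  qed
qed

end
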